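(* Let $N$ be any positive integer and $k>2$ any integer. Then $\sup(S_k(N))\asymp_k 1$. The same holds with $\Gamma_0(N)$ replaced by any principal congruence subgroup $\Gamma(N)$, and for half-integral weights $\kappa\ge 5/2$ with square-free level.
   Context: $S_k(N)$ denotes holomorphic cusp forms of weight $k$ on $\Gamma_0(N)$ (for half-integral weight $\kappa$: cusp forms on $\Gamma_0(4N)$ with the standard theta multiplier). For an orthonormal basis $\mathcal B$ (Petersson inner product) of the space, $\sup(S_k(N)):=\sup_{\tau\in\mathbf H}\sum_{f\in\mathcal B}v^k|f(\tau)|^2$, $v=\mathrm{Im}\tau$.
   Formalization: The lower bound is stated only for nonzero spaces of cusp forms; when the space is {0} (for example every odd k on Γ_0(N)) the sup is 0 and the claimed lower bound fails. The upper bound holds for all levels. *)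

theory Defs
  imports "HOL-Analysis.Analysis" "HOL-Computational_Algebra.Squarefree"
begin

definition upper_half_plane :: "complex set" where
  "upper_half_plane = {z. Im z > 0}"

definition SL2Z :: "(int^2^2) set" where
  "SL2Z = {A. det A = 1}"

definition Gamma0 :: "nat \<Rightarrow> (int^2^2) set" where
  "Gamma0 N = {A \<in> SL2Z. int N dvd A $ 2 $ 1}"

definition principal_congruence_subgroup :: "nat \<Rightarrow> (int^2^2) set" where
  "principal_congruence_subgroup N =
     {A \<in> SL2Z. \<forall>i j. int N dvd (A $ i $ j - (mat 1 :: int^2^2) $ i $ j)}"

definition denom :: "int^2^2 \<Rightarrow> complex \<Rightarrow> complex" where
  "denom A z = of_int (A $ 2 $ 1) * z + of_int (A $ 2 $ 2)"

definition moebius_action :: "int^2^2 \<Rightarrow> complex \<Rightarrow> complex" where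
  "moebius_action A z = (of_int (A $ 1 $ 1) * z + of_int (A $ 1 $ 2)) / denom A z"

definition theta :: "complex \<Rightarrow> complex" where
  "theta z = (\<Sum>\<^sub>\<infinity>n\<in>(UNIV :: int set). exp (2 * of_real pi * \<i> * of_int (n\<^sup>2) * z))"

text \<open>
  Cusp forms of real weight \<open>\<kappa>\<close> on \<open>\<Gamma>\<close> with automorphy factor \<open>J\<close>. A form is a function on the
  upper half plane; it is represented by its extension by \<open>0\<close>, so that equality of forms is
  equality of functions. The last condition is vanishing at the cusp \<open>A \<infinity>\<close>, uniformly in the
  real part; the branch chosen by \<open>powr\<close> only affects a factor of modulus one and is irrelevant.
\<close>

definition cusp_forms ::
    "real \<Rightarrow> (int^2^2) set \<Rightarrow> (int^2^2 \<Rightarrow> complex \<Rightarrow> complex) \<Rightarrow> (complex \<Rightarrow> complex) set" where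
  "cusp_forms \<kappa> \<Gamma> J =
     {f. f holomorphic_on upper_half_plane \<and>
         (\<forall>z. z \<notin> upper_half_plane \<longrightarrow> f z = 0) \<and>
         (\<forall>A\<in>\<Gamma>. \<forall>z\<in>upper_half_plane. f (moebius_action A z) = J A z * f z) \<and>
         (\<forall>A\<in>SL2Z. ((\<lambda>z. denom A z powr (- of_real \<kappa>) * f (moebius_action A z)) \<longlongrightarrow> 0)
                     (filtercomap Im at_top))}"

definition cusp_forms_integral :: "nat \<Rightarrow> (int^2^2) set \<Rightarrow> (complex \<Rightarrow> complex) set" where
  "cusp_forms_integral k \<Gamma> = cusp_forms (real k) \<Gamma> (\<lambda>A z. denom A z ^ k)"

text \<open>
  Weight \<open>j / 2\<close> on \<open>\<Gamma>\<^sub>0(4N)\<close>. The theta multiplier is encoded through the automorphy factor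
  \<open>\<theta>(A z) / \<theta>(z)\<close> of weight \<open>1/2\<close> itself rather than through its expression by
  quadratic residue symbols.
\<close>

definition cusp_forms_half_integral :: "nat \<Rightarrow> nat \<Rightarrow> (complex \<Rightarrow> complex) set" where
  "cusp_forms_half_integral j N =
     cusp_forms (real j / 2) (Gamma0 (4 * N))
       (\<lambda>A z. (theta (moebius_action A z) / theta z) ^ j)"

definition modular_fundamental_domain :: "complex set" where
  "modular_fundamental_domain =
     {z \<in> upper_half_plane. \<bar>Re z\<bar> \<le> 1 / 2 \<and> cmod z \<ge> 1}"

text \<open>The cosets \<open>{\<plusminus>1} \<Gamma> A\<close> in the full modular group.\<close>

definition pm_cosets :: "(int^2^2) set \<Rightarrow> (int^2^2) set set" where
  "pm_cosets \<Gamma> = (\<lambda>A. {B. \<exists>G\<in>\<Gamma>. B = G ** A \<or> B = - (G ** A)}) ` SL2Z"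

text \<open>
  The Petersson product is the integral of \<open>f(w) cnj(g(w)) Im(w)\<^sup>\<kappa>\<close> over \<open>\<Gamma>\<close> modulo the upper
  half plane with respect to the hyperbolic area, not normalised by the volume. For \<open>\<Gamma>\<close> of finite
  index, translates of the standard fundamental domain by representatives of \<open>{\<plusminus>1} \<Gamma> A\<close> form a
  fundamental domain for \<open>\<Gamma>\<close>; the integrand is \<open>\<Gamma>\<close>-invariant, so the representatives chosen
  do not matter.
\<close>

definition petersson ::
    "real \<Rightarrow> (int^2^2) set \<Rightarrow> (complex \<Rightarrow> complex) \<Rightarrow> (complex \<Rightarrow> complex) \<Rightarrow> complex" where
  "petersson \<kappa> \<Gamma> f g =
     (\<Sum>C\<in>pm_cosets \<Gamma>.
        LINT z : modular_fundamental_domain | lborel.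
          (let w = moebius_action (SOME A. A \<in> C) z
           in f w * cnj (g w) * of_real (Im w powr \<kappa> / (Im z)\<^sup>2)))"

definition orthonormal_basis ::
    "real \<Rightarrow> (int^2^2) set \<Rightarrow> (complex \<Rightarrow> complex) set \<Rightarrow> (complex \<Rightarrow> complex) set \<Rightarrow> bool" where
  "orthonormal_basis \<kappa> \<Gamma> V B \<longleftrightarrow>
     B \<subseteq> V \<and>
     (\<forall>f\<in>B. \<forall>g\<in>B. petersson \<kappa> \<Gamma> f g = (if f = g then 1 else 0)) \<and>
     (\<forall>f\<in>V. \<exists>T c. finite T \<and> T \<subseteq> B \<and> f = (\<lambda>z. \<Sum>b\<in>T. c b * b z))"

text \<open>
  The quantity \<open>sup(S)\<close>, computed from an orthonormal basis \<open>B\<close> of \<open>S\<close>. It takes values in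
  \<open>ennreal\<close>, so the sum and the supremum are meaningful without knowing that they are finite.
\<close>

definition basis_sup :: "real \<Rightarrow> (complex \<Rightarrow> complex) set \<Rightarrow> ennreal" where
  "basis_sup \<kappa> B =
     (SUP \<tau>\<in>upper_half_plane. \<Sum>\<^sub>\<infinity>f\<in>B. ennreal (Im \<tau> powr \<kappa> * (cmod (f \<tau>))\<^sup>2))"

end

theory Submission
  imports Defs "HOL-Complex_Analysis.Complex_Analysis" "HOL-Probability.Probability" "HOL-Real_Asymp.Real_Asymp"
begin

text \<open>
  If \<open>f\<close> is a form of weight \<open>\<kappa> = m / 2\<close>, then \<open>f\<^sup>4\<close> is a form of the even integral weight \<open>2 m\<close>
  without multiplier, so integral and half-integral weights can be treated together.

  Upper bound: \<open>|F|\<^sup>2 Im\<^sup>\<kappa>\<close> is at most a constant depending only on \<open>\<kappa>\<close> times the squared Petersson norm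
  of \<open>F\<close>. To see this, move the point to the standard fundamental domain. If its height \<open>v\<close> does not
  exceed the width \<open>h\<close> of the cusp, apply the mean value inequality on a square of half side \<open>v / 4\<close>;
  this square meets boundedly many translates of the fundamental domain, and every coset at most twice
  among the translates by a given matrix. If \<open>v > h\<close>, the exponential decay at the cusp reduces the
  claim to height \<open>h\<close>. For \<open>F = \<Sum>b. cnj (b \<tau>) * b\<close> over an orthonormal basis this bounds
  \<open>\<Sum>b. |b \<tau>|\<^sup>2 Im \<tau>\<^sup>\<kappa>\<close>.

  Lower bound: let \<open>P\<close> be the Poincare series of \<open>exp (2 \<pi> i z / h)\<close>. The upper bound, applied to \<open>P\<close>
  itself, controls its supremum by its norm, so the squared norm of \<open>P\<close> is at most a constant times the
  square of its \<open>L\<^sup>1\<close> norm, and the latter is estimated term by term. At the point \<open>i h\<close> the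
  terms with lower left entry \<open>0\<close> dominate as soon as the level is large. The finitely many remaining
  levels only contribute a minimum of positive constants.

  For half-integral weights one needs that \<open>\<theta>\<^sup>4\<close> has weight \<open>2\<close> on \<open>\<Gamma>\<^sub>0(4)\<close>, which is generated by \<open>-1\<close> and
  the upper and lower unipotent matrices, and that \<open>\<theta>\<close> has no zeros.
\<close>

section \<open>Integer matrices and Moebius transformations\<close>

no_notation fps_nth (infixl \<open>$\<close> 75)

text \<open>The level enters through two numbers only: the width h of the cusp at infinity and a
  divisor N of all lower left entries. What makes the lower bound uniform is that the powers of h
  balance. At i h the quantity |P|^2 Im^\<kappa> has order h^\<kappa>. Summed over the cosets, the
  terms of P are indexed by coprime rows (c, d) of the full modular group, each met at most h times,
  so the L^1 norm is at most h times an integral over the standard domain of size h^(\<kappa>/2 -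
  1); its square has order h^\<kappa> as well. Fourier coefficients, Kloosterman sums and dimension
  formulas do not enter. The assumption \<kappa> > 2 is met as a = \<kappa>/2 > 1: the exponent 2a
  of |c z + d| is split evenly between two lower bounds, one for each summation variable, and both
  sums converge. Fourth powers determine absolute values, and the estimates only see absolute
  values, so the roots of unity in a multiplier never have to be computed. As the Petersson product
  is a sum over cosets, the change of variables is needed for translations and z \<mapsto> -1/z
  alone.\<close>

definition mat2 :: "int \<Rightarrow> int \<Rightarrow> int \<Rightarrow> int \<Rightarrow> int^2^2" where
  "mat2 a b c d = vector [vector [a, b], vector [c, d]]"

lemma mat2_nth [simp]:
  "mat2 a b c d $ 1 $ 1 = a" "mat2 a b c d $ 1 $ 2 = b"
  "mat2 a b c d $ 2 $ 1 = c" "mat2 a b c d $ 2 $ 2 = d"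
  by (simp_all add: mat2_def)

lemma mat2_eq_iff:
  fixes A B :: "int^2^2"
  shows "A = B \<longleftrightarrow> A$1$1 = B$1$1 \<and> A$1$2 = B$1$2 \<and> A$2$1 = B$2$1 \<and> A$2$2 = B$2$2"
  by (auto simp: vec_eq_iff forall_2)

lemma mult2_nth:
  fixes A B :: "int^2^2"
  shows "(A ** B) $ i $ j = A$i$1 * B$1$j + A$i$2 * B$2$j"
  by (simp add: matrix_matrix_mult_def sum_2)

lemma one2_nth [simp]:
  "(mat 1 :: int^2^2) $ 1 $ 1 = 1" "(mat 1 :: int^2^2) $ 1 $ 2 = 0"
  "(mat 1 :: int^2^2) $ 2 $ 1 = 0" "(mat 1 :: int^2^2) $ 2 $ 2 = 1"
  by (simp_all add: mat_def)

lemma SL2Z_iff: "A \<in> SL2Z \<longleftrightarrow> A$1$1 * A$2$2 - A$1$2 * A$2$1 = 1"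
  by (simp add: SL2Z_def det_2)

lemma one_in_SL2Z [simp]: "mat 1 \<in> SL2Z"
  by (simp add: SL2Z_iff)

lemma SL2Z_mult: "A \<in> SL2Z \<Longrightarrow> B \<in> SL2Z \<Longrightarrow> A ** B \<in> SL2Z"
  by (simp add: SL2Z_def det_mul)

lemma SL2Z_uminus [simp]: "- A \<in> SL2Z \<longleftrightarrow> A \<in> SL2Z"
  by (simp add: SL2Z_iff)

text \<open>The adjugate inverts a matrix of determinant 1 without leaving the integers.\<close>

definition adj2 :: "int^2^2 \<Rightarrow> int^2^2" where
  "adj2 A = mat2 (A$2$2) (- A$1$2) (- A$2$1) (A$1$1)"

lemma adj2_nth [simp]:
  "adj2 A $ 1 $ 1 = A$2$2" "adj2 A $ 1 $ 2 = - A$1$2"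
  "adj2 A $ 2 $ 1 = - A$2$1" "adj2 A $ 2 $ 2 = A$1$1"
  by (simp_all add: adj2_def)

lemma adj2_in_SL2Z [simp]: "adj2 A \<in> SL2Z \<longleftrightarrow> A \<in> SL2Z"
  by (simp add: SL2Z_iff mult.commute)

lemma adj2_mult [simp]: "A \<in> SL2Z \<Longrightarrow> adj2 A ** A = mat 1" "A \<in> SL2Z \<Longrightarrow> A ** adj2 A = mat 1"
  by (auto simp: mat2_eq_iff mult2_nth SL2Z_iff algebra_simps)

lemma adj2_mult_cancel [simp]:
  "A \<in> SL2Z \<Longrightarrow> adj2 A ** (A ** B) = B" "A \<in> SL2Z \<Longrightarrow> A ** (adj2 A ** B) = B"
  by (simp_all add: matrix_mul_assoc)

lemma adj2_cancel_right [simp]: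
  "A \<in> SL2Z \<Longrightarrow> (B ** A) ** adj2 A = B" "A \<in> SL2Z \<Longrightarrow> (B ** adj2 A) ** A = B"
  by (simp_all flip: matrix_mul_assoc)

lemma adj2_prod: "adj2 (A ** B) = adj2 B ** adj2 A"
  by (simp add: mat2_eq_iff mult2_nth algebra_simps)

lemma mult2_minus:
  fixes A B :: "int^2^2"
  shows "(- A) ** B = - (A ** B)" "A ** (- B) = - (A ** B)"
  by (simp_all add: mat2_eq_iff mult2_nth)

definition Tm :: "int \<Rightarrow> int^2^2" where "Tm n = mat2 1 n 0 1"

definition Sm :: "int^2^2" where "Sm = mat2 0 (-1) 1 0"

lemma Tm_nth [simp]: "Tm n $ 1 $ 1 = 1" "Tm n $ 1 $ 2 = n" "Tm n $ 2 $ 1 = 0" "Tm n $ 2 $ 2 = 1"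
  by (simp_all add: Tm_def)

lemma Sm_nth [simp]: "Sm $ 1 $ 1 = 0" "Sm $ 1 $ 2 = -1" "Sm $ 2 $ 1 = 1" "Sm $ 2 $ 2 = 0"
  by (simp_all add: Sm_def)

lemma Tm_in_SL2Z [simp]: "Tm n \<in> SL2Z" and Sm_in_SL2Z [simp]: "Sm \<in> SL2Z"
  by (simp_all add: SL2Z_iff)

lemma Tm_add: "Tm m ** Tm n = Tm (m + n)"
  by (simp add: mat2_eq_iff mult2_nth)

lemma Tm_0 [simp]: "Tm 0 = mat 1"
  by (simp add: mat2_eq_iff)

lemma adj2_Tm [simp]: "adj2 (Tm n) = Tm (- n)"
  by (simp add: mat2_eq_iff)

text \<open>Since the bottom rows agree, \<open>B ** adj2 A\<close> has bottom row (0, 1), and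
  determinant 1 makes it a translation.\<close>

lemma SL2Z_same_row:
  assumes "A \<in> SL2Z" "B \<in> SL2Z" "A$2$1 = B$2$1" "A$2$2 = B$2$2"
  shows "\<exists>n. B = Tm n ** A"
proof -
  have "B ** adj2 A = Tm ((B ** adj2 A) $ 1 $ 2)"
    using assms by (auto simp: mat2_eq_iff mult2_nth SL2Z_iff algebra_simps)
  hence "B = Tm ((B ** adj2 A) $ 1 $ 2) ** A"
    by (metis adj2_cancel_right(2) assms(1))
  thus ?thesis ..
qed

section \<open>Moebius transformations and the standard fundamental domain\<close>

abbreviation "\<H> \<equiv> upper_half_plane"

lemma in_H_iff [simp]: "z \<in> \<H> \<longleftrightarrow> Im z > 0"
  by (simp add: upper_half_plane_def)

lemma open_H [simp]: "open \<H>"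
  unfolding upper_half_plane_def by (simp add: open_halfspace_Im_gt)

lemma convex_H: "convex \<H>"
  unfolding upper_half_plane_def by (rule convex_halfspace_Im_gt)

lemma connected_H: "connected \<H>"
  using convex_H convex_connected by blast

lemma Im_denom: "Im (denom A z) = of_int (A$2$1) * Im z"
  and Re_denom: "Re (denom A z) = of_int (A$2$1) * Re z + of_int (A$2$2)"
  by (simp_all add: denom_def)

lemma denom_nonzero:
  assumes "A \<in> SL2Z" "Im z > 0" shows "denom A z \<noteq> 0"
proof
  assume "denom A z = 0"
  hence "Im (denom A z) = 0" "Re (denom A z) = 0" by simp_all
  with assms have "A$2$1 = 0" "A$2$2 = 0" by (auto simp: Im_denom Re_denom)
  with assms show False by (simp add: SL2Z_iff)
qed

lemma Im_moebius:
  assumes "A \<in> SL2Z" shows "Im (moebius_action A z) = Im z / (cmod (denom A z))\<^sup>2"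
proof -
  define a b c d where abcd: "a = real_of_int (A$1$1)" "b = real_of_int (A$1$2)"
    "c = real_of_int (A$2$1)" "d = real_of_int (A$2$2)"
  have det: "a * d - b * c = 1"
    using assms unfolding SL2Z_iff abcd by (metis of_int_1 of_int_diff of_int_mult)
  define x y where "x = Re z" "y = Im z"
  have m: "moebius_action A z = (of_real a * z + of_real b) / (of_real c * z + of_real d)"
    by (simp add: moebius_action_def denom_def abcd)
  have "Im (moebius_action A z) = ((a * y) * (c * x + d) - (a * x + b) * (c * y)) / ((c * x + d)\<^sup>2 + (c * y)\<^sup>2)"
    unfolding m by (simp add: Im_divide x_y_def)
  also have "(a * y) * (c * x + d) - (a * x + b) * (c * y) = y * (a * d - b * c)"
    by (simp add: algebra_simps)
  also have "(c * x + d)\<^sup>2 + (c * y)\<^sup>2 = (cmod (denom A z))\<^sup>2"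
    unfolding cmod_power2 Im_denom Re_denom abcd x_y_def by simp
  finally show ?thesis by (simp add: det x_y_def)
qed

lemma Im_moebius_pos [simp]:
  "A \<in> SL2Z \<Longrightarrow> Im z > 0 \<Longrightarrow> Im (moebius_action A z) > 0"
  using Im_moebius[of A z] denom_nonzero[of A z] by simp

text \<open>The denominator is the factor by which a matrix rescales the column (z, 1), so it is a
  cocycle.\<close>

lemma denom_mult:
  assumes "B \<in> SL2Z" "Im z > 0"
  shows "denom (A ** B) z = denom A (moebius_action B z) * denom B z"
proof -
  have "denom B z \<noteq> 0" using denom_nonzero assms by blast
  hence *: "moebius_action B z * denom B z = of_int (B$1$1) * z + of_int (B$1$2)"
    by (simp add: moebius_action_def)
  have "denom A (moebius_action B z) * denom B z
      = of_int (A$2$1) * (moebius_action B z * denom B z) + of_int (A$2$2) * denom B z"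
    by (simp add: denom_def algebra_simps)
  also have "\<dots> = denom (A ** B) z"
    unfolding * by (simp add: denom_def mult2_nth algebra_simps)
  finally show ?thesis ..
qed

lemma moebius_mult:
  assumes "A \<in> SL2Z" "B \<in> SL2Z" "Im z > 0"
  shows "moebius_action (A ** B) z = moebius_action A (moebius_action B z)"
proof -
  have nB: "denom B z \<noteq> 0" and nA: "denom A (moebius_action B z) \<noteq> 0"
    using denom_nonzero assms by simp_all
  have *: "moebius_action B z * denom B z = of_int (B$1$1) * z + of_int (B$1$2)"
    using nB by (simp add: moebius_action_def)
  have "moebius_action A (moebius_action B z) * denom (A ** B) z
      = (of_int (A$1$1) * moebius_action B z + of_int (A$1$2)) * denom B z"
    using nA by (simp add: denom_mult assms moebius_action_def[of A])
  also have "\<dots> = of_int (A$1$1) * (moebius_action B z * denom B z) + of_int (A$1$2) * denom B z"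
    by (simp add: algebra_simps)
  also have "\<dots> = of_int ((A ** B)$1$1) * z + of_int ((A ** B)$1$2)"
    unfolding * by (simp add: denom_def mult2_nth algebra_simps)
  also have "\<dots> = moebius_action (A ** B) z * denom (A ** B) z"
    using nA nB by (simp add: moebius_action_def[of "A ** B"] denom_mult assms)
  finally show ?thesis
    using nA nB by (simp add: denom_mult assms)
qed

lemma denom_one [simp]: "denom (mat 1) z = 1" and moebius_one [simp]: "moebius_action (mat 1) z = z"
  by (simp_all add: denom_def moebius_action_def)

lemma denom_uminus [simp]: "denom (- A) z = - denom A z"
  by (simp add: denom_def)

lemma moebius_uminus [simp]: "moebius_action (- A) z = moebius_action A z"
proof -
  have "moebius_action (- A) z = (- (of_int (A$1$1) * z + of_int (A$1$2))) / (- denom A z)"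
    by (simp add: moebius_action_def)
  thus ?thesis by (simp add: moebius_action_def del: minus_add_distrib)
qed

lemma denom_Tm [simp]: "denom (Tm n) z = 1" and moebius_Tm [simp]: "moebius_action (Tm n) z = z + of_int n"
  by (simp_all add: denom_def moebius_action_def)

lemma denom_Sm [simp]: "denom Sm z = z" and moebius_Sm [simp]: "moebius_action Sm z = - 1 / z"
  by (simp_all add: denom_def moebius_action_def)

lemma moebius_adj2:
  assumes "A \<in> SL2Z" "Im z > 0"
  shows "moebius_action (adj2 A) (moebius_action A z) = z" "moebius_action A (moebius_action (adj2 A) z) = z"
  using assms by (simp_all flip: moebius_mult)

lemma holomorphic_denom [holomorphic_intros]: "(\<lambda>z. denom A z) holomorphic_on S"
  unfolding denom_def by (intro holomorphic_intros)

lemma holomorphic_moebius: "A \<in> SL2Z \<Longrightarrow> moebius_action A holomorphic_on \<H>"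
  unfolding moebius_action_def[abs_def]
  by (intro holomorphic_intros) (auto dest: denom_nonzero)

text \<open>Termination of the reduction: every step \<open>z \<mapsto> -1/z\<close> with \<open>|z| < 1\<close> lowers the norm of the pair
  \<open>(c, d)\<close>, which takes only finitely many values below a given bound; it is enough to choose
  the matrix maximising \<open>Im\<close>.\<close>

lemma finite_small_denoms:
  assumes "Im z > 0"
  shows "finite {(c::int, d::int). cmod (of_int c * z + of_int d) \<le> R}"
proof (rule finite_subset)
  define M where "M = \<lceil>\<bar>R\<bar> / Im z\<rceil>"
  define M' where "M' = \<lceil>\<bar>R\<bar> + of_int M * \<bar>Re z\<bar>\<rceil>"
  show "{(c::int, d::int). cmod (of_int c * z + of_int d) \<le> R} \<subseteq> {-M..M} \<times> {-M'..M'}"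
  proof safe
    fix c d :: int assume *: "cmod (of_int c * z + of_int d) \<le> R"
    have "\<bar>Im (of_int c * z + of_int d)\<bar> \<le> R" using abs_Im_le_cmod * order_trans by blast
    hence "\<bar>of_int c\<bar> * Im z \<le> R" using assms by (simp add: abs_mult)
    hence c: "\<bar>real_of_int c\<bar> \<le> of_int M"
      using assms unfolding M_def by (smt (verit) le_of_int_ceiling pos_le_divide_eq)
    thus "c \<in> {-M..M}" by auto
    have "\<bar>Re (of_int c * z + of_int d)\<bar> \<le> R" using abs_Re_le_cmod * order_trans by blast
    hence "\<bar>of_int c * Re z + of_int d\<bar> \<le> R" by simp
    moreover have "\<bar>of_int c * Re z\<bar> \<le> of_int M * \<bar>Re z\<bar>"
      using c by (simp add: abs_mult mult_right_mono)
    ultimately have "\<bar>real_of_int d\<bar> \<le> \<bar>R\<bar> + of_int M * \<bar>Re z\<bar>" by linarith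
    hence "\<bar>real_of_int d\<bar> \<le> of_int M'" unfolding M'_def by linarith
    thus "d \<in> {-M'..M'}" by auto
  qed
qed simp

lemma reduction_to_fundamental_domain:
  assumes z: "Im z > 0"
  shows "\<exists>A\<in>SL2Z. moebius_action A z \<in> modular_fundamental_domain"
proof -
  \<comment> \<open>By \<open>Im_moebius\<close> the height of the image is largest where these
    values are smallest. The identity contributes 1, so only values up to 1 compete.\<close>
  define X where "X = (\<lambda>A. cmod (denom A z)) ` SL2Z"
  have "finite (X \<inter> {..1})"
  proof (rule finite_subset)
    show "X \<inter> {..1} \<subseteq> (\<lambda>(c, d). cmod (of_int c * z + of_int d)) ` {(c::int, d::int). cmod (of_int c * z + of_int d) \<le> 1}"
      unfolding X_def denom_def by force
    show "finite ((\<lambda>(c, d). cmod (of_int c * z + of_int d)) ` {(c::int, d::int). cmod (of_int c * z + of_int d) \<le> 1})"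
      using finite_small_denoms[OF z] by blast
  qed
  moreover have "1 \<in> X \<inter> {..1}"
    unfolding X_def using denom_one one_in_SL2Z by (auto intro!: image_eqI[where x = "mat 1"])
  ultimately have "Min (X \<inter> {..1}) \<in> X \<inter> {..1}" by (intro Min_in) auto
  moreover have le: "\<And>x. x \<in> X \<inter> {..1} \<Longrightarrow> Min (X \<inter> {..1}) \<le> x"
    using \<open>finite (X \<inter> {..1})\<close> by (rule Min_le)
  ultimately obtain A where A: "A \<in> SL2Z" "cmod (denom A z) = Min (X \<inter> {..1})" and A1: "cmod (denom A z) \<le> 1"
    unfolding X_def by auto
  have min: "cmod (denom A z) \<le> cmod (denom B z)" if "B \<in> SL2Z" for B
    using le[of "cmod (denom B z)"] that A A1 unfolding X_def by fastforce
  define n where "n = - round (Re (moebius_action A z))"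
  define w where "w = moebius_action (Tm n ** A) z"
  have w: "w = moebius_action A z + of_int n"
    unfolding w_def by (simp add: moebius_mult A z)
  have wpos: "Im w > 0" unfolding w_def using A z by (simp add: SL2Z_mult)
  have "\<bar>Re w\<bar> \<le> 1 / 2"
    unfolding w n_def using of_int_round_abs_le[of "Re (moebius_action A z)"] by (simp add: abs_minus_commute)
  moreover have "cmod w \<ge> 1"
  proof -
    \<comment> \<open>One more inversion multiplies the denominator by w, so minimality forces |w|
      to be at least 1.\<close>
    have "denom (Sm ** (Tm n ** A)) z = w * denom A z"
      using A z by (simp add: denom_mult SL2Z_mult w_def)
    moreover have "cmod (denom A z) \<le> cmod (denom (Sm ** (Tm n ** A)) z)"
      using A by (intro min SL2Z_mult) auto
    ultimately have "1 * cmod (denom A z) \<le> cmod w * cmod (denom A z)" by (simp add: norm_mult)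
    thus ?thesis using denom_nonzero[OF A(1) z] by (simp add: mult_le_cancel_right)
  qed
  ultimately have "w \<in> modular_fundamental_domain"
    using wpos by (simp add: modular_fundamental_domain_def)
  thus ?thesis using A unfolding w_def by (intro bexI[of _ "Tm n ** A"]) (auto intro: SL2Z_mult)
qed

lemma fundamental_domain_cover:
  assumes "Im z > 0"
  obtains A w where "A \<in> SL2Z" "w \<in> modular_fundamental_domain" "z = moebius_action A w"
proof -
  obtain A where A: "A \<in> SL2Z" "moebius_action A z \<in> modular_fundamental_domain"
    using reduction_to_fundamental_domain[OF assms] by blast
  show ?thesis
    by (rule that[of "adj2 A" "moebius_action A z"]) (use A assms in \<open>simp_all add: moebius_adj2\<close>)
qed

lemma fundamental_domain_Im:
  assumes "z \<in> modular_fundamental_domain" shows "Im z \<ge> sqrt 3 / 2"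
proof -
  have "(Re z)\<^sup>2 \<le> (1/2)\<^sup>2" using assms unfolding modular_fundamental_domain_def
    by (metis (mono_tags, lifting) abs_ge_zero mem_Collect_eq power2_abs power_mono)
  moreover have "(Re z)\<^sup>2 + (Im z)\<^sup>2 \<ge> 1"
    using assms unfolding modular_fundamental_domain_def cmod_power2[symmetric] by simp
  ultimately have "(Im z)\<^sup>2 \<ge> (sqrt 3 / 2)\<^sup>2" by (simp add: power_divide)
  moreover have "Im z > 0" using assms by (simp add: modular_fundamental_domain_def)
  ultimately show ?thesis by (meson abs_le_square_iff abs_of_pos power2_le_imp_le less_imp_le)
qed

section \<open>The hyperbolic measure\<close>

lemma measurable_Complex_pair [measurable]:
  "(\<lambda>p. Complex (fst p) (snd p)) \<in> borel_measurable (borel :: (real \<times> real) measure)"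
  unfolding Complex_eq by (intro borel_measurable_continuous_onI continuous_intros)

text \<open>Agreement on boxes determines Lebesgue measure. This opens the way to Tonelli in the
  coordinates Re and Im.\<close>

lemma lborel_complex_distr:
  "distr (lborel :: (real \<times> real) measure) borel (\<lambda>p. Complex (fst p) (snd p)) = lborel"
proof (rule lborel_eqI[symmetric])
  fix l u :: complex
  assume "\<And>b. b \<in> Basis \<Longrightarrow> l \<bullet> b \<le> u \<bullet> b"
  from this[of 1] this[of \<i>] have le: "Re l \<le> Re u" "Im l \<le> Im u" by (simp_all add: Basis_complex_def)
  have "(\<lambda>p. Complex (fst p) (snd p)) -` box l u = box (Re l) (Re u) \<times> box (Im l) (Im u)"
    by (auto simp: box_def Basis_complex_def)
  hence "emeasure (distr lborel borel (\<lambda>p. Complex (fst p) (snd p))) (box l u)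
      = emeasure (lborel \<Otimes>\<^sub>M lborel) (box (Re l) (Re u) \<times> box (Im l) (Im u))"
    by (subst emeasure_distr) (auto simp: lborel_prod)
  also have "\<dots> = ennreal (Re u - Re l) * ennreal (Im u - Im l)"
    using le by (subst lborel.emeasure_pair_measure_Times) auto
  also have "\<dots> = ennreal (\<Prod>b\<in>Basis. (u - l) \<bullet> b)"
    using le by (simp add: Basis_complex_def ennreal_mult)
  finally show "emeasure (distr lborel borel (\<lambda>p. Complex (fst p) (snd p))) (box l u)
      = ennreal (\<Prod>b\<in>Basis. (u - l) \<bullet> b)" .
qed simp

lemma nn_integral_complex:
  fixes f :: "complex \<Rightarrow> ennreal"
  assumes [measurable]: "f \<in> borel_measurable borel"
  shows "(\<integral>\<^sup>+z. f z \<partial>lborel) = (\<integral>\<^sup>+y. \<integral>\<^sup>+x. f (Complex x y) \<partial>lborel \<partial>lborel)"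
    and "(\<integral>\<^sup>+z. f z \<partial>lborel) = (\<integral>\<^sup>+x. \<integral>\<^sup>+y. f (Complex x y) \<partial>lborel \<partial>lborel)"
proof -
  have [measurable]: "(\<lambda>p. f (Complex (fst p) (snd p))) \<in> borel_measurable (lborel \<Otimes>\<^sub>M lborel)"
    unfolding lborel_prod by measurable
  have "(\<integral>\<^sup>+z. f z \<partial>lborel) = (\<integral>\<^sup>+p. f (Complex (fst p) (snd p)) \<partial>(lborel \<Otimes>\<^sub>M lborel))"
    by (subst lborel_complex_distr[symmetric], subst nn_integral_distr) (simp_all add: lborel_prod)
  moreover have "\<dots> = (\<integral>\<^sup>+x. \<integral>\<^sup>+y. f (Complex x y) \<partial>lborel \<partial>lborel)"
    using lborel.nn_integral_fst[of "\<lambda>p. f (Complex (fst p) (snd p))" lborel] by simp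
  moreover have "(\<integral>\<^sup>+p. f (Complex (fst p) (snd p)) \<partial>(lborel \<Otimes>\<^sub>M lborel))
      = (\<integral>\<^sup>+y. \<integral>\<^sup>+x. f (Complex x y) \<partial>lborel \<partial>lborel)"
    using lborel_pair.nn_integral_snd[of "\<lambda>p. f (Complex (fst p) (snd p))"] by simp
  ultimately show "(\<integral>\<^sup>+z. f z \<partial>lborel) = (\<integral>\<^sup>+y. \<integral>\<^sup>+x. f (Complex x y) \<partial>lborel \<partial>lborel)"
    "(\<integral>\<^sup>+z. f z \<partial>lborel) = (\<integral>\<^sup>+x. \<integral>\<^sup>+y. f (Complex x y) \<partial>lborel \<partial>lborel)" by simp_all
qed

section \<open>Jacobians of holomorphic maps\<close>

text \<open>In \<open>real^2\<close> a derivative has a matrix and a determinant, so the change of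
  variables is carried out there.\<close>

definition vec_complex :: "real^2 \<Rightarrow> complex" where "vec_complex v = Complex (v $ 1) (v $ 2)"

definition complex_vec :: "complex \<Rightarrow> real^2" where "complex_vec z = vector [Re z, Im z]"

lemma complex_vec_nth [simp]: "complex_vec z $ 1 = Re z" "complex_vec z $ 2 = Im z"
  by (simp_all add: complex_vec_def)

lemma vec_complex_sel [simp]: "Re (vec_complex v) = v $ 1" "Im (vec_complex v) = v $ 2"
  by (simp_all add: vec_complex_def)

lemma vec_complex_inverse [simp]: "vec_complex (complex_vec z) = z" "complex_vec (vec_complex v) = v"
  by (simp_all add: complex_eq_iff vec_eq_iff forall_2)

lemma bounded_linear_vec_complex: "bounded_linear vec_complex"
  and bounded_linear_complex_vec: "bounded_linear complex_vec"
proof -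
  have "linear vec_complex" "linear complex_vec"
    by (auto intro!: linearI simp: complex_eq_iff vec_eq_iff forall_2)
  thus "bounded_linear vec_complex" "bounded_linear complex_vec"
    by (auto simp: linear_conv_bounded_linear)
qed

lemma borel_measurable_vec_complex [measurable]: "vec_complex \<in> borel_measurable borel"
  by (intro borel_measurable_continuous_onI linear_continuous_on bounded_linear_vec_complex)

lemma lborel_vec_complex_distr: "distr (lborel :: (real^2) measure) borel vec_complex = lborel"
proof (rule lborel_eqI[symmetric])
  fix l u :: complex
  assume "\<And>b. b \<in> Basis \<Longrightarrow> l \<bullet> b \<le> u \<bullet> b"
  from this[of 1] this[of \<i>] have le: "Re l \<le> Re u" "Im l \<le> Im u" by (simp_all add: Basis_complex_def)
  have B: "(Basis :: (real^2) set) = {axis 1 1, axis 2 1}"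
    by (auto simp: Basis_vec_def UNIV_2)
  have ne: "(axis 1 1 :: real^2) \<noteq> axis 2 1" by (simp add: axis_eq_axis)
  have "vec_complex -` box l u = box (complex_vec l) (complex_vec u)"
    by (auto simp: box_def Basis_complex_def B inner_axis)
  hence "emeasure (distr lborel borel vec_complex) (box l u) = emeasure lborel (box (complex_vec l) (complex_vec u))"
    by (subst emeasure_distr) auto
  also have "\<dots> = ennreal (\<Prod>b\<in>Basis. (complex_vec u - complex_vec l) \<bullet> b)"
    using le by (subst emeasure_lborel_box) (auto simp: B inner_axis)
  also have "\<dots> = ennreal (\<Prod>b\<in>Basis. (u - l) \<bullet> b)"
    using ne by (simp add: Basis_complex_def B inner_axis)
  finally show "emeasure (distr lborel borel vec_complex) (box l u)
      = ennreal (\<Prod>b\<in>Basis. (u - l) \<bullet> b)" .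
qed simp

text \<open>Multiplication by w is a rotation followed by scaling with |w|; this is the Jacobian of
  a holomorphic map with derivative w.\<close>

lemma det_matrix_mult_complex:
  "det (matrix (\<lambda>h. complex_vec (w * vec_complex h))) = (cmod w)\<^sup>2"
  by (simp add: det_2 matrix_def axis_def cmod_power2) (simp add: power2_eq_square)

text \<open>A bounded image has finite measure, so the change of variables is an identity between
  real integrals and can be transferred to \<open>ennreal\<close>. Unbounded images are reached by
  exhaustion.\<close>

lemma emeasure_holomorphic_image:
  assumes A: "A \<in> sets borel" and der: "\<And>z. z \<in> A \<Longrightarrow> (f has_field_derivative f' z) (at z)"
    and inj: "inj_on f A" and fA: "f ` A \<in> sets borel" and bd: "bounded (f ` A)"
    and [measurable]: "f' \<in> borel_measurable borel"
  shows "emeasure lborel (f ` A) = (\<integral>\<^sup>+z. indicator A z * ennreal ((cmod (f' z))\<^sup>2) \<partial>lborel)"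
proof -
  define S where "S = vec_complex -` A"
  define g where "g = (\<lambda>v. complex_vec (f (vec_complex v)))"
  define g' where "g' = (\<lambda>v h. complex_vec (f' (vec_complex v) * vec_complex h))"
  have [measurable]: "S \<in> sets borel" "A \<in> sets borel"
    using A unfolding S_def by (auto intro: measurable_sets_borel[of vec_complex borel])
  have S: "S \<in> sets lebesgue" by (intro sets_completionI_sets) simp
  have dg: "(g has_derivative g' v) (at v within S)" if "v \<in> S" for v
  proof -
    have "(f has_derivative (\<lambda>h. f' (vec_complex v) * h)) (at (vec_complex v))"
      using der that by (auto simp: S_def has_field_derivative_def)
    hence "((\<lambda>v. complex_vec (f (vec_complex v))) has_derivative g' v) (at v within S)"
      unfolding g'_def
      by (intro bounded_linear.has_derivative[OF bounded_linear_complex_vec]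
          has_derivative_compose[of vec_complex vec_complex v S f]
          bounded_linear_imp_has_derivative bounded_linear_vec_complex)
    thus ?thesis by (simp add: g_def)
  qed
  have injg: "inj_on g S"
    using inj unfolding g_def S_def inj_on_def by (metis vec_complex_inverse vimageE)
  have gS: "g ` S = vec_complex -` (f ` A)"
    unfolding g_def S_def by (auto simp: image_iff) (metis vec_complex_inverse vimageI)+
  have gSb [measurable]: "g ` S \<in> sets borel"
    unfolding gS using fA by (auto intro: measurable_sets_borel[of vec_complex borel])
  have "g ` S = complex_vec ` (f ` A)"
    unfolding gS by (auto simp: image_iff) (metis vec_complex_inverse)
  hence "bounded (g ` S)"
    using bounded_linear_image[OF bd bounded_linear_complex_vec] by simp
  hence lm: "g ` S \<in> lmeasurable" by (intro bounded_set_imp_lmeasurable) auto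
  have "((\<lambda>x. \<bar>det (matrix (g' x))\<bar>) has_integral (measure lebesgue (g ` S))) S"
    using has_measure_differentiable_image[OF S dg injg] lm by blast
  hence "((\<lambda>x. (cmod (f' (vec_complex x)))\<^sup>2) has_integral (measure lebesgue (g ` S))) S"
    by (simp add: g'_def det_matrix_mult_complex)
  hence "(\<integral>\<^sup>+x. indicator S x * ennreal ((cmod (f' (vec_complex x)))\<^sup>2) \<partial>lborel) = ennreal (measure lebesgue (g ` S))"
    by (subst nn_integral_has_integral_lebesgue[symmetric, where \<Omega> = S])
       (auto intro!: nn_integral_cong split: split_indicator)
  also have "ennreal (measure lebesgue (g ` S)) = emeasure lebesgue (g ` S)"
    using lm by (simp add: emeasure_eq_measure2 fmeasurableD2)
  also have "\<dots> = emeasure lborel (g ` S)" by simp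
  also have "\<dots> = emeasure lborel (f ` A)"
  proof -
    have "emeasure (distr lborel borel vec_complex) (f ` A) = emeasure lborel (vec_complex -` (f ` A))"
      by (subst emeasure_distr) (use fA in auto)
    thus ?thesis unfolding gS lborel_vec_complex_distr ..
  qed
  also have "(\<integral>\<^sup>+x. indicator S x * ennreal ((cmod (f' (vec_complex x)))\<^sup>2) \<partial>lborel)
     = (\<integral>\<^sup>+z. indicator A z * ennreal ((cmod (f' z))\<^sup>2) \<partial>lborel)"
  proof -
    have "(\<integral>\<^sup>+z. indicator A z * ennreal ((cmod (f' z))\<^sup>2) \<partial>distr lborel borel vec_complex)
        = (\<integral>\<^sup>+x. indicator S x * ennreal ((cmod (f' (vec_complex x)))\<^sup>2) \<partial>lborel)"
      by (subst nn_integral_distr) (auto simp: S_def intro!: nn_integral_cong split: split_indicator)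
    thus ?thesis unfolding lborel_vec_complex_distr ..
  qed
  finally show ?thesis ..
qed

lemma sets_H [measurable]: "\<H> \<in> sets borel" by (simp add: borel_open)

lemma Im_one_over: "Im (1 / z) = - (Im z / (cmod z)\<^sup>2)"
  by (simp add: Im_divide cmod_power2)

text \<open>Equality of two measures: the image of Lebesgue measure on the half plane under z
  \<mapsto> -1/z, and the measure with density |z|^(-4). They are compared on sets that stay away
  from 0, whose images are bounded.\<close>

lemma nn_integral_inversion:
  assumes f [measurable]: "f \<in> borel_measurable borel"
  shows "(\<integral>\<^sup>+z. indicator \<H> z * f (- 1 / z) \<partial>lborel)
       = (\<integral>\<^sup>+z. indicator \<H> z * ennreal (1 / cmod z ^ 4) * f z \<partial>lborel)"
proof -
  define M N where "M = distr (density lborel (indicator \<H>)) borel (\<lambda>z::complex. - 1 / z)"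
    and "N = density lborel (\<lambda>z::complex. indicator \<H> z * ennreal (1 / cmod z ^ 4))"
  have g: "(\<lambda>z::complex. - 1 / z) \<in> borel_measurable borel" by measurable
  have eqK: "emeasure M A = emeasure N A" if A [measurable]: "A \<in> sets borel"
    and K: "A \<subseteq> {z. z = 0 \<or> cmod z \<ge> 1 / Suc n}" for A n
  proof -
    define A' where "A' = A \<inter> \<H>"
    have A' [measurable]: "A' \<in> sets borel" unfolding A'_def by measurable
    have im: "(\<lambda>z. - 1 / z) ` A' = ((\<lambda>z. - 1 / z) -` A) \<inter> \<H>"
    proof (intro equalityI subsetI)
      fix z assume z: "z \<in> ((\<lambda>z. - 1 / z) -` A) \<inter> \<H>"
      hence "- 1 / z \<in> A'" unfolding A'_def by (auto simp: Im_one_over zero_less_divide_iff intro: ccontr)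
      moreover have "z = - 1 / (- 1 / z)" by simp
      ultimately show "z \<in> (\<lambda>z. - 1 / z) ` A'" by blast
    qed (auto simp: A'_def Im_one_over zero_less_divide_iff)
    have pre: "(\<lambda>z. - 1 / z) -` A \<in> sets borel" using measurable_sets_borel[OF g A] .
    have "emeasure M A = emeasure (density lborel (indicator \<H>)) ((\<lambda>z. - 1 / z) -` A)"
      unfolding M_def by (subst emeasure_distr) (use g in simp_all)
    also have "\<dots> = (\<integral>\<^sup>+z. indicator \<H> z * indicator ((\<lambda>z. - 1 / z) -` A) z \<partial>lborel)"
    proof (rule emeasure_density)
      show "(\<lambda>z. - 1 / z) -` A \<in> sets lborel" by (simp only: sets_lborel pre)
    qed simp
    also have "\<dots> = emeasure lborel (((\<lambda>z. - 1 / z) -` A) \<inter> \<H>)"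
    proof -
      have *: "(\<lambda>z. - 1 / z) -` A \<inter> \<H> \<in> sets lborel"
        unfolding sets_lborel by (intro sets.Int pre sets_H)
      show ?thesis
        unfolding nn_integral_indicator[OF *, symmetric]
        by (intro nn_integral_cong) (simp split: split_indicator)
    qed
    also have "\<dots> = emeasure lborel ((\<lambda>z. - 1 / z) ` A')" by (simp only: im)
    also have "\<dots> = (\<integral>\<^sup>+z. indicator A' z * ennreal ((cmod (1 / z\<^sup>2))\<^sup>2) \<partial>lborel)"
    proof (rule emeasure_holomorphic_image)
      show "(\<lambda>z. - 1 / z) ` A' \<in> sets borel" unfolding im using measurable_sets_borel[OF g A] by auto
      show "((\<lambda>z. - 1 / z) has_field_derivative 1 / z\<^sup>2) (at z)" if "z \<in> A'" for z
        using that by (auto intro!: derivative_eq_intros simp: A'_def power2_eq_square)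
      show "inj_on (\<lambda>z. - 1 / z) A'" by (auto simp: inj_on_def)
      have "cmod (- 1 / z) \<le> Suc n" if "z \<in> A'" for z
        using that K by (auto simp: A'_def norm_divide divide_simps mult.commute split: if_splits)
      thus "bounded ((\<lambda>z. - 1 / z) ` A')" unfolding bounded_iff by blast
    qed auto
    also have "\<dots> = emeasure N A"
      unfolding N_def
      by (subst emeasure_density)
         (auto intro!: nn_integral_cong simp: A'_def norm_divide norm_power power_divide split: split_indicator simp flip: power_mult)
    finally show ?thesis .
  qed
  have "M = N"
  proof (rule measure_eqI)
    show "sets M = sets N" by (simp add: M_def N_def)
    fix A assume "A \<in> sets M"
    hence [measurable]: "A \<in> sets borel" by (simp add: M_def)
    \<comment> \<open>The point 0 is kept in every set so that the union is all of A; lying outside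
      \<open>\<H>\<close>, it carries no mass.\<close>
    define B where "B = (\<lambda>n. A \<inter> {z. z = 0 \<or> cmod z \<ge> 1 / Suc n})"
    have B: "B n \<in> sets borel" for n unfolding B_def by measurable
    have inc: "incseq B"
      unfolding B_def incseq_def by (auto intro: order_trans[rotated] simp: frac_le)
    have un: "(\<Union>n. B n) = A"
    proof -
      have "\<exists>n. 1 / real (Suc n) \<le> cmod z" if "z \<noteq> 0" for z :: complex
        using that by (meson less_imp_le nat_approx_posE zero_less_norm_iff)
      thus ?thesis unfolding B_def by auto
    qed
    have "(\<Squnion>n. emeasure M (B n)) = emeasure M (\<Union>n. B n)"
      by (rule SUP_emeasure_incseq) (use B inc in \<open>auto simp: M_def\<close>)
    moreover have "(\<Squnion>n. emeasure N (B n)) = emeasure N (\<Union>n. B n)"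
      by (rule SUP_emeasure_incseq) (use B inc in \<open>auto simp: N_def\<close>)
    moreover have "emeasure M (B n) = emeasure N (B n)" for n
      by (rule eqK[OF B]) (auto simp: B_def)
    ultimately show "emeasure M A = emeasure N A" by (simp add: un)
  qed
  have "(\<integral>\<^sup>+z. indicator \<H> z * f (- 1 / z) \<partial>lborel) = (\<integral>\<^sup>+z. f z \<partial>M)"
    unfolding M_def by (subst nn_integral_distr) (simp_all add: nn_integral_density)
  also have "\<dots> = (\<integral>\<^sup>+z. f z \<partial>N)" by (simp only: \<open>M = N\<close>)
  also have "\<dots> = (\<integral>\<^sup>+z. indicator \<H> z * ennreal (1 / cmod z ^ 4) * f z \<partial>lborel)"
    unfolding N_def by (subst nn_integral_density) auto
  finally show ?thesis .
qed

section \<open>Invariance of the hyperbolic area\<close>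

definition hyp_integral :: "(complex \<Rightarrow> ennreal) \<Rightarrow> ennreal" where
  "hyp_integral u = (\<integral>\<^sup>+z. indicator \<H> z * ennreal (1 / (Im z)\<^sup>2) * u z \<partial>lborel)"

text \<open>As Im (-1/z) = Im z / |z|^2, the density 1/Im^2 becomes |z|^4/Im^2, and the Jacobian
  |z|^(-4) cancels the new factor.\<close>

lemma hyp_integral_inversion:
  assumes [measurable]: "u \<in> borel_measurable borel"
  shows "hyp_integral (\<lambda>z. u (- 1 / z)) = hyp_integral u"
proof -
  have "hyp_integral (\<lambda>z. u (- 1 / z))
      = (\<integral>\<^sup>+z. indicator \<H> z * (\<lambda>w. ennreal (cmod w ^ 4 / (Im w)\<^sup>2) * u w) (- 1 / z) \<partial>lborel)"
    unfolding hyp_integral_def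
    by (intro nn_integral_cong)
       (auto split: split_indicator simp: Im_one_over norm_divide power_divide simp flip: power_mult)
  also have "\<dots> = (\<integral>\<^sup>+z. indicator \<H> z * ennreal (1 / cmod z ^ 4) * (ennreal (cmod z ^ 4 / (Im z)\<^sup>2) * u z) \<partial>lborel)"
    by (subst nn_integral_inversion) auto
  also have "\<dots> = hyp_integral u"
    unfolding hyp_integral_def
  proof (intro nn_integral_cong)
    fix z :: complex
    show "indicator \<H> z * ennreal (1 / cmod z ^ 4) * (ennreal (cmod z ^ 4 / (Im z)\<^sup>2) * u z)
        = indicator \<H> z * ennreal (1 / (Im z)\<^sup>2) * u z"
    proof (cases "z \<in> \<H>")
      case True
      hence "z \<noteq> 0" by auto
      hence "ennreal (1 / cmod z ^ 4) * ennreal (cmod z ^ 4 / (Im z)\<^sup>2) = ennreal (1 / (Im z)\<^sup>2)"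
        by (simp flip: ennreal_mult)
      thus ?thesis using True by (simp flip: mult.assoc)
    qed simp
  qed
  finally show ?thesis .
qed

lemma hyp_integral_translate:
  assumes [measurable]: "u \<in> borel_measurable borel"
  shows "hyp_integral (\<lambda>z. u (z + of_real t)) = hyp_integral u"
proof -
  have "hyp_integral u = (\<integral>\<^sup>+z. indicator \<H> z * ennreal (1 / (Im z)\<^sup>2) * u z \<partial>distr lborel borel ((+) (complex_of_real t)))"
    by (simp add: hyp_integral_def lborel_distr_plus)
  also have "\<dots> = hyp_integral (\<lambda>z. u (z + of_real t))"
    unfolding hyp_integral_def
    by (subst nn_integral_distr) (auto intro!: nn_integral_cong simp: add.commute split: split_indicator)
  finally show ?thesis ..
qed

section \<open>Mean value inequality and decay at a cusp\<close>

lemma measurable_Complex [measurable (raw)]: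
  "f \<in> borel_measurable M \<Longrightarrow> g \<in> borel_measurable M \<Longrightarrow> (\<lambda>x. Complex (f x) (g x)) \<in> borel_measurable M"
  by (subst borel_measurable_complex_iff) simp

text \<open>Values in \<open>ennreal\<close> allow the contour to be averaged afterwards by Tonelli
  without any question of integrability.\<close>

lemma contour_integral_linepath_nn_bound:
  assumes c: "continuous_on (closed_segment a b) f"
    and le: "\<And>z. z \<in> closed_segment a b \<Longrightarrow> ennreal (cmod (f z)) \<le> u z"
  shows "ennreal (cmod (contour_integral (linepath a b) f))
      \<le> (\<integral>\<^sup>+t. ennreal (cmod (b - a)) * (indicator {0..1::real} t * u (a + of_real t * (b - a))) \<partial>lborel)"
proof -
  have lp: "linepath a b t = a + of_real t * (b - a)" for t
    by (simp add: linepath_def scaleR_conv_of_real algebra_simps)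
  have seg: "linepath a b t \<in> closed_segment a b" if "t \<in> {0..1}" for t
    using that by (metis imageI linepath_image_01)
  have c1: "continuous_on {0..1} (\<lambda>t. f (linepath a b t))"
    by (rule continuous_on_compose2[OF c]) (auto intro: seg continuous_intros)
  have c2: "continuous_on {0..1} (\<lambda>t. cmod (f (linepath a b t) * (b - a)))"
    by (intro continuous_intros c1)
  have eq: "contour_integral (linepath a b) f = integral {0..1} (\<lambda>t. f (linepath a b t) * (b - a))"
    by (simp add: contour_integral_integral)
  have "cmod (contour_integral (linepath a b) f) \<le> integral {0..1} (\<lambda>t. cmod (f (linepath a b t) * (b - a)))"
    unfolding eq
    by (intro integral_norm_bound_integral integrable_continuous_interval c2 continuous_intros c1) simp
  hence "ennreal (cmod (contour_integral (linepath a b) f)) \<le> ennreal (integral {0..1} (\<lambda>t. cmod (f (linepath a b t) * (b - a))))"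
    by (rule ennreal_leI)
  also have "\<dots> = (\<integral>\<^sup>+t. ennreal (indicator {0..1} t * cmod (f (linepath a b t) * (b - a))) \<partial>lborel)"
    by (rule nn_integral_has_integral_lebesgue[symmetric])
       (auto intro!: integrable_integral integrable_continuous_interval c2)
  also have "\<dots> \<le> (\<integral>\<^sup>+t. ennreal (cmod (b - a)) * (indicator {0..1::real} t * u (a + of_real t * (b - a))) \<partial>lborel)"
  proof (rule nn_integral_mono)
    fix t :: real
    show "ennreal (indicator {0..1} t * cmod (f (linepath a b t) * (b - a)))
        \<le> ennreal (cmod (b - a)) * (indicator {0..1::real} t * u (a + of_real t * (b - a)))"
    proof (cases "t \<in> {0..1}")
      case True
      have "ennreal (cmod (f (linepath a b t) * (b - a))) = ennreal (cmod (b - a)) * ennreal (cmod (f (linepath a b t)))"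
        by (simp add: norm_mult ennreal_mult mult.commute)
      also have "\<dots> \<le> ennreal (cmod (b - a)) * u (linepath a b t)"
        by (intro mult_left_mono le seg True) auto
      finally show ?thesis using True by (simp add: lp)
    qed simp
  qed
  finally show ?thesis .
qed

text \<open>The affine substitution absorbs the length of the segment. Passing to the whole line
  loses nothing later, since u will vanish outside a square.\<close>

lemma contour_integral_horizontal_nn_bound:
  assumes c: "continuous_on (closed_segment (Complex x1 y) (Complex x2 y)) f"
    and le: "\<And>z. z \<in> closed_segment (Complex x1 y) (Complex x2 y) \<Longrightarrow> ennreal (cmod (f z)) \<le> u z"
    and ne: "x1 \<noteq> x2" and [measurable]: "u \<in> borel_measurable borel"
  shows "ennreal (cmod (contour_integral (linepath (Complex x1 y) (Complex x2 y)) f)) \<le> (\<integral>\<^sup>+x. u (Complex x y) \<partial>lborel)"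
proof -
  have eq: "Complex x1 y + of_real t * (Complex x2 y - Complex x1 y) = Complex (x1 + (x2 - x1) * t) y" for t
    by (simp add: complex_eq_iff)
  have "cmod (Complex x2 y - Complex x1 y) = \<bar>x2 - x1\<bar>"
    by (simp add: complex_diff cmod_def)
  hence "ennreal (cmod (contour_integral (linepath (Complex x1 y) (Complex x2 y)) f))
      \<le> (\<integral>\<^sup>+t. ennreal \<bar>x2 - x1\<bar> * (indicator {0..1::real} t * u (Complex (x1 + (x2 - x1) * t) y)) \<partial>lborel)"
    using contour_integral_linepath_nn_bound[OF c le] by (simp add: eq)
  also have "\<dots> \<le> (\<integral>\<^sup>+t. ennreal \<bar>x2 - x1\<bar> * u (Complex (x1 + (x2 - x1) * t) y) \<partial>lborel)"
    by (intro nn_integral_mono mult_left_mono) (auto split: split_indicator)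
  also have "\<dots> = (\<integral>\<^sup>+x. u (Complex x y) \<partial>lborel)"
    using ne by (subst nn_integral_cmult) (auto simp: nn_integral_real_affine[of "\<lambda>x. u (Complex x y)" "x2 - x1" x1])
  finally show ?thesis .
qed

lemma contour_integral_vertical_nn_bound:
  assumes c: "continuous_on (closed_segment (Complex x y1) (Complex x y2)) f"
    and le: "\<And>z. z \<in> closed_segment (Complex x y1) (Complex x y2) \<Longrightarrow> ennreal (cmod (f z)) \<le> u z"
    and ne: "y1 \<noteq> y2" and [measurable]: "u \<in> borel_measurable borel"
  shows "ennreal (cmod (contour_integral (linepath (Complex x y1) (Complex x y2)) f)) \<le> (\<integral>\<^sup>+y. u (Complex x y) \<partial>lborel)"
proof -
  have eq: "Complex x y1 + of_real t * (Complex x y2 - Complex x y1) = Complex x (y1 + (y2 - y1) * t)" for t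
    by (simp add: complex_eq_iff)
  have "cmod (Complex x y2 - Complex x y1) = \<bar>y2 - y1\<bar>"
    by (simp add: complex_diff cmod_def)
  hence "ennreal (cmod (contour_integral (linepath (Complex x y1) (Complex x y2)) f))
      \<le> (\<integral>\<^sup>+t. ennreal \<bar>y2 - y1\<bar> * (indicator {0..1::real} t * u (Complex x (y1 + (y2 - y1) * t))) \<partial>lborel)"
    using contour_integral_linepath_nn_bound[OF c le] by (simp add: eq)
  also have "\<dots> \<le> (\<integral>\<^sup>+t. ennreal \<bar>y2 - y1\<bar> * u (Complex x (y1 + (y2 - y1) * t)) \<partial>lborel)"
    by (intro nn_integral_mono mult_left_mono) (auto split: split_indicator)
  also have "\<dots> = (\<integral>\<^sup>+y. u (Complex x y) \<partial>lborel)"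
    using ne by (subst nn_integral_cmult) (auto simp: nn_integral_real_affine[of "\<lambda>y. u (Complex x y)" "y2 - y1" y1])
  finally show ?thesis .
qed

text \<open>Squares take the place of discs because their sides are parallel to the axes, so that
  averaging over the size is Tonelli in Cartesian coordinates.\<close>

definition csquare :: "complex \<Rightarrow> real \<Rightarrow> complex set" where
  "csquare z r = {w. \<bar>Re w - Re z\<bar> \<le> r \<and> \<bar>Im w - Im z\<bar> \<le> r}"

lemma csquare_eq_cbox: "csquare z r = cbox (z - Complex r r) (z + Complex r r)"
  by (auto simp: csquare_def in_cbox_complex_iff)

lemma csquare_mono: "s \<le> r \<Longrightarrow> csquare z s \<subseteq> csquare z r"
  by (auto simp: csquare_def)

lemma convex_csquare: "convex (csquare z r)" and closed_csquare: "closed (csquare z r)"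
  unfolding csquare_eq_cbox by (rule convex_box closed_cbox)+

lemma sets_csquare [measurable]: "csquare z r \<in> sets borel"
  using closed_csquare by (rule borel_closed)

text \<open>Cauchy's formula on the boundary of the square, where |w - z| is at least s. The gain of
  1/(2 pi) is given away.\<close>

lemma csquare_Cauchy_bound:
  assumes hol: "f holomorphic_on csquare z s" and s: "s > 0"
    and u [measurable]: "u \<in> borel_measurable borel"
    and le: "\<And>w. w \<in> csquare z s \<Longrightarrow> ennreal (cmod (f w)) \<le> u w"
  defines "x \<equiv> Re z" and "y \<equiv> Im z"
  shows "ennreal (s * cmod (f z)) \<le>
     ((\<integral>\<^sup>+t. u (Complex t (y - s)) \<partial>lborel) + (\<integral>\<^sup>+t. u (Complex t (y + s)) \<partial>lborel)) +
     ((\<integral>\<^sup>+t. u (Complex (x - s) t) \<partial>lborel) + (\<integral>\<^sup>+t. u (Complex (x + s) t) \<partial>lborel))"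
proof -
  define a where "a = Complex (x - s) (y - s)"
  define b where "b = Complex (x + s) (y + s)"
  define g where "g = (\<lambda>w. f w / (w - z))"
  have z: "z = Complex x y" by (simp add: x_def y_def)
  have int: "z \<in> interior (csquare z s)"
    using s by (simp add: csquare_eq_cbox interior_cbox in_box_complex_iff)
  have zb: "z \<in> box a b" using s by (simp add: in_box_complex_iff a_def b_def z)
  have im: "path_image (rectpath a b) = cbox a b - box a b"
    using s by (intro path_image_rectpath_cbox_minus_box) (auto simp: a_def b_def)
  have cb: "cbox a b = csquare z s"
    by (auto simp: csquare_def in_cbox_complex_iff a_def b_def z)
  have int2: "(g has_contour_integral (2*pi * \<i> * winding_number (rectpath a b) z * f z)) (rectpath a b)"
    unfolding g_def using zb
    by (intro Cauchy_integral_formula_convex_simple[OF convex_csquare hol int]) (auto simp: im cb)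
  hence I: "contour_integral (rectpath a b) g = 2 * pi * \<i> * f z" and ig: "g contour_integrable_on (rectpath a b)"
    using winding_number_rectpath[OF zb] contour_integral_unique by (auto simp: contour_integrable_on_def)
  define B R T L where "B = linepath (Complex (x - s) (y - s)) (Complex (x + s) (y - s))"
    and "R = linepath (Complex (x + s) (y - s)) (Complex (x + s) (y + s))"
    and "T = linepath (Complex (x + s) (y + s)) (Complex (x - s) (y + s))"
    and "L = linepath (Complex (x - s) (y + s)) (Complex (x - s) (y - s))"
  have rp: "rectpath a b = B +++ R +++ T +++ L"
    by (simp add: rectpath_def Let_def a_def b_def B_def R_def T_def L_def)
  have sub: "path_image B \<subseteq> cbox a b - box a b" "path_image R \<subseteq> cbox a b - box a b"
    "path_image T \<subseteq> cbox a b - box a b" "path_image L \<subseteq> cbox a b - box a b"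
    unfolding im[symmetric] rp B_def R_def T_def L_def by (auto simp: path_image_join)
  have contg: "continuous_on (cbox a b - box a b) g"
    unfolding g_def using zb
    by (intro continuous_intros holomorphic_on_imp_continuous_on holomorphic_on_subset[OF hol])
       (auto simp: cb)
  have ints: "contour_integral (rectpath a b) g
      = contour_integral B g + (contour_integral R g + (contour_integral T g + contour_integral L g))"
    using ig unfolding rp B_def R_def T_def L_def by simp
  have far: "cmod (w - z) \<ge> s" if "w \<in> cbox a b - box a b" for w
  proof -
    have "\<bar>Re (w - z)\<bar> \<ge> s \<or> \<bar>Im (w - z)\<bar> \<ge> s"
      using that by (auto simp: in_cbox_complex_iff in_box_complex_iff a_def b_def z)
    thus ?thesis using abs_Re_le_cmod[of "w - z"] abs_Im_le_cmod[of "w - z"] by linarith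
  qed
  have gle: "ennreal (cmod (g w)) \<le> ennreal (1 / s) * u w" if "w \<in> cbox a b - box a b" for w
  proof -
    have "cmod (g w) \<le> 1 / s * cmod (f w)"
      using far[OF that] s by (simp add: g_def norm_divide frac_le)
    hence "ennreal (cmod (g w)) \<le> ennreal (1 / s) * ennreal (cmod (f w))"
      using s by (simp add: ennreal_leI flip: ennreal_mult)
    also have "\<dots> \<le> ennreal (1 / s) * u w" using that cb by (intro mult_left_mono le) auto
    finally show ?thesis .
  qed
  have h: "ennreal (cmod (contour_integral (linepath (Complex x1 t) (Complex x2 t)) g)) \<le> ennreal (1 / s) * (\<integral>\<^sup>+x. u (Complex x t) \<partial>lborel)"
    if "path_image (linepath (Complex x1 t) (Complex x2 t)) \<subseteq> cbox a b - box a b" "x1 \<noteq> x2" for x1 x2 t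
    using that contour_integral_horizontal_nn_bound[of x1 t x2 g "\<lambda>w. ennreal (1 / s) * u w"]
    by (auto simp: nn_integral_cmult intro: gle continuous_on_subset[OF contg])
  have v: "ennreal (cmod (contour_integral (linepath (Complex t y1) (Complex t y2)) g)) \<le> ennreal (1 / s) * (\<integral>\<^sup>+x. u (Complex t x) \<partial>lborel)"
    if "path_image (linepath (Complex t y1) (Complex t y2)) \<subseteq> cbox a b - box a b" "y1 \<noteq> y2" for y1 y2 t
    using that contour_integral_vertical_nn_bound[of t y1 y2 g "\<lambda>w. ennreal (1 / s) * u w"]
    by (auto simp: nn_integral_cmult intro: gle continuous_on_subset[OF contg])
  have "1 * cmod (f z) \<le> 2 * pi * cmod (f z)" using pi_ge_two by (intro mult_right_mono) auto
  also have "\<dots> = cmod (contour_integral (rectpath a b) g)" by (simp add: I norm_mult)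
  also have "\<dots> \<le> cmod (contour_integral B g) + (cmod (contour_integral R g) + (cmod (contour_integral T g) + cmod (contour_integral L g)))"
    unfolding ints by (intro order_trans[OF norm_triangle_ineq] add_left_mono order_refl)
  finally have "ennreal (cmod (f z)) \<le> ennreal (cmod (contour_integral B g) + (cmod (contour_integral R g) + (cmod (contour_integral T g) + cmod (contour_integral L g))))"
    by (intro ennreal_leI) simp
  also have "\<dots> = ennreal (cmod (contour_integral B g)) + (ennreal (cmod (contour_integral R g)) + (ennreal (cmod (contour_integral T g)) + ennreal (cmod (contour_integral L g))))"
    by simp
  also have "\<dots> \<le> ennreal (1 / s) * (\<integral>\<^sup>+t. u (Complex t (y - s)) \<partial>lborel) +
      (ennreal (1 / s) * (\<integral>\<^sup>+t. u (Complex (x + s) t) \<partial>lborel) +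
       (ennreal (1 / s) * (\<integral>\<^sup>+t. u (Complex t (y + s)) \<partial>lborel) +
        ennreal (1 / s) * (\<integral>\<^sup>+t. u (Complex (x - s) t) \<partial>lborel)))"
    using sub s unfolding B_def R_def T_def L_def by (intro add_mono h v) auto
  also have "\<dots> = ennreal (1 / s) * (((\<integral>\<^sup>+t. u (Complex t (y - s)) \<partial>lborel) + (\<integral>\<^sup>+t. u (Complex t (y + s)) \<partial>lborel)) +
     ((\<integral>\<^sup>+t. u (Complex (x - s) t) \<partial>lborel) + (\<integral>\<^sup>+t. u (Complex (x + s) t) \<partial>lborel)))" (is "_ = _ * ?X")
    by (simp add: algebra_simps)
  finally have "ennreal s * ennreal (cmod (f z)) \<le> ennreal s * (ennreal (1 / s) * ?X)"
    by (intro mult_left_mono) auto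
  also have "ennreal s * (ennreal (1 / s) * ?X) = ?X"
    using s by (simp flip: mult.assoc ennreal_mult)
  finally show ?thesis using s by (simp add: ennreal_mult)
qed

text \<open>The Cauchy bound is integrated over half sides s between r/2 and r. Each of the four
  line integrals sweeps the plane once and contributes the total mass I, whence (r/2)^2 |f z| \<le>
  4 I.\<close>

lemma csquare_mean_value:
  assumes hol: "f holomorphic_on csquare z r" and r: "r > 0"
  shows "ennreal (cmod (f z)) \<le> ennreal (16 / r\<^sup>2) * (\<integral>\<^sup>+w. indicator (csquare z r) w * ennreal (cmod (f w)) \<partial>lborel)"
proof -
  define u where "u = (\<lambda>w. ennreal (indicator (csquare z r) w *\<^sub>R cmod (f w)))"
  have [measurable]: "u \<in> borel_measurable borel"
    unfolding u_def
    by (intro measurable_compose[OF _ measurable_ennreal] borel_measurable_continuous_on_indicator sets_csquare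
        continuous_intros holomorphic_on_imp_continuous_on[OF hol])
  define I where "I = (\<integral>\<^sup>+w. u w \<partial>lborel)"
  have um: "u w = ennreal (cmod (f w))" if "w \<in> csquare z r" for w
    using that by (simp add: u_def)
  define x y where "x = Re z" and "y = Im z"
  define X where "X = (\<lambda>s. ((\<integral>\<^sup>+t. u (Complex t (y - s)) \<partial>lborel) + (\<integral>\<^sup>+t. u (Complex t (y + s)) \<partial>lborel)) +
     ((\<integral>\<^sup>+t. u (Complex (x - s) t) \<partial>lborel) + (\<integral>\<^sup>+t. u (Complex (x + s) t) \<partial>lborel)))"
  have X: "ennreal (r / 2 * cmod (f z)) \<le> X s" if "s \<in> {r/2..r}" for s
  proof -
    have "ennreal (r / 2 * cmod (f z)) \<le> ennreal (s * cmod (f z))"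
      using that by (intro ennreal_leI mult_right_mono) auto
    also have "\<dots> \<le> X s"
      unfolding X_def x_def y_def
      using that r csquare_mono[of s r z]
      by (intro csquare_Cauchy_bound holomorphic_on_subset[OF hol] \<open>u \<in> borel_measurable borel\<close>)
         (auto simp: um subset_iff)
    finally show ?thesis .
  qed
  have i1: "(\<integral>\<^sup>+s. \<integral>\<^sup>+t. u (Complex t (y - s)) \<partial>lborel \<partial>lborel) = I"
    unfolding I_def nn_integral_complex(1)[of u, simplified]
    by (subst nn_integral_real_affine[of "\<lambda>s. \<integral>\<^sup>+t. u (Complex t s) \<partial>lborel" "-1" y]) auto
  have i2: "(\<integral>\<^sup>+s. \<integral>\<^sup>+t. u (Complex t (y + s)) \<partial>lborel \<partial>lborel) = I"
    unfolding I_def nn_integral_complex(1)[of u, simplified]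
    by (subst nn_integral_real_affine[of "\<lambda>s. \<integral>\<^sup>+t. u (Complex t s) \<partial>lborel" "1" y]) auto
  have i3: "(\<integral>\<^sup>+s. \<integral>\<^sup>+t. u (Complex (x - s) t) \<partial>lborel \<partial>lborel) = I"
    unfolding I_def nn_integral_complex(2)[of u, simplified]
    by (subst nn_integral_real_affine[of "\<lambda>s. \<integral>\<^sup>+t. u (Complex s t) \<partial>lborel" "-1" x]) auto
  have i4: "(\<integral>\<^sup>+s. \<integral>\<^sup>+t. u (Complex (x + s) t) \<partial>lborel \<partial>lborel) = I"
    unfolding I_def nn_integral_complex(2)[of u, simplified]
    by (subst nn_integral_real_affine[of "\<lambda>s. \<integral>\<^sup>+t. u (Complex s t) \<partial>lborel" "1" x]) auto
  have "ennreal (r / 2 * cmod (f z)) * ennreal (r / 2) = (\<integral>\<^sup>+s. ennreal (r / 2 * cmod (f z)) * indicator {r/2..r} s \<partial>lborel)"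
    using r by (subst nn_integral_cmult_indicator) auto
  also have "\<dots> \<le> (\<integral>\<^sup>+s. X s \<partial>lborel)"
    using X by (intro nn_integral_mono) (auto split: split_indicator)
  also have "\<dots> = (I + I) + (I + I)"
    unfolding X_def by (simp add: nn_integral_add i1 i2 i3 i4)
  also have "\<dots> = 4 * I"
  proof -
    have "(4::ennreal) = (1 + 1) + (1 + 1)" by simp
    thus ?thesis by (simp only: distrib_right mult_1_left)
  qed
  finally have "ennreal (4 / r\<^sup>2) * (ennreal (r / 2 * cmod (f z)) * ennreal (r / 2)) \<le> ennreal (4 / r\<^sup>2) * (4 * I)"
    by (intro mult_left_mono) auto
  also have "ennreal (4 / r\<^sup>2) * (ennreal (r / 2 * cmod (f z)) * ennreal (r / 2)) = ennreal (cmod (f z))"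
    using r by (simp add: power2_eq_square flip: ennreal_mult)
  also have "ennreal (4 / r\<^sup>2) * (4 * I) = ennreal (16 / r\<^sup>2) * I"
  proof -
    have "ennreal (4 / r\<^sup>2) * 4 = ennreal (16 / r\<^sup>2)"
      by (subst ennreal_numeral[symmetric], subst ennreal_mult[symmetric]) auto
    thus ?thesis by (simp add: mult.assoc[symmetric])
  qed
  also have "I = (\<integral>\<^sup>+w. indicator (csquare z r) w * ennreal (cmod (f w)) \<partial>lborel)"
    unfolding I_def u_def by (intro nn_integral_cong) (auto split: split_indicator)
  finally show ?thesis .
qed

section \<open>Exponential decay of periodic functions\<close>

lemma periodic_int_multiple:
  fixes g :: "complex \<Rightarrow> complex"
  assumes per: "\<And>z. Im z > 0 \<Longrightarrow> g (z + of_real h) = g z" and z: "Im z > 0"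
  shows "g (z + of_int n * of_real h) = g z"
proof -
  have nat: "g (z + of_nat n * of_real h) = g z" if "Im z > 0" for n z
  proof (induction n)
    case (Suc n)
    have "g ((z + of_nat n * of_real h) + of_real h) = g (z + of_nat n * of_real h)"
      by (rule per) (use that in simp)
    thus ?case using Suc by (simp add: algebra_simps)
  qed simp
  show ?thesis
  proof (cases n)
    case (nonneg m)
    thus ?thesis using nat[OF z, of m] by simp
  next
    case (neg m)
    have "Im (z + of_int n * of_real h) > 0" using z by simp
    from nat[OF this, of "Suc m"] show ?thesis by (simp add: neg algebra_simps)
  qed
qed

text \<open>In the coordinate \<open>q = exp (2 \<pi> i z / h)\<close> this is the Schwarz lemma on the disc of radius
  \<open>exp (- 2 \<pi> y\<^sub>0 / h)\<close>.\<close>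

lemma periodic_decay:
  assumes hol: "g holomorphic_on \<H>" and h: "h > 0"
    and per: "\<And>z. Im z > 0 \<Longrightarrow> g (z + of_real h) = g z"
    and lim: "(g \<longlongrightarrow> 0) (filtercomap Im at_top)"
    and y0: "y0 > 0" and M: "\<And>z. Im z = y0 \<Longrightarrow> cmod (g z) \<le> M"
    and z: "Im z \<ge> y0"
  shows "cmod (g z) \<le> M * exp (- (2 * pi * (Im z - y0) / h))"
proof -
  define E where "E = (\<lambda>z. exp (2 * of_real pi * \<i> * z / of_real h))"
  define K where "K = (\<lambda>w. of_real h * w / (2 * of_real pi * \<i>))"
  \<comment> \<open>The principal logarithm may be used: another value would move the argument of g
    by a multiple of the period h.\<close>
  define G where "G = (\<lambda>q. g (K (Ln q)))"
  have EK: "E (K w) = exp w" for w using h by (simp add: E_def K_def)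
  have ImK: "Im (K w) = - (h * Re w / (2 * pi))" for w
    unfolding K_def using h by (simp add: Im_divide power2_eq_square)
  have absE: "cmod (E z) = exp (- (2 * pi * Im z / h))" for z
    unfolding E_def by (simp add: norm_exp_eq_Re)
  have GE: "G (E z) = g z" if "Im z > 0" for z
  proof -
    have "exp (Ln (E z)) = exp (2 * of_real pi * \<i> * z / of_real h)" by (simp add: E_def)
    then obtain n :: int where n: "Ln (E z) = 2 * of_real pi * \<i> * z / of_real h + (of_int (2 * n) * pi) * \<i>"
      unfolding exp_eq by blast
    have "K (Ln (E z)) = z + of_int n * of_real h"
      unfolding n K_def using h by (simp add: field_simps)
    thus ?thesis using periodic_int_multiple[of g h z n] per that by (simp add: G_def)
  qed
  have pos: "Im w > 0" if "cmod (E w) < 1" for w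
    using that h by (simp add: absE zero_less_mult_iff zero_less_divide_iff)
  have holG: "G holomorphic_on ball 0 1 - {0}"
  proof (rule holomorphic_onI)
    fix q0 :: complex assume q0: "q0 \<in> ball 0 1 - {0}"
    define z0 where "z0 = K (Ln q0)"
    have Ez0: "E z0 = q0" using q0 by (simp add: z0_def EK)
    \<comment> \<open>A branch centred at q0 replaces the principal one, whose cut might pass
      through q0. On the disc of radius |q0| around q0 the quotient q/q0 has positive real
      part.\<close>
    define L where "L = (\<lambda>q. z0 + K (Ln (q / q0)))"
    define U where "U = ball q0 (cmod q0) \<inter> ball 0 1"
    have U0: "q \<noteq> 0" if "q \<in> U" for q using that by (auto simp: U_def)
    have EL: "E (L q) = q" if "q \<in> U" for q
    proof -
      have "E (L q) = E z0 * E (K (Ln (q / q0)))"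
        unfolding L_def E_def by (simp add: ring_distribs add_divide_distrib exp_add)
      thus ?thesis using q0 U0[OF that] by (simp add: EK Ez0)
    qed
    have Lpos: "Im (L q) > 0" if "q \<in> U" for q
      using that by (intro pos) (auto simp: EL U_def)
    have eq: "g (L q) = G q" if "q \<in> U" for q
      using GE[OF Lpos[OF that]] EL[OF that] by simp
    have Re: "q / q0 \<notin> \<real>\<^sub>\<le>\<^sub>0" if "q \<in> U" for q
    proof -
      have "cmod (q / q0 - 1) < 1"
        using that q0 by (auto simp: U_def dist_norm norm_minus_commute diff_divide_distrib[symmetric] norm_divide divide_simps)
      hence "\<bar>Re (q / q0 - 1)\<bar> < 1" using abs_Re_le_cmod order_le_less_trans by blast
      thus ?thesis by (auto simp: complex_nonpos_Reals_iff)
    qed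
    have "L holomorphic_on U"
      unfolding L_def K_def using Re q0 by (intro holomorphic_intros) auto
    moreover have "L ` U \<subseteq> \<H>" using Lpos by auto
    ultimately have "(\<lambda>q. g (L q)) holomorphic_on U"
      using holomorphic_on_compose_gen[OF _ hol, of L U] by (simp add: o_def)
    hence "G holomorphic_on U" by (rule holomorphic_transform) (use eq in auto)
    moreover have "q0 \<in> U" "open U" using q0 by (auto simp: U_def)
    ultimately show "G field_differentiable at q0 within ball 0 1 - {0}"
      by (meson holomorphic_on_imp_differentiable_at field_differentiable_at_within)
  qed
  have limG: "G \<midarrow>0\<rightarrow> 0"
  proof (rule LIM_I)
    fix e :: real assume "e > 0"
    then obtain Y where Y: "\<And>z. Im z \<ge> Y \<Longrightarrow> cmod (g z) < e"
      using tendstoD[OF lim, of e] unfolding eventually_filtercomap_at_top_linorder by auto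
    define d where "d = exp (- (2 * pi * Y / h))"
    show "\<exists>d>0. \<forall>q. q \<noteq> 0 \<and> cmod (q - 0) < d \<longrightarrow> cmod (G q - 0) < e"
    proof (intro exI[of _ d] conjI allI impI)
      fix q assume q: "q \<noteq> 0 \<and> cmod (q - 0) < d"
      hence "ln (cmod q) < ln d" by (subst ln_less_cancel_iff) (auto simp: d_def)
      hence "Im (K (Ln q)) \<ge> Y" using h q unfolding ImK d_def by (simp add: field_simps)
      thus "cmod (G q - 0) < e" using Y by (simp add: G_def)
    qed (simp add: d_def)
  qed
  define G0 where "G0 = (\<lambda>q. if q = 0 then 0 else G q)"
  have "G0 holomorphic_on ball 0 1"
    unfolding G0_def by (rule removable_singularity[OF holG _ limG]) simp
  then obtain k where k: "k holomorphic_on ball 0 1" and Gk: "\<And>q. cmod q < 1 \<Longrightarrow> G0 q = q * k q"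
    using Schwarz3[of G0 1] by (auto simp: G0_def)
  define R where "R = exp (- (2 * pi * y0 / h))"
  have R: "0 < R" "R < 1" using h y0 by (simp_all add: R_def)
  \<comment> \<open>Dividing by q before the maximum principle is applied gains the factor |q|/R,
    which is the asserted decay.\<close>
  have "cmod (k (E z)) \<le> M / R"
  proof (rule maximum_modulus_frontier[of k "cball 0 R"])
    show "k holomorphic_on interior (cball 0 R)" "continuous_on (closure (cball 0 R)) k"
      using R by (auto intro!: holomorphic_on_imp_continuous_on intro: holomorphic_on_subset[OF k])
    show "E z \<in> cball 0 R" using z h by (simp add: absE R_def divide_right_mono)
    fix q :: complex assume "q \<in> frontier (cball 0 R)"
    hence q: "cmod q = R" using R by (simp add: frontier_cball)
    hence q0: "q \<noteq> 0" using R by auto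
    have "Im (K (Ln q)) = y0" using h q q0 by (simp add: ImK R_def)
    hence "cmod (G q) \<le> M" unfolding G_def by (rule M)
    moreover have "cmod (G q) = R * cmod (k q)" using Gk[of q] q q0 R by (simp add: G0_def norm_mult)
    ultimately show "cmod (k q) \<le> M / R" using R by (simp add: field_simps)
  qed simp
  moreover have "g z = E z * k (E z)"
    using GE[of z] Gk[of "E z"] z y0 h by (simp add: G0_def absE) (simp add: E_def)
  ultimately have "cmod (g z) \<le> exp (- (2 * pi * Im z / h)) * (M / R)"
    by (simp add: norm_mult absE mult_left_mono del: times_divide_eq_right)
  also have "\<dots> = M * exp (- (2 * pi * (Im z - y0) / h))"
    unfolding R_def by (simp add: exp_minus exp_diff field_simps diff_divide_distrib)
  finally show ?thesis .
qed

section \<open>The neighbourhood of the fundamental domain\<close>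

abbreviation "\<F> \<equiv> modular_fundamental_domain"

lemma sets_F [measurable]: "\<F> \<in> sets borel"
proof -
  have "\<F> = {z. Im z > 0} \<inter> {z. \<bar>Re z\<bar> \<le> 1 / 2} \<inter> {z. cmod z \<ge> 1}"
    by (auto simp: modular_fundamental_domain_def)
  also have "\<dots> \<in> sets borel" by measurable
  finally show ?thesis .
qed

lemma F_subset_H: "z \<in> \<F> \<Longrightarrow> Im z > 0"
  by (simp add: modular_fundamental_domain_def)

lemma F_Im_ge: "z \<in> \<F> \<Longrightarrow> Im z \<ge> 1 / 2"
  using fundamental_domain_Im[of z] real_sqrt_ge_one[of 3] by linarith

text \<open>The domain lies in a strip of width 1 above height 1/2, so a function of the height
  alone leaves a one-dimensional integral.\<close>

lemma nn_integral_F_le: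
  assumes [measurable]: "g \<in> borel_measurable borel"
  shows "(\<integral>\<^sup>+z. indicator \<F> z * g (Im z) \<partial>lborel) \<le> (\<integral>\<^sup>+y. indicator {1/2..} y * g y \<partial>lborel)"
proof -
  have "(\<integral>\<^sup>+z. indicator \<F> z * g (Im z) \<partial>lborel)
      = (\<integral>\<^sup>+y. \<integral>\<^sup>+x. indicator \<F> (Complex x y) * g y \<partial>lborel \<partial>lborel)"
    by (subst nn_integral_complex(1)) auto
  also have "\<dots> \<le> (\<integral>\<^sup>+y. \<integral>\<^sup>+x. (indicator {1/2..} y * g y) * indicator {-(1/2)..1/2::real} x \<partial>lborel \<partial>lborel)"
  proof (rule nn_integral_mono, rule nn_integral_mono)
    fix x y :: real
    show "indicator \<F> (Complex x y) * g y \<le> (indicator {1/2..} y * g y) * indicator {-(1/2)..1/2} x"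
    proof (cases "Complex x y \<in> \<F>")
      case True
      hence "x \<in> {-(1/2)..1/2}" by (auto simp: modular_fundamental_domain_def abs_le_iff)
      thus ?thesis using F_Im_ge[OF True] True by simp
    qed simp
  qed
  also have "\<dots> = (\<integral>\<^sup>+y. indicator {1/2..} y * g y \<partial>lborel)"
    by (subst nn_integral_cmult_indicator) auto
  finally show ?thesis .
qed

lemma nn_integral_inverse_square_half:
  "(\<integral>\<^sup>+y. indicator {1/2..} y * ennreal (1 / y\<^sup>2) \<partial>lborel) = 2"
proof -
  have "(\<integral>\<^sup>+y. ennreal (1 / y\<^sup>2) * indicator {1/2..} y \<partial>lborel) = ennreal (0 - (- (1 / (1/2))))"
  proof (rule nn_integral_FTC_atLeast)
    show "((\<lambda>y::real. - (1 / y)) \<longlongrightarrow> 0) at_top" by real_asymp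
    show "DERIV (\<lambda>y. - (1 / y)) y :> 1 / y\<^sup>2" if "1/2 \<le> y" for y :: real
      using that by (auto intro!: derivative_eq_intros simp: power2_eq_square)
  qed auto
  thus ?thesis by (simp add: mult.commute)
qed

text \<open>The exact area is pi/3; the value 2 is that of the enclosing strip.\<close>

lemma hyp_area_F: "(\<integral>\<^sup>+z. indicator \<F> z * ennreal (1 / (Im z)\<^sup>2) \<partial>lborel) \<le> 2"
  using nn_integral_F_le[of "\<lambda>y. ennreal (1 / y\<^sup>2)"] nn_integral_inverse_square_half by simp

lemma hyp_integral_cong: "(\<And>z. Im z > 0 \<Longrightarrow> u z = v z) \<Longrightarrow> hyp_integral u = hyp_integral v"
  unfolding hyp_integral_def by (intro nn_integral_cong) (auto split: split_indicator)

text \<open>The inverse matrix is, up to sign, a translation, an inversion and another translation,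
  each of which preserves the hyperbolic integral.\<close>

lemma hyp_integral_TST:
  assumes [measurable]: "u \<in> borel_measurable borel"
  shows "hyp_integral (\<lambda>z. u (moebius_action (adj2 (Tm n ** (Sm ** Tm m))) z)) = hyp_integral u"
    and "hyp_integral (\<lambda>z. u (moebius_action (adj2 (Tm n)) z)) = hyp_integral u"
proof -
  show "hyp_integral (\<lambda>z. u (moebius_action (adj2 (Tm n)) z)) = hyp_integral u" for n
    using hyp_integral_translate[OF assms, of "- of_int n"] by simp
  have "adj2 Sm = - Sm" by (simp add: mat2_eq_iff)
  hence "moebius_action (adj2 (Tm n ** (Sm ** Tm m))) z = (- 1 / (z + of_real (- of_int n))) + of_real (- of_int m)"
    if "Im z > 0" for z
    using that by (simp add: adj2_prod moebius_mult SL2Z_mult mult2_minus)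
  hence "hyp_integral (\<lambda>z. u (moebius_action (adj2 (Tm n ** (Sm ** Tm m))) z))
      = hyp_integral (\<lambda>z. (\<lambda>w. u (- 1 / w + of_real (- of_int m))) (z + of_real (- of_int n)))"
    by (intro hyp_integral_cong) simp
  also have "\<dots> = hyp_integral (\<lambda>w. (\<lambda>v. u (v + of_real (- of_int m))) (- 1 / w))"
    by (subst hyp_integral_translate) auto
  also have "\<dots> = hyp_integral (\<lambda>v. u (v + of_real (- of_int m)))"
    by (subst hyp_integral_inversion) auto
  also have "\<dots> = hyp_integral u" by (subst hyp_integral_translate) auto
  finally show "hyp_integral (\<lambda>z. u (moebius_action (adj2 (Tm n ** (Sm ** Tm m))) z)) = hyp_integral u" .
qed

lemma power_le_fact_exp: "t \<ge> 0 \<Longrightarrow> t ^ n \<le> fact n * exp (t::real)"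
proof -
  assume t: "t \<ge> 0"
  have "t ^ n / fact n = (\<Sum>k\<in>{n}. t ^ k /\<^sub>R fact k)" by (simp add: field_simps)
  also have "\<dots> \<le> (\<Sum>k. t ^ k /\<^sub>R fact k)"
    using t by (intro sum_le_suminf summable_exp_generic) auto
  finally show ?thesis by (simp add: exp_def field_simps)
qed

text \<open>Origin of \<open>decay_const\<close>: the power costs \<open>fact n * exp t\<close>, and
  since pi is larger than 1 the factor \<open>exp (- pi * t)\<close> absorbs
  \<open>exp t\<close>.\<close>

lemma power_exp_decay:
  assumes "t \<ge> 1" shows "t ^ n * exp (- (pi * (t - 1))) \<le> fact n * exp (pi::real)"
proof -
  have "t ^ n * exp (- (pi * (t - 1))) \<le> fact n * exp t * exp (- (pi * (t - 1)))"
    using assms by (intro mult_right_mono power_le_fact_exp) auto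
  also have "\<dots> = fact n * exp (t - pi * t + pi)" by (simp add: algebra_simps flip: exp_add)
  also have "\<dots> \<le> fact n * exp pi"
    using assms pi_ge_two by (intro mult_left_mono) (auto simp: mult_le_cancel_right)
  finally show ?thesis .
qed

text \<open>The squares of the mean value inequality reach down to height \<open>3 sqrt 3 / 8 > 3 / 5\<close>.\<close>

lemma reduction_near_fundamental_domain:
  assumes w: "Im w \<ge> 3 / 5"
  obtains n :: int and B where "\<bar>Re w - of_int n\<bar> \<le> 1 / 2"
    "B \<in> {mat 1, Sm ** Tm 0, Sm ** Tm 1, Sm ** Tm (- 1)}" "moebius_action (adj2 (Tm n ** B)) w \<in> \<F>"
proof -
  define n where "n = round (Re w)"
  define w1 where "w1 = w - of_int n"
  have n: "\<bar>Re w - of_int n\<bar> \<le> 1 / 2"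
    unfolding n_def using of_int_round_abs_le[of "Re w"] by (simp add: abs_minus_commute)
  hence re1: "\<bar>Re w1\<bar> \<le> 1 / 2" and im1: "Im w1 \<ge> 3 / 5" using w by (simp_all add: w1_def)
  have w0: "Im w > 0" using w by linarith
  show ?thesis
  proof (cases "cmod w1 \<ge> 1")
    case True
    hence "moebius_action (adj2 (Tm n ** mat 1)) w \<in> \<F>"
      using re1 im1 w0 by (simp add: modular_fundamental_domain_def w1_def)
    thus ?thesis using that n by blast
  next
    case False
    define w2 where "w2 = - 1 / w1"
    have w1ne: "w1 \<noteq> 0" using im1 by auto
    have re2: "Re w2 = - (Re w1 / (cmod w1)\<^sup>2)" by (simp add: w2_def Re_divide cmod_power2)
    have im2: "Im w2 > 0" using im1 w1ne by (simp add: w2_def Im_one_over)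
    have "(Im w1)\<^sup>2 \<ge> (3/5)\<^sup>2" using im1 by (intro power_mono) auto
    hence sq: "(cmod w1)\<^sup>2 \<ge> \<bar>Re w1\<bar>\<^sup>2 + 9/25" by (simp add: cmod_power2 power_divide)
    \<comment> \<open>With x = |Re w1| this reads x \<le> x^2 + 1/4, and |w1|^2 is at least x^2 +
      9/25; together they give x \<le> 3/2 |w1|^2, so the real part of -1/w1 is at most 3/2 in
      modulus and a translation by 0, 1 or -1 brings it back into the strip.\<close>
    have "0 \<le> (\<bar>Re w1\<bar> - 1/2)\<^sup>2" by simp
    hence "\<bar>Re w1\<bar> \<le> \<bar>Re w1\<bar>\<^sup>2 + 1/4" by (simp add: power2_eq_square algebra_simps)
    hence "\<bar>Re w1\<bar> \<le> 3 / 2 * (cmod w1)\<^sup>2" using sq zero_le_power2[of "\<bar>Re w1\<bar>"] by linarith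
    hence re2': "\<bar>Re w2\<bar> \<le> 3 / 2" using w1ne by (simp add: re2 abs_divide pos_divide_le_eq)
    define m :: int where "m = (if \<bar>Re w2\<bar> \<le> 1/2 then 0 else if Re w2 > 0 then 1 else - 1)"
    have m: "m \<in> {0, 1, -1}" by (simp add: m_def)
    define w3 where "w3 = w2 - of_int m"
    have re3: "\<bar>Re w3\<bar> \<le> 1 / 2" using re2' by (auto simp: w3_def m_def abs_if split: if_splits)
    \<comment> \<open>The modulus of w3 is |1 + m w1| / |w1|. As |Re w1| \<le> 1/2 and |w1| < 1, it
      is at least 1 for all three values of m, so a single inversion is enough.\<close>
    have "cmod (1 + of_int m * w1) \<ge> cmod w1"
    proof -
      have "(cmod (1 + of_int m * w1))\<^sup>2 = 1 + 2 * of_int m * Re w1 + (of_int m)\<^sup>2 * (cmod w1)\<^sup>2"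
        by (simp add: cmod_power2) (simp add: power2_eq_square algebra_simps)
      moreover have "(cmod w1)\<^sup>2 \<le> 1" using False by (simp add: power_le_one)
      ultimately have "(cmod (1 + of_int m * w1))\<^sup>2 \<ge> (cmod w1)\<^sup>2"
        using m re1 by (elim insertE) auto
      thus ?thesis by (rule power2_le_imp_le) simp
    qed
    moreover have "w3 = - ((1 + of_int m * w1) / w1)" using w1ne by (simp add: w3_def w2_def field_simps)
    ultimately have "cmod w3 \<ge> 1" using w1ne by (simp add: norm_divide)
    hence F: "w3 \<in> \<F>" using re3 im2 by (simp add: modular_fundamental_domain_def w3_def)
    have "adj2 Sm = - Sm" by (simp add: mat2_eq_iff)
    hence "moebius_action (adj2 (Tm n ** (Sm ** Tm m))) w = w3"
      using w0 by (simp add: adj2_prod moebius_mult SL2Z_mult mult2_minus w3_def w2_def w1_def)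
    thus ?thesis using that[OF n, of "Sm ** Tm m"] F m by auto
  qed
qed

section \<open>Cosets of congruence subgroups\<close>

text \<open>The modulus M makes the cosets finite in number and gives every cusp a width; the
  constants of the estimates depend on the weight alone.\<close>

locale congruence_group =
  fixes \<Gamma> :: "(int^2^2) set" and M :: nat
  assumes sub: "\<Gamma> \<subseteq> SL2Z" and one: "mat 1 \<in> \<Gamma>"
    and mult: "A \<in> \<Gamma> \<Longrightarrow> B \<in> \<Gamma> \<Longrightarrow> A ** B \<in> \<Gamma>" and inv: "A \<in> \<Gamma> \<Longrightarrow> adj2 A \<in> \<Gamma>"
    and M: "M > 0" and principal: "principal_congruence_subgroup M \<subseteq> \<Gamma>"
begin

definition coset :: "int^2^2 \<Rightarrow> (int^2^2) set" where
  "coset A = {B. \<exists>G\<in>\<Gamma>. B = G ** A \<or> B = - (G ** A)}"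

lemma pm_cosets_eq: "pm_cosets \<Gamma> = coset ` SL2Z"
  by (simp add: pm_cosets_def coset_def)

lemma coset_self: "A \<in> coset A"
  unfolding coset_def using one by (auto intro: bexI[of _ "mat 1"])

lemma coset_in_SL2Z: "A \<in> SL2Z \<Longrightarrow> B \<in> coset A \<Longrightarrow> B \<in> SL2Z"
  unfolding coset_def by (auto intro!: SL2Z_mult intro: subsetD[OF sub])

lemma coset_trans: "B \<in> coset A \<Longrightarrow> C \<in> coset B \<Longrightarrow> C \<in> coset A"
  unfolding coset_def by (auto simp: mult2_minus matrix_mul_assoc intro: mult)

lemma coset_sym:
  assumes "B \<in> coset A" shows "A \<in> coset B"
proof -
  obtain G where G: "G \<in> \<Gamma>" "B = G ** A \<or> B = - (G ** A)" using assms by (auto simp: coset_def)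
  hence "A = adj2 G ** B \<or> A = - (adj2 G ** B)"
    using sub by (auto simp: mult2_minus)
  thus ?thesis using inv[OF G(1)] by (auto simp: coset_def)
qed

lemma coset_eq_iff: "coset A = coset B \<longleftrightarrow> B \<in> coset A"
proof
  assume "B \<in> coset A"
  thus "coset A = coset B" using coset_trans coset_sym by blast
qed (use coset_self in auto)

lemma coset_mult_right: "B \<in> coset A \<Longrightarrow> B ** X \<in> coset (A ** X)"
  unfolding coset_def by (auto simp: mult2_minus matrix_mul_assoc)

lemma coset_mult_right_eq: "coset A = coset B \<Longrightarrow> coset (A ** X) = coset (B ** X)"
  using coset_mult_right by (auto simp: coset_eq_iff)

text \<open>The same choice as in \<open>petersson\<close>, so that the two sums over cosets match
  literally.\<close>

definition rep :: "(int^2^2) set \<Rightarrow> int^2^2" where "rep C = (SOME A. A \<in> C)"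

lemma rep_in:
  assumes "C \<in> pm_cosets \<Gamma>" shows "rep C \<in> C"
proof -
  obtain A where "A \<in> C" using assms coset_self by (auto simp: pm_cosets_eq)
  thus ?thesis unfolding rep_def by (rule someI)
qed

lemma rep_in_SL2Z: "C \<in> pm_cosets \<Gamma> \<Longrightarrow> rep C \<in> SL2Z"
  using rep_in[of C] coset_in_SL2Z by (auto simp: pm_cosets_eq)

lemma coset_rep: "C \<in> pm_cosets \<Gamma> \<Longrightarrow> coset (rep C) = C"
  using rep_in[of C] by (auto simp: pm_cosets_eq coset_eq_iff[symmetric])

lemma rep_coset: "A \<in> SL2Z \<Longrightarrow> rep (coset A) \<in> coset A"
  by (rule rep_in) (simp add: pm_cosets_eq)

lemma congruent_imp_coset_eq:
  assumes A: "A \<in> SL2Z" and B: "B \<in> SL2Z" and AB: "\<And>i j. int M dvd B$i$j - A$i$j"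
  shows "coset A = coset B"
proof -
  have *: "int M dvd (B ** adj2 A) $ i $ j - (A ** adj2 A) $ i $ j" for i j
  proof -
    have "(B ** adj2 A) $ i $ j - (A ** adj2 A) $ i $ j
       = (B$i$1 - A$i$1) * adj2 A $1$j + (B$i$2 - A$i$2) * adj2 A $2$j"
      by (simp add: mult2_nth algebra_simps)
    thus ?thesis using AB by simp
  qed
  hence "B ** adj2 A \<in> principal_congruence_subgroup M"
    using A B by (simp add: principal_congruence_subgroup_def SL2Z_mult)
  hence "B ** adj2 A \<in> \<Gamma>" using principal by blast
  moreover have "B = (B ** adj2 A) ** A" using A by simp
  ultimately have "B \<in> coset A" unfolding coset_def by blast
  thus ?thesis by (simp add: coset_eq_iff)
qed

text \<open>A coset is determined by the residues modulo M of the entries of any of its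
  elements.\<close>

lemma finite_cosets: "finite (pm_cosets \<Gamma>)"
proof -
  define red where "red = (\<lambda>A::int^2^2. (A$1$1 mod M, A$1$2 mod M, A$2$1 mod M, A$2$2 mod M))"
  have *: "coset A = coset B" if "A \<in> SL2Z" "B \<in> SL2Z" "red A = red B" for A B
  proof (rule congruent_imp_coset_eq[OF that(1,2)])
    have "\<forall>i j. B$i$j mod int M = A$i$j mod int M"
      using that(3) by (auto simp: red_def forall_2)
    thus "int M dvd B$i$j - A$i$j" for i j by (auto simp: mod_eq_dvd_iff)
  qed
  hence "pm_cosets \<Gamma> \<subseteq> (\<lambda>t. coset (inv_into SL2Z red t)) ` (red ` SL2Z)"
    unfolding pm_cosets_eq image_image
  proof (intro image_subsetI)
    fix A assume A: "A \<in> SL2Z"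
    hence "red A \<in> red ` SL2Z" by blast
    from inv_into_into[OF this] f_inv_into_f[OF this]
    have "coset A = coset (inv_into SL2Z red (red A))" by (intro *) (use A in auto)
    thus "coset A \<in> (\<lambda>A. coset (inv_into SL2Z red (red A))) ` SL2Z" using A by blast
  qed
  moreover have "finite (red ` SL2Z)"
  proof (rule finite_subset)
    show "red ` SL2Z \<subseteq> {0..<int M} \<times> {0..<int M} \<times> {0..<int M} \<times> {0..<int M}"
      using M by (auto simp: red_def)
  qed auto
  ultimately show ?thesis by (meson finite_imageI finite_subset)
qed

section \<open>Widths of cusps\<close>

text \<open>Cosets are taken up to sign, so irregular cusps are not singled out: translation by the
  width may multiply a form by a root of unity, which its fourth power does not see.\<close>

definition width :: "int^2^2 \<Rightarrow> nat" where
  "width A = (LEAST n. n > 0 \<and> A ** Tm (int n) \<in> coset A)"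

lemma width:
  assumes A: "A \<in> SL2Z"
  shows "width A > 0" "A ** Tm (int (width A)) \<in> coset A"
proof -
  have "coset A = coset (A ** Tm (int M))"
  proof (rule congruent_imp_coset_eq)
    fix i j :: 2
    have "\<forall>i j. int M dvd (A ** Tm (int M)) $ i $ j - A $ i $ j"
      by (auto simp: forall_2 mult2_nth)
    thus "int M dvd (A ** Tm (int M)) $ i $ j - A $ i $ j" by blast
  qed (use A in \<open>auto intro: SL2Z_mult\<close>)
  hence "\<exists>n. n > 0 \<and> A ** Tm (int n) \<in> coset A" using M coset_eq_iff by blast
  from LeastI_ex[OF this] show "width A > 0" "A ** Tm (int (width A)) \<in> coset A"
    unfolding width_def by blast+
qed

text \<open>The n for which A T^n lies in the coset of A form a subgroup of the integers, and the
  width is its least positive element.\<close>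

lemma width_dvd:
  assumes A: "A \<in> SL2Z" and n: "A ** Tm n \<in> coset A" shows "int (width A) dvd n"
proof -
  define P where "P = {n. A ** Tm n \<in> coset A}"
  have add: "m + n \<in> P" if "m \<in> P" "n \<in> P" for m n
  proof -
    have "(A ** Tm m) ** Tm n \<in> coset (A ** Tm n)" using that by (auto simp: P_def intro: coset_mult_right)
    thus ?thesis using that coset_trans by (auto simp: P_def Tm_add simp flip: matrix_mul_assoc)
  qed
  have neg: "- m \<in> P" if "m \<in> P" for m
  proof -
    have "A ** Tm (- m) \<in> coset ((A ** Tm m) ** Tm (- m))"
      using that by (intro coset_mult_right) (auto simp: P_def intro: coset_sym)
    thus ?thesis by (simp add: P_def Tm_add flip: matrix_mul_assoc)
  qed
  have zero: "0 \<in> P" by (simp add: P_def coset_self)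
  have nmul: "int k * m \<in> P" if "m \<in> P" for k m
    by (induction k) (auto simp: zero that algebra_simps intro: add)
  have mul: "k * m \<in> P" if "m \<in> P" for k m
    using nmul[OF that, of "nat k"] neg[OF nmul[OF that, of "nat (- k)"]] by (cases "k \<ge> 0") auto
  define h where "h = int (width A)"
  have h: "h > 0" "h \<in> P" using width[OF A] by (auto simp: h_def P_def)
  have "n + (- (n div h)) * h \<in> P" using n h by (intro add mul) (auto simp: P_def)
  hence "n mod h \<in> P" by (simp add: minus_div_mult_eq_mod[symmetric])
  have "n mod h = 0"
  proof (rule ccontr)
    assume "n mod h \<noteq> 0"
    moreover have "n mod h \<ge> 0" "n mod h < h" using h by auto
    ultimately have "nat (n mod h) > 0 \<and> A ** Tm (int (nat (n mod h))) \<in> coset A" "nat (n mod h) < width A"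
      using \<open>n mod h \<in> P\<close> by (auto simp: P_def h_def)
    thus False using not_less_Least unfolding width_def by blast
  qed
  thus ?thesis by (auto simp: h_def)
qed

end

section \<open>The Petersson norm bounds a form pointwise\<close>

definition invnorm :: "real \<Rightarrow> (complex \<Rightarrow> complex) \<Rightarrow> complex \<Rightarrow> real" where
  "invnorm \<kappa> f z = (cmod (f z))\<^sup>2 * Im z powr \<kappa>"

lemma invnorm_nonneg [simp]: "invnorm \<kappa> f z \<ge> 0"
  by (simp add: invnorm_def)

text \<open>The principal branch makes this a slash operator only up to factors of modulus one. What
  counts is that it is holomorphic, together with its modulus and, for half-integral \<kappa>, its
  fourth power.\<close>

definition slash :: "real \<Rightarrow> (complex \<Rightarrow> complex) \<Rightarrow> int^2^2 \<Rightarrow> complex \<Rightarrow> complex" where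
  "slash \<kappa> f A z = denom A z powr (- of_real \<kappa>) * f (moebius_action A z)"

lemma powr_real_power2: "x \<ge> 0 \<Longrightarrow> (x powr a)\<^sup>2 = (x powr (2 * a) :: real)"
  by (simp add: power2_eq_square flip: powr_add)

lemma Im_moebius_powr:
  assumes "A \<in> SL2Z" "Im z > 0"
  shows "Im (moebius_action A z) powr \<kappa> = Im z powr \<kappa> * (cmod (denom A z) powr (- \<kappa>))\<^sup>2"
proof -
  define d where "d = cmod (denom A z)"
  have d: "d > 0" using denom_nonzero[OF assms] by (simp add: d_def)
  have "(d\<^sup>2) powr \<kappa> = d powr (2 * \<kappa>)"
    using d by (simp add: powr_powr flip: powr_numeral)
  moreover have "(d powr (- \<kappa>))\<^sup>2 = d powr (- (2 * \<kappa>))"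
    using d by (simp add: powr_real_power2)
  ultimately have "(Im z / d\<^sup>2) powr \<kappa> = Im z powr \<kappa> * (d powr (- \<kappa>))\<^sup>2"
    using d assms by (simp add: powr_divide powr_minus_divide)
  thus ?thesis using assms by (simp add: Im_moebius d_def)
qed

lemma invnorm_slash:
  assumes "A \<in> SL2Z" "Im z > 0"
  shows "invnorm \<kappa> f (moebius_action A z) = invnorm \<kappa> (slash \<kappa> f A) z"
  using assms by (simp add: invnorm_def slash_def Im_moebius_powr norm_mult norm_powr_real_powr' power_mult_distrib)

text \<open>If the lower left entry is not 0, the denominator is never real on \<open>\<H>\<close>
  and avoids the cut of the logarithm; otherwise it is constant.\<close>

lemma holomorphic_slash:
  assumes A: "A \<in> SL2Z" and f: "f holomorphic_on \<H>"
  shows "slash \<kappa> f A holomorphic_on \<H>"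
proof -
  have "(\<lambda>z. denom A z powr (- of_real \<kappa>)) holomorphic_on \<H>"
  proof (cases "A$2$1 = 0")
    case True
    thus ?thesis by (simp add: denom_def)
  next
    case False
    hence "denom A z \<notin> \<real>\<^sub>\<le>\<^sub>0" if "z \<in> \<H>" for z
      using that by (auto simp: complex_nonpos_Reals_iff Im_denom)
    thus ?thesis by (intro holomorphic_intros) auto
  qed
  moreover have "(\<lambda>z. f (moebius_action A z)) holomorphic_on \<H>"
  proof -
    have "moebius_action A ` \<H> \<subseteq> \<H>" using A by auto
    from holomorphic_on_compose_gen[OF holomorphic_moebius[OF A] f this] show ?thesis
      by (simp add: o_def)
  qed
  ultimately show ?thesis unfolding slash_def[abs_def] by (rule holomorphic_on_mult)
qed

text \<open>Four times the weight m/2 is the integer 2m, so the branch disappears.\<close>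

lemma slash_power4:
  assumes "A \<in> SL2Z" "Im z > 0"
  shows "slash (real m / 2) f A z ^ 4 = f (moebius_action A z) ^ 4 / denom A z ^ (2 * m)"
proof -
  have nz: "denom A z \<noteq> 0" using denom_nonzero assms by blast
  have "(denom A z powr (- of_real (real m / 2))) ^ 4 = exp (of_nat 4 * (- of_real (real m / 2) * Ln (denom A z)))"
    using nz unfolding powr_def by (simp only: exp_of_nat_mult if_False)
  also have "of_nat 4 * (- of_real (real m / 2) * Ln (denom A z)) = - (of_nat (2 * m) * Ln (denom A z))"
    by simp
  also have "exp \<dots> = 1 / denom A z ^ (2 * m)"
    unfolding exp_minus exp_of_nat_mult using nz by (simp add: exp_Ln divide_inverse)
  finally show ?thesis by (simp add: slash_def power_mult_distrib)
qed

lemma exp_half_decay: "exp (- (2 * pi * t)) = (exp (- (pi * t)))\<^sup>2"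
  by (simp add: power2_eq_square flip: exp_add)

definition decay_const :: "nat \<Rightarrow> real" where
  "decay_const m = fact m * exp pi"

lemma decay_const_pos: "decay_const m > 0" by (simp add: decay_const_def)

text \<open>The parameter \<open>m\<close> is twice the weight of \<open>f\<close>.\<close>

context congruence_group
begin

text \<open>The notion shared by integral and half-integral weight. It is not closed under sums, so
  linear combinations are first formed inside \<open>cusp_forms\<close> and only then regarded as
  weak forms.\<close>

definition weak_form :: "nat \<Rightarrow> (complex \<Rightarrow> complex) \<Rightarrow> bool" where
  "weak_form m f \<longleftrightarrow> f holomorphic_on \<H> \<and>
     (\<forall>G\<in>\<Gamma>. \<forall>z\<in>\<H>. f (moebius_action G z) ^ 4 = denom G z ^ (2 * m) * f z ^ 4) \<and>
     (\<forall>A\<in>SL2Z. (slash (real m / 2) f A \<longlongrightarrow> 0) (filtercomap Im at_top))"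

lemma invnorm_invariant:
  assumes f: "weak_form m f" and G: "G \<in> \<Gamma>" and z: "Im z > 0"
  shows "invnorm (real m / 2) f (moebius_action G z) = invnorm (real m / 2) f z"
proof -
  have GS: "G \<in> SL2Z" using G sub by blast
  have "f (moebius_action G z) ^ 4 = denom G z ^ (2 * m) * f z ^ 4"
    using f G z by (auto simp: weak_form_def)
  hence "slash (real m / 2) f G z ^ 4 = f z ^ 4"
    using denom_nonzero[OF GS z] by (simp add: slash_power4 GS z)
  hence "cmod (slash (real m / 2) f G z) ^ 4 = cmod (f z) ^ 4"
    by (metis norm_power)
  hence "cmod (slash (real m / 2) f G z) = cmod (f z)"
    by (simp add: power_eq_iff_eq_base)
  thus ?thesis unfolding invnorm_slash[OF GS z] by (simp add: invnorm_def)
qed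

lemma invnorm_coset:
  assumes f: "weak_form m f" and A: "A \<in> SL2Z" "B \<in> coset A" and z: "Im z > 0"
  shows "invnorm (real m / 2) f (moebius_action B z) = invnorm (real m / 2) f (moebius_action A z)"
proof -
  obtain G where G: "G \<in> \<Gamma>" "B = G ** A \<or> B = - (G ** A)" using A by (auto simp: coset_def)
  have GS: "G \<in> SL2Z" using G sub by blast
  have "moebius_action B z = moebius_action G (moebius_action A z)"
    using G A z GS by (auto simp: moebius_mult)
  thus ?thesis using invnorm_invariant[OF f G(1)] A z by simp
qed

definition cell_energy :: "real \<Rightarrow> (complex \<Rightarrow> complex) \<Rightarrow> int^2^2 \<Rightarrow> ennreal" where
  "cell_energy \<kappa> f A = (\<integral>\<^sup>+z. indicator \<F> z * ennreal (invnorm \<kappa> f (moebius_action A z) / (Im z)\<^sup>2) \<partial>lborel)"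

text \<open>The squared Petersson norm, with values in \<open>ennreal\<close> so that sums and
  comparisons come before finiteness.\<close>

definition energy :: "real \<Rightarrow> (complex \<Rightarrow> complex) \<Rightarrow> ennreal" where
  "energy \<kappa> f = (\<Sum>C\<in>pm_cosets \<Gamma>. cell_energy \<kappa> f (rep C))"

lemma cell_energy_coset:
  assumes "weak_form m f" "A \<in> SL2Z" "B \<in> coset A"
  shows "cell_energy (real m / 2) f B = cell_energy (real m / 2) f A"
  unfolding cell_energy_def
  by (intro nn_integral_cong) (auto simp: invnorm_coset[OF assms] F_subset_H split: split_indicator)

lemma slash_periodic:
  assumes f: "weak_form m f" and A: "A \<in> SL2Z" and z: "Im z > 0"
  shows "slash (real m / 2) f A (z + of_real (real (width A))) ^ 4 = slash (real m / 2) f A z ^ 4"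
proof -
  define h where "h = int (width A)"
  obtain G where G: "G \<in> \<Gamma>" "A ** Tm h = G ** A \<or> A ** Tm h = - (G ** A)"
    using width(2)[OF A] by (auto simp: coset_def h_def)
  have GS: "G \<in> SL2Z" using G sub by blast
  have zh: "moebius_action (Tm h) z = z + of_real (real (width A))" by (simp add: h_def)
  have zh0: "Im (z + of_real (real (width A))) > 0" using z by simp
  have Az: "Im (moebius_action A z) > 0" using A z by simp
  have m1: "moebius_action A (z + of_real (real (width A))) = moebius_action G (moebius_action A z)"
  proof -
    have "moebius_action A (z + of_real (real (width A))) = moebius_action (A ** Tm h) z"
      using A z by (simp add: moebius_mult h_def)
    also have "\<dots> = moebius_action (G ** A) z" using G(2) by auto
    finally show ?thesis using A z GS by (simp add: moebius_mult)
  qed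
  have "denom A (z + of_real (real (width A))) = denom (A ** Tm h) z"
    using z by (simp add: denom_mult h_def)
  hence d1: "denom A (z + of_real (real (width A))) ^ (2 * m) = denom G (moebius_action A z) ^ (2 * m) * denom A z ^ (2 * m)"
  proof -
    have "denom (A ** Tm h) z ^ (2 * m) = denom (G ** A) z ^ (2 * m)" using G(2) by auto
    also have "denom (G ** A) z = denom G (moebius_action A z) * denom A z"
      using A z by (simp add: denom_mult)
    finally show ?thesis using \<open>denom A (z + of_real (real (width A))) = denom (A ** Tm h) z\<close>
      by (simp only: power_mult_distrib)
  qed
  have "f (moebius_action G (moebius_action A z)) ^ 4 = denom G (moebius_action A z) ^ (2 * m) * f (moebius_action A z) ^ 4"
    using f G Az by (auto simp: weak_form_def)
  thus ?thesis
    using denom_nonzero[OF GS Az]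
    unfolding slash_power4[OF A z] slash_power4[OF A zh0] m1 d1 by simp
qed

text \<open>The fourth power of the slashed form has period h, so it decays like exp (-2 pi (y/h -
  1)) and its square root, the squared modulus, like exp (-pi (y/h - 1)). This beats the growth
  (y/h)^\<kappa> of the weight factor.\<close>

lemma invnorm_cusp_decay:
  assumes f: "weak_form m f" and A: "A \<in> SL2Z"
    and c: "\<And>z. Im z = real (width A) \<Longrightarrow> invnorm (real m / 2) f (moebius_action A z) \<le> c"
    and z: "Im z \<ge> real (width A)"
  shows "invnorm (real m / 2) f (moebius_action A z) \<le> decay_const m * c"
proof -
  define h where "h = real (width A)"
  define \<kappa> where "\<kappa> = real m / 2"
  define G where "G = slash \<kappa> f A"
  have h: "h > 0" using width(1)[OF A] by (simp add: h_def)
  have z0: "Im z > 0" using z h by (simp add: h_def)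
  have c0: "c \<ge> 0" using order_trans[OF invnorm_nonneg c[of "Complex 0 h"]] by (simp add: h_def)
  have inv: "invnorm \<kappa> f (moebius_action A w) = (cmod (G w))\<^sup>2 * Im w powr \<kappa>" if "Im w > 0" for w
    using invnorm_slash[OF A that, of \<kappa> f] by (simp add: G_def invnorm_def)
  have "cmod (G z ^ 4) \<le> (c / h powr \<kappa>)\<^sup>2 * exp (- (2 * pi * (Im z - h) / h))"
  proof (rule periodic_decay[where g = "\<lambda>z. G z ^ 4"])
    show "(\<lambda>z. G z ^ 4) holomorphic_on \<H>"
      using f unfolding G_def weak_form_def by (intro holomorphic_intros holomorphic_slash[OF A]) auto
    show "((\<lambda>z. G z ^ 4) \<longlongrightarrow> 0) (filtercomap Im at_top)"
      using tendsto_power[of G 0 _ 4] f A by (auto simp: weak_form_def G_def \<kappa>_def)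
    show "G (z + of_real h) ^ 4 = G z ^ 4" if "Im z > 0" for z
      using slash_periodic[OF f A that] by (simp add: G_def h_def \<kappa>_def)
    show "cmod (G w ^ 4) \<le> (c / h powr \<kappa>)\<^sup>2" if w: "Im w = h" for w
    proof -
      have "(cmod (G w))\<^sup>2 * h powr \<kappa> \<le> c"
        using c[of w] w h inv[of w] by (simp add: h_def \<kappa>_def)
      hence "(cmod (G w))\<^sup>2 \<le> c / h powr \<kappa>" using h by (simp add: pos_le_divide_eq)
      hence "((cmod (G w))\<^sup>2)\<^sup>2 \<le> (c / h powr \<kappa>)\<^sup>2" by (intro power_mono) auto
      thus ?thesis by (simp add: norm_power)
    qed
  qed (use h z in \<open>auto simp: h_def\<close>)
  also have "\<dots> = (c / h powr \<kappa> * exp (- (pi * (Im z / h - 1))))\<^sup>2"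
    using exp_half_decay[of "Im z / h - 1"] h by (simp add: power_mult_distrib power_divide diff_divide_distrib right_diff_distrib)
  finally have "((cmod (G z))\<^sup>2)\<^sup>2 \<le> (c / h powr \<kappa> * exp (- (pi * (Im z / h - 1))))\<^sup>2"
    by (simp add: norm_power)
  hence "(cmod (G z))\<^sup>2 \<le> c / h powr \<kappa> * exp (- (pi * (Im z / h - 1)))"
    by (rule power2_le_imp_le) (use c0 h in simp)
  hence "(cmod (G z))\<^sup>2 * Im z powr \<kappa> \<le> c / h powr \<kappa> * exp (- (pi * (Im z / h - 1))) * Im z powr \<kappa>"
    by (rule mult_right_mono) simp
  also have "\<dots> = c * ((Im z / h) powr \<kappa> * exp (- (pi * (Im z / h - 1))))"
    using h z0 by (simp add: powr_divide)
  also have "\<dots> \<le> c * ((Im z / h) ^ m * exp (- (pi * (Im z / h - 1))))"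
  proof (intro mult_left_mono mult_right_mono c0)
    have "Im z / h \<ge> 1" using h z by (simp add: h_def)
    hence "(Im z / h) powr \<kappa> \<le> (Im z / h) powr (real m)"
      by (intro powr_mono) (auto simp: \<kappa>_def)
    also have "\<dots> = (Im z / h) ^ m" using h z0 by (intro powr_realpow) auto
    finally show "(Im z / h) powr \<kappa> \<le> (Im z / h) ^ m" .
  qed auto
  also have "\<dots> \<le> c * decay_const m"
    using h z unfolding decay_const_def by (intro mult_left_mono power_exp_decay c0) (auto simp: h_def)
  finally show ?thesis using inv[OF z0] by (simp add: \<kappa>_def mult.commute)
qed

text \<open>Compactness below the width, decay above it. The bound depends on f and serves only to
  show that the energy is finite.\<close>

lemma invnorm_bounded:
  assumes f: "weak_form m f" and A: "A \<in> SL2Z"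
  obtains c where "\<And>z. z \<in> \<F> \<Longrightarrow> invnorm (real m / 2) f (moebius_action A z) \<le> c"
proof -
  define h where "h = real (width A)"
  define \<kappa> where "\<kappa> = real m / 2"
  have h: "h \<ge> 1" using width(1)[OF A] by (simp add: h_def)
  \<comment> \<open>The half width h makes the box large enough for a full period of the line of
    height h as well as for the lower part of \<open>\<F>\<close>.\<close>
  define K where "K = cbox (Complex (- h) (1/2)) (Complex h h)"
  have KH: "K \<subseteq> \<H>" by (auto simp: K_def in_cbox_complex_iff)
  have "continuous_on K (\<lambda>z. invnorm \<kappa> (slash \<kappa> f A) z)"
    unfolding invnorm_def using KH f
    by (intro continuous_intros holomorphic_on_imp_continuous_on holomorphic_on_subset[OF holomorphic_slash[OF A]])
       (auto simp: weak_form_def)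
  hence "compact ((\<lambda>z. invnorm \<kappa> (slash \<kappa> f A) z) ` K)"
    by (intro compact_continuous_image) (auto simp: K_def)
  then obtain c where c: "\<And>z. z \<in> K \<Longrightarrow> invnorm \<kappa> (slash \<kappa> f A) z \<le> c"
    by (meson bdd_above.E bounded_imp_bdd_above compact_imp_bounded image_eqI)
  have cK: "invnorm \<kappa> f (moebius_action A z) \<le> c" if "z \<in> K" for z
    using c[OF that] that KH invnorm_slash[OF A, of z \<kappa> f] by auto
  have line: "invnorm \<kappa> f (moebius_action A z) \<le> c" if z: "Im z = h" for z
  proof -
    define n where "n = - round (Re z / h)"
    define g where "g = (\<lambda>z. slash \<kappa> f A z ^ 4)"
    have z0: "Im z > 0" using z h by simp
    have "g (z + of_int n * of_real h) = g z"
      by (rule periodic_int_multiple) (use slash_periodic[OF f A] z0 in \<open>auto simp: g_def h_def \<kappa>_def\<close>)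
    hence "cmod (slash \<kappa> f A (z + of_int n * of_real h)) ^ 4 = cmod (slash \<kappa> f A z) ^ 4"
      unfolding g_def by (metis norm_power)
    hence eq: "cmod (slash \<kappa> f A (z + of_int n * of_real h)) = cmod (slash \<kappa> f A z)"
      by (simp add: power_eq_iff_eq_base)
    have "\<bar>Re z / h + of_int n\<bar> \<le> 1/2"
      unfolding n_def using of_int_round_abs_le[of "Re z / h"] by (simp add: abs_minus_commute)
    hence "\<bar>Re z / h + of_int n\<bar> * h \<le> 1 * h" using h by (intro mult_right_mono) auto
    moreover have "\<bar>Re z / h + of_int n\<bar> * h = \<bar>(Re z / h + of_int n) * h\<bar>" using h by (simp add: abs_mult)
    moreover have "(Re z / h + of_int n) * h = Re z + of_int n * h" using h by (simp add: field_simps)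
    ultimately have "\<bar>Re z + of_int n * h\<bar> \<le> h" by simp
    hence "z + of_int n * of_real h \<in> K"
      using h z by (auto simp: K_def in_cbox_complex_iff abs_le_iff)
    from c[OF this] eq z show ?thesis
      unfolding invnorm_slash[OF A z0] by (simp add: invnorm_def)
  qed
  have c0: "c \<ge> 0"
    using order_trans[OF invnorm_nonneg line[of "Complex 0 h"]] by simp
  show ?thesis
  proof (rule that[of "max c (decay_const m * c)"])
    fix z assume z: "z \<in> \<F>"
    show "invnorm (real m / 2) f (moebius_action A z) \<le> max c (decay_const m * c)"
    proof (cases "Im z \<ge> h")
      case True
      have "invnorm (real m / 2) f (moebius_action A z) \<le> decay_const m * c"
        by (rule invnorm_cusp_decay[OF f A]) (use True line in \<open>simp_all add: h_def \<kappa>_def\<close>)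
      thus ?thesis by simp
    next
      case False
      hence "z \<in> K" using z F_Im_ge[OF z] h
        by (auto simp: K_def in_cbox_complex_iff modular_fundamental_domain_def abs_le_iff)
      from cK[OF this] show ?thesis by (simp add: \<kappa>_def)
    qed
  qed
qed

lemma cell_energy_finite:
  assumes f: "weak_form m f" and A: "A \<in> SL2Z"
  shows "cell_energy (real m / 2) f A < \<infinity>"
proof -
  obtain c where c: "\<And>z. z \<in> \<F> \<Longrightarrow> invnorm (real m / 2) f (moebius_action A z) \<le> c"
    by (rule invnorm_bounded[OF f A]) blast
  define c' where "c' = max 0 c"
  have "c' \<ge> 0" by (simp add: c'_def)
  have "cell_energy (real m / 2) f A \<le> (\<integral>\<^sup>+z. ennreal (c') * (indicator \<F> z * ennreal (1 / (Im z)\<^sup>2)) \<partial>lborel)"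
    unfolding cell_energy_def
  proof (intro nn_integral_mono)
    fix z :: complex
    show "indicator \<F> z * ennreal (invnorm (real m / 2) f (moebius_action A z) / (Im z)\<^sup>2)
       \<le> ennreal (c') * (indicator \<F> z * ennreal (1 / (Im z)\<^sup>2))"
    proof (cases "z \<in> \<F>")
      case True
      have "ennreal (invnorm (real m / 2) f (moebius_action A z) / (Im z)\<^sup>2) \<le> ennreal (c' / (Im z)\<^sup>2)"
        using c[OF True] by (intro ennreal_leI divide_right_mono) (auto simp: c'_def)
      thus ?thesis using True \<open>c' \<ge> 0\<close> by (simp flip: ennreal_mult)
    qed simp
  qed
  also have "\<dots> = ennreal (c') * (\<integral>\<^sup>+z. indicator \<F> z * ennreal (1 / (Im z)\<^sup>2) \<partial>lborel)"
    by (rule nn_integral_cmult) measurable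
  also have "\<dots> \<le> ennreal (c') * 2"
    by (intro mult_left_mono hyp_area_F) auto
  also have "\<dots> < \<infinity>" by (simp add: ennreal_mult_less_top)
  finally show ?thesis .
qed

lemma energy_finite: "weak_form m f \<Longrightarrow> energy (real m / 2) f < \<infinity>"
  unfolding energy_def using cell_energy_finite[of m f] rep_in_SL2Z finite_cosets by auto

end

section \<open>Covering a square by translates of the fundamental domain\<close>

lemma measurable_moebius [measurable]: "moebius_action A \<in> borel_measurable borel"
  unfolding moebius_action_def[abs_def] denom_def by measurable

text \<open>All elements differ from the smallest one by a nonnegative multiple of h below 2 h,
  hence by 0 or h.\<close>

lemma card_le_2_if_spread:
  fixes S :: "int set"
  assumes fin: "finite S" and dvd: "\<And>a b. a \<in> S \<Longrightarrow> b \<in> S \<Longrightarrow> h dvd a - b"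
    and diam: "\<And>a b. a \<in> S \<Longrightarrow> b \<in> S \<Longrightarrow> a - b < 2 * h"
  shows "card S \<le> 2"
proof (cases "S = {}")
  case False
  define a where "a = Min S"
  have a: "a \<in> S" "\<And>b. b \<in> S \<Longrightarrow> a \<le> b" using fin False by (auto simp: a_def)
  have "S \<subseteq> {a, a + h}"
  proof
    fix b assume b: "b \<in> S"
    obtain k where k: "b - a = h * k" using dvd[OF b a(1)] by (auto elim: dvdE)
    have d: "0 \<le> b - a" "b - a < 2 * h" using a(2)[OF b] diam[OF b a(1)] by auto
    hence h: "h > 0" by linarith
    have "k \<ge> 0" using d(1) h unfolding k by (simp add: zero_le_mult_iff)
    moreover have "h * k < h * 2" using d(2) unfolding k by simp
    hence "k < 2" using h by simp
    ultimately have "k = 0 \<or> k = 1" by linarith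
    thus "b \<in> {a, a + h}" using k by auto
  qed
  hence "card S \<le> card {a, a + h}" by (intro card_mono) auto
  also have "\<dots> \<le> 2" by (simp add: card_insert_if)
  finally show ?thesis .
qed simp

text \<open>Used for the cosets met by a square, with k = 2, and for the rows of the modular group
  met by a Poincare series, with k = h.\<close>

lemma sum_fibres_le:
  fixes e :: "'b \<Rightarrow> 'c::linordered_nonzero_semiring"
  assumes I: "finite I" and C: "finite C" "f ` I \<subseteq> C" and card: "\<And>y. y \<in> C \<Longrightarrow> card {x \<in> I. f x = y} \<le> k"
    and e: "\<And>y. y \<in> C \<Longrightarrow> 0 \<le> e y"
  shows "(\<Sum>x\<in>I. e (f x)) \<le> of_nat k * (\<Sum>y\<in>C. e y)"
proof -
  have "(\<Sum>x\<in>I. e (f x)) = (\<Sum>y\<in>C. \<Sum>x\<in>{x \<in> I. f x = y}. e (f x))"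
    using sum.group[OF I C(1,2), of "\<lambda>x. e (f x)"] by simp
  also have "\<dots> = (\<Sum>y\<in>C. of_nat (card {x \<in> I. f x = y}) * e y)"
    by (intro sum.cong refl) simp
  also have "\<dots> \<le> (\<Sum>y\<in>C. of_nat k * e y)"
    using card e by (intro sum_mono mult_right_mono of_nat_mono) auto
  finally show ?thesis by (simp add: sum_distrib_left)
qed

lemma hyp_integral_sum:
  assumes "finite I" "\<And>i. i \<in> I \<Longrightarrow> k i \<in> borel_measurable borel"
  shows "hyp_integral (\<lambda>z. \<Sum>i\<in>I. k i z) = (\<Sum>i\<in>I. hyp_integral (k i))"
  unfolding hyp_integral_def sum_distrib_left
  by (rule nn_integral_sum) (use assms in measurable)

lemma hyp_integral_mono: "(\<And>z. Im z > 0 \<Longrightarrow> u z \<le> v z) \<Longrightarrow> hyp_integral u \<le> hyp_integral v"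
  unfolding hyp_integral_def by (intro nn_integral_mono) (auto split: split_indicator intro: mult_left_mono)

definition reduction_mats :: "(int^2^2) set" where
  "reduction_mats = {mat 1, Sm ** Tm 0, Sm ** Tm 1, Sm ** Tm (- 1)}"

lemma reduction_mats: "finite reduction_mats" "card reduction_mats \<le> 4" "B \<in> reduction_mats \<Longrightarrow> B \<in> SL2Z"
proof -
  show "card reduction_mats \<le> 4"
    unfolding reduction_mats_def
    using card_length[of "[mat 1, Sm ** Tm 0, Sm ** Tm 1, Sm ** Tm (- 1)]"] by simp
qed (auto simp: reduction_mats_def intro: SL2Z_mult)

lemma hyp_integral_reduction_mats:
  assumes "u \<in> borel_measurable borel" "B \<in> reduction_mats"
  shows "hyp_integral (\<lambda>z. u (moebius_action (adj2 (Tm n ** B)) z)) = hyp_integral u"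
  using assms(2) unfolding reduction_mats_def
  by (elim insertE emptyE) (simp_all only: hyp_integral_TST[OF assms(1)] matrix_mul_rid)

text \<open>400 and the power of 4/3 come from the mean value inequality; the remaining factor 8
  counts four reduction matrices and two occurrences of each coset.\<close>

definition sup_const :: "nat \<Rightarrow> real" where
  "sup_const m = decay_const m * (3200 * (4/3) ^ m)"

lemma sup_const_pos: "sup_const m > 0"
  using decay_const_pos by (simp add: sup_const_def)

lemma decay_const_ge_1: "decay_const m \<ge> 1"
proof -
  have "1 * 1 \<le> (fact m :: real) * exp pi" by (intro mult_mono) auto
  thus ?thesis by (simp add: decay_const_def)
qed

context congruence_group
begin

text \<open>The mean value inequality for the square of the slashed form. On the square of half side
  v/4 heights lie between 3v/4 and 5v/4, so v^\<kappa> \<le> (4/3)^m Im^\<kappa>, and 16/(v/4)^2 =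
  256/v^2 is at most 400/Im^2.\<close>

lemma thick_mean_value:
  assumes f: "weak_form m f" and A: "A \<in> SL2Z" and v: "Im z > 0"
  defines "u \<equiv> (\<lambda>w. ennreal (indicator \<H> w *\<^sub>R invnorm (real m / 2) (slash (real m / 2) f A) w))"
  shows "ennreal (invnorm (real m / 2) f (moebius_action A z))
     \<le> ennreal (400 * (4/3) ^ m) * hyp_integral (\<lambda>w. indicator (csquare z (Im z / 4)) w * u w)"
    and "u \<in> borel_measurable borel"
proof -
  define \<kappa> where "\<kappa> = real m / 2"
  define G where "G = slash \<kappa> f A"
  define v where "v = Im z"
  have v: "v > 0" using assms by (simp add: v_def)
  have G: "G holomorphic_on \<H>"
    using f holomorphic_slash[OF A] by (auto simp: G_def weak_form_def)
  show um [measurable]: "u \<in> borel_measurable borel"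
    unfolding u_def invnorm_def G_def[symmetric] \<kappa>_def[symmetric]
    by (intro measurable_compose[OF _ measurable_ennreal] borel_measurable_continuous_on_indicator sets_H
        continuous_intros holomorphic_on_imp_continuous_on[OF G]) auto
  define Q where "Q = csquare z (v / 4)"
  have Q: "3/4 * v \<le> Im w \<and> Im w \<le> 5/4 * v" if "w \<in> Q" for w
  proof -
    have "\<bar>Im w - v\<bar> \<le> v / 4" using that by (simp add: Q_def csquare_def v_def)
    thus ?thesis by linarith
  qed
  have QH: "Q \<subseteq> \<H>" using Q v by fastforce
  have [measurable]: "Q \<in> sets borel" by (simp add: Q_def sets_csquare)
  have "ennreal (cmod ((G z)\<^sup>2)) \<le> ennreal (16 / (v/4)\<^sup>2) * (\<integral>\<^sup>+w. indicator Q w * ennreal (cmod ((G w)\<^sup>2)) \<partial>lborel)"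
    unfolding Q_def
  proof (rule csquare_mean_value)
    show "(\<lambda>w. (G w)\<^sup>2) holomorphic_on csquare z (v / 4)"
      using QH by (intro holomorphic_intros holomorphic_on_subset[OF G]) (simp add: Q_def)
  qed (use v in simp)
  hence mv: "ennreal ((cmod (G z))\<^sup>2) \<le> ennreal (256 / v\<^sup>2) * (\<integral>\<^sup>+w. indicator Q w * ennreal ((cmod (G w))\<^sup>2) \<partial>lborel)"
    by (simp add: norm_power power_divide)
  have [measurable]: "(\<lambda>w. indicator Q w * ennreal ((cmod (G w))\<^sup>2)) \<in> borel_measurable borel"
  proof -
    have "(\<lambda>w. ennreal (indicator Q w *\<^sub>R (cmod (G w))\<^sup>2)) \<in> borel_measurable borel"
      by (intro measurable_compose[OF _ measurable_ennreal] borel_measurable_continuous_on_indicator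
          continuous_intros holomorphic_on_imp_continuous_on[OF holomorphic_on_subset[OF G QH]]) simp
    also have "(\<lambda>w. ennreal (indicator Q w *\<^sub>R (cmod (G w))\<^sup>2)) = (\<lambda>w. indicator Q w * ennreal ((cmod (G w))\<^sup>2))"
      by (auto simp: fun_eq_iff split: split_indicator)
    finally show ?thesis .
  qed
  have pt: "ennreal (v powr \<kappa> * (256 / v\<^sup>2)) * (indicator Q w * ennreal ((cmod (G w))\<^sup>2))
      \<le> ennreal (400 * (4/3) ^ m) * (indicator \<H> w * ennreal (1 / (Im w)\<^sup>2) * (indicator Q w * u w))" for w
  proof (cases "w \<in> Q")
    case True
    have w0: "Im w > 0" and w1: "3/4 * v \<le> Im w" "Im w \<le> 5/4 * v" using Q[OF True] v by linarith+
    have "v powr \<kappa> \<le> (4/3 * Im w) powr \<kappa>" using w1 v by (intro powr_mono2) (auto simp: \<kappa>_def)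
    also have "\<dots> = (4/3) powr \<kappa> * Im w powr \<kappa>" using w0 by (intro powr_mult)
    also have "(4/3::real) powr \<kappa> \<le> (4/3) powr (real m)" by (intro powr_mono) (auto simp: \<kappa>_def)
    also have "(4/3::real) powr (real m) = (4/3) ^ m" by (simp add: powr_realpow)
    finally have p: "v powr \<kappa> \<le> (4/3) ^ m * Im w powr \<kappa>" by (simp add: mult_right_mono)
    have "(Im w)\<^sup>2 \<le> (5/4 * v)\<^sup>2" using w0 w1 by (intro power_mono) auto
    hence q: "256 / v\<^sup>2 \<le> 400 / (Im w)\<^sup>2" using v w0 by (simp add: field_simps power2_eq_square)
    have "v powr \<kappa> * (256 / v\<^sup>2) \<le> ((4/3) ^ m * Im w powr \<kappa>) * (400 / (Im w)\<^sup>2)"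
      using p q by (intro mult_mono) auto
    hence "v powr \<kappa> * (256 / v\<^sup>2) * (cmod (G w))\<^sup>2 \<le> ((4/3) ^ m * Im w powr \<kappa>) * (400 / (Im w)\<^sup>2) * (cmod (G w))\<^sup>2"
      by (rule mult_right_mono) simp
    also have "\<dots> = (400 * (4/3) ^ m) * (1 / (Im w)\<^sup>2 * invnorm \<kappa> G w)"
      by (simp add: invnorm_def)
    finally have "ennreal (v powr \<kappa> * (256 / v\<^sup>2) * (cmod (G w))\<^sup>2) \<le> ennreal ((400 * (4/3) ^ m) * (1 / (Im w)\<^sup>2 * invnorm \<kappa> G w))"
      by (rule ennreal_leI)
    thus ?thesis using True w0
      by (simp add: u_def G_def[symmetric] \<kappa>_def[symmetric] ennreal_mult[symmetric])
  qed simp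
  have "ennreal (invnorm \<kappa> f (moebius_action A z)) = ennreal (v powr \<kappa>) * ennreal ((cmod (G z))\<^sup>2)"
    using invnorm_slash[OF A, of z \<kappa> f] v
    by (simp add: invnorm_def G_def v_def mult.commute flip: ennreal_mult)
  also have "\<dots> \<le> ennreal (v powr \<kappa>) * (ennreal (256 / v\<^sup>2) * (\<integral>\<^sup>+w. indicator Q w * ennreal ((cmod (G w))\<^sup>2) \<partial>lborel))"
    by (intro mult_left_mono mv) simp
  also have "\<dots> = (\<integral>\<^sup>+w. ennreal (v powr \<kappa> * (256 / v\<^sup>2)) * (indicator Q w * ennreal ((cmod (G w))\<^sup>2)) \<partial>lborel)"
  proof -
    have "ennreal (v powr \<kappa> * (256 / v\<^sup>2)) = ennreal (v powr \<kappa>) * ennreal (256 / v\<^sup>2)"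
      by (rule ennreal_mult) auto
    thus ?thesis by (subst nn_integral_cmult) (simp, simp only: mult.assoc)
  qed
  also have "\<dots> \<le> (\<integral>\<^sup>+w. ennreal (400 * (4/3) ^ m) * (indicator \<H> w * ennreal (1 / (Im w)\<^sup>2) * (indicator Q w * u w)) \<partial>lborel)"
    by (intro nn_integral_mono pt)
  also have "\<dots> = ennreal (400 * (4/3) ^ m) * hyp_integral (\<lambda>w. indicator Q w * u w)"
    unfolding hyp_integral_def by (rule nn_integral_cmult) measurable
  finally show "ennreal (invnorm (real m / 2) f (moebius_action A z))
     \<le> ennreal (400 * (4/3) ^ m) * hyp_integral (\<lambda>w. indicator (csquare z (Im z / 4)) w * u w)"
    by (simp add: Q_def v_def \<kappa>_def)
qed

text \<open>The inner indicator equals 1 where it matters; it makes the integrand literally the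
  function of \<open>thick_mean_value\<close>, moved by B.\<close>

lemma cell_energy_eq_hyp_integral:
  assumes A: "A \<in> SL2Z" and B: "B \<in> SL2Z"
  shows "cell_energy \<kappa> f (A ** B) = hyp_integral (\<lambda>w. indicator \<F> w *
     ennreal (indicator \<H> (moebius_action B w) *\<^sub>R invnorm \<kappa> (slash \<kappa> f A) (moebius_action B w)))"
  unfolding cell_energy_def hyp_integral_def
proof (intro nn_integral_cong)
  fix w :: complex
  show "indicator \<F> w * ennreal (invnorm \<kappa> f (moebius_action (A ** B) w) / (Im w)\<^sup>2) =
     indicator \<H> w * ennreal (1 / (Im w)\<^sup>2) * (indicator \<F> w *
     ennreal (indicator \<H> (moebius_action B w) *\<^sub>R invnorm \<kappa> (slash \<kappa> f A) (moebius_action B w)))"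
  proof (cases "w \<in> \<F>")
    case True
    note w = F_subset_H[OF True]
    have "invnorm \<kappa> f (moebius_action (A ** B) w) = invnorm \<kappa> (slash \<kappa> f A) (moebius_action B w)"
      using invnorm_slash[of A "moebius_action B w" \<kappa> f] A B w by (simp add: moebius_mult)
    thus ?thesis using True w B by (simp flip: ennreal_mult)
  qed simp
qed

text \<open>The translates T^n B of the domain that are needed have n in an interval of length v/2 +
  1. For fixed B, two of them give the same coset only if their n differ by a multiple of the width
  h, and v \<le> h makes v/2 + 1 smaller than 2 h.\<close>

lemma thick_bound:
  assumes f: "weak_form m f" and A: "A \<in> SL2Z" and v1: "Im z \<ge> sqrt 3 / 2" and v2: "Im z \<le> real (width A)"
  shows "ennreal (invnorm (real m / 2) f (moebius_action A z)) \<le> ennreal (3200 * (4/3) ^ m) * energy (real m / 2) f"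
proof -
  define \<kappa> where "\<kappa> = real m / 2"
  define v where "v = Im z"
  \<comment> \<open>The lower edge of the square has height 3v/4, and 3/4 * 17/20 still exceeds 3/5,
    the height required by the reduction.\<close>
  have s3: "sqrt 3 \<ge> 17/10" by (rule real_le_rsqrt) (simp add: power2_eq_square)
  have v: "v \<ge> 17/20" using v1 s3 by (simp add: v_def)
  define h where "h = int (width A)"
  have h: "h \<ge> 1" using width(1)[OF A] by (simp add: h_def)
  have vh: "v \<le> of_int h" using v2 by (simp add: v_def h_def)
  define u where "u = (\<lambda>w. ennreal (indicator \<H> w *\<^sub>R invnorm \<kappa> (slash \<kappa> f A) w))"
  have um [measurable]: "u \<in> borel_measurable borel"
    using thick_mean_value(2)[OF f A, of z] v unfolding u_def \<kappa>_def v_def by simp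
  define I where "I = {n::int. \<bar>of_int n - Re z\<bar> \<le> v / 4 + 1 / 2}"
  have "I \<subseteq> {\<lfloor>Re z - (v/4 + 1/2)\<rfloor>..\<lceil>Re z + (v/4 + 1/2)\<rceil>}"
    unfolding I_def by (auto simp: abs_le_iff) linarith+
  hence finI: "finite I" by (rule finite_subset) simp
  define k where "k = (\<lambda>n B w. indicator \<F> w * u (moebius_action (Tm n ** B) w))"
  have km [measurable]: "k n B \<in> borel_measurable borel" for n B unfolding k_def by measurable
  have cover: "indicator (csquare z (v/4)) w * u w
      \<le> (\<Sum>B\<in>reduction_mats. \<Sum>n\<in>I. k n B (moebius_action (adj2 (Tm n ** B)) w))" if w: "Im w > 0" for w
  proof (cases "w \<in> csquare z (v/4)")
    case True
    hence "\<bar>Im w - v\<bar> \<le> v / 4" and re: "\<bar>Re w - Re z\<bar> \<le> v / 4" by (auto simp: csquare_def v_def)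
    hence "Im w \<ge> 3 / 5" using v by linarith
    then obtain n :: int and B where nB: "\<bar>Re w - of_int n\<bar> \<le> 1 / 2" "B \<in> reduction_mats"
        "moebius_action (adj2 (Tm n ** B)) w \<in> \<F>"
      using reduction_near_fundamental_domain unfolding reduction_mats_def by metis
    have n: "n \<in> I" using nB(1) re unfolding I_def mem_Collect_eq by linarith
    have TB: "Tm n ** B \<in> SL2Z" using reduction_mats(3)[OF nB(2)] by (simp add: SL2Z_mult)
    have "u w = k n B (moebius_action (adj2 (Tm n ** B)) w)"
      using nB(3) w by (simp add: k_def moebius_adj2[OF TB])
    also have "\<dots> \<le> (\<Sum>n\<in>I. k n B (moebius_action (adj2 (Tm n ** B)) w))"
      by (rule member_le_sum[OF n _ finI]) simp
    also have "\<dots> \<le> (\<Sum>B\<in>reduction_mats. \<Sum>n\<in>I. k n B (moebius_action (adj2 (Tm n ** B)) w))"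
      by (rule member_le_sum[OF nB(2) _ reduction_mats(1), of "\<lambda>B. \<Sum>n\<in>I. k n B (moebius_action (adj2 (Tm n ** B)) w)"]) simp
    finally show ?thesis using True by simp
  qed simp
  have fibre: "(\<Sum>n\<in>I. hyp_integral (k n B)) \<le> 2 * energy \<kappa> f" if B: "B \<in> reduction_mats" for B
  proof -
    have BS: "B \<in> SL2Z" using reduction_mats(3)[OF B] .
    have "hyp_integral (k n B) = cell_energy \<kappa> f (rep (coset (A ** (Tm n ** B))))" for n
    proof -
      have AS: "A ** (Tm n ** B) \<in> SL2Z" using A BS by (simp add: SL2Z_mult)
      have "hyp_integral (k n B) = cell_energy \<kappa> f (A ** (Tm n ** B))"
        unfolding k_def u_def using A BS by (subst cell_energy_eq_hyp_integral) (auto intro: SL2Z_mult)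
      also have "\<dots> = cell_energy \<kappa> f (rep (coset (A ** (Tm n ** B))))"
        using cell_energy_coset[OF f AS rep_coset[OF AS]] by (simp add: \<kappa>_def)
      finally show ?thesis .
    qed
    hence "(\<Sum>n\<in>I. hyp_integral (k n B)) = (\<Sum>n\<in>I. cell_energy \<kappa> f (rep (coset (A ** (Tm n ** B)))))" by simp
    also have "\<dots> \<le> of_nat 2 * (\<Sum>C\<in>pm_cosets \<Gamma>. cell_energy \<kappa> f (rep C))"
    proof (rule sum_fibres_le[OF finI finite_cosets, where e = "\<lambda>C. cell_energy \<kappa> f (rep C)"])
      show "(\<lambda>n. coset (A ** (Tm n ** B))) ` I \<subseteq> pm_cosets \<Gamma>"
        unfolding pm_cosets_eq using A BS by (auto intro!: imageI SL2Z_mult)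
      fix C
      show "card {n \<in> I. coset (A ** (Tm n ** B)) = C} \<le> 2"
      proof (rule card_le_2_if_spread[of _ h])
        fix a b assume ab: "a \<in> {n \<in> I. coset (A ** (Tm n ** B)) = C}" "b \<in> {n \<in> I. coset (A ** (Tm n ** B)) = C}"
        \<comment> \<open>Right multiplication respects equality of cosets, so B and T^b can be
          removed and the definition of the width applies to a - b.\<close>
        hence "coset ((A ** (Tm a ** B)) ** adj2 B ** Tm (- b)) = coset ((A ** (Tm b ** B)) ** adj2 B ** Tm (- b))"
          by (intro coset_mult_right_eq) auto
        moreover have "(A ** (Tm n ** B)) ** adj2 B ** Tm (- b) = A ** Tm (n - b)" for n
          using BS by (simp add: Tm_add flip: matrix_mul_assoc)
        ultimately have "coset (A ** Tm (a - b)) = coset A" by simp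
        thus "h dvd a - b" unfolding h_def using A by (intro width_dvd) (simp_all add: coset_self flip: coset_eq_iff)
        have "real_of_int (a - b) \<le> v / 2 + 1" using ab by (auto simp: I_def abs_le_iff)
        also have "\<dots> < 2 * of_int h" using vh h by linarith
        finally show "a - b < 2 * h" by linarith
      qed (use finI in simp)
    qed simp
    finally show ?thesis by (simp add: energy_def)
  qed
  have "hyp_integral (\<lambda>w. indicator (csquare z (v/4)) w * u w)
      \<le> hyp_integral (\<lambda>w. \<Sum>B\<in>reduction_mats. \<Sum>n\<in>I. k n B (moebius_action (adj2 (Tm n ** B)) w))"
    by (intro hyp_integral_mono cover)
  also have "\<dots> = (\<Sum>B\<in>reduction_mats. \<Sum>n\<in>I. hyp_integral (\<lambda>w. k n B (moebius_action (adj2 (Tm n ** B)) w)))"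
    by (subst hyp_integral_sum[OF reduction_mats(1)], measurable, intro sum.cong refl hyp_integral_sum[OF finI], measurable)
  also have "\<dots> = (\<Sum>B\<in>reduction_mats. \<Sum>n\<in>I. hyp_integral (k n B))"
    by (intro sum.cong refl hyp_integral_reduction_mats km)
  also have "\<dots> \<le> (\<Sum>B\<in>reduction_mats. 2 * energy \<kappa> f)"
    by (intro sum_mono fibre)
  also have "\<dots> = of_nat (card reduction_mats) * (2 * energy \<kappa> f)" by simp
  also have "\<dots> \<le> of_nat 4 * (2 * energy \<kappa> f)"
    using reduction_mats(2) by (intro mult_right_mono) (auto simp del: of_nat_numeral)
  also have "\<dots> = ennreal 8 * energy \<kappa> f"
  proof -
    have "(4::ennreal) * 2 = ennreal 8" by (simp flip: ennreal_numeral ennreal_mult)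
    thus ?thesis by (simp add: mult.assoc[symmetric])
  qed
  finally have *: "hyp_integral (\<lambda>w. indicator (csquare z (v/4)) w * u w) \<le> ennreal 8 * energy \<kappa> f" .
  have "ennreal (invnorm \<kappa> f (moebius_action A z)) \<le> ennreal (400 * (4/3) ^ m) * (ennreal 8 * energy \<kappa> f)"
    using thick_mean_value(1)[OF f A, of z] v
    by (intro order_trans[OF _ mult_left_mono[OF *]]) (auto simp: u_def \<kappa>_def v_def)
  also have "\<dots> = ennreal (3200 * (4/3) ^ m) * energy \<kappa> f"
  proof -
    have "ennreal (400 * (4/3) ^ m) * ennreal 8 = ennreal (3200 * (4/3) ^ m)"
      by (subst ennreal_mult[symmetric]) auto
    thus ?thesis by (simp only: mult.assoc[symmetric])
  qed
  finally show ?thesis by (simp add: \<kappa>_def)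
qed

text \<open>Up to the width \<open>thick_bound\<close> applies directly. Above it the decay starts
  from the line at the height of the width, and that line is itself covered by
  \<open>thick_bound\<close>, because the width is at least 1 and so exceeds sqrt 3 / 2.\<close>

theorem invnorm_le_energy:
  assumes f: "weak_form m f" and z: "Im z > 0"
  shows "ennreal (invnorm (real m / 2) f z) \<le> ennreal (sup_const m) * energy (real m / 2) f"
proof -
  define \<kappa> where "\<kappa> = real m / 2"
  define c where "c = (3200 * (4/3::real) ^ m) * enn2real (energy \<kappa> f)"
  have c0: "c \<ge> 0" by (simp add: c_def)
  have "ennreal (enn2real (energy \<kappa> f)) = energy \<kappa> f"
    using energy_finite[OF f] by (simp add: \<kappa>_def less_top)
  hence c: "ennreal (t * c) = ennreal (t * (3200 * (4/3) ^ m)) * energy \<kappa> f" if "t \<ge> 0" for t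
    using that by (simp add: c_def ennreal_mult mult.assoc[symmetric])
  obtain A w where A: "A \<in> SL2Z" and w: "w \<in> \<F>" "z = moebius_action A w"
    using fundamental_domain_cover[OF z] by blast
  have w3: "Im w \<ge> sqrt 3 / 2" using fundamental_domain_Im w by blast
  have thick: "invnorm \<kappa> f (moebius_action A w) \<le> c" if "Im w \<ge> sqrt 3 / 2" "Im w \<le> real (width A)" for w
    using thick_bound[OF f A that] c[of 1] c0 by (simp add: \<kappa>_def flip: ennreal_le_iff)
  have h: "sqrt 3 / 2 \<le> real (width A)"
  proof -
    have "sqrt 3 \<le> 2" by (rule real_le_lsqrt) auto
    thus ?thesis using width(1)[OF A] by linarith
  qed
  have "invnorm \<kappa> f z \<le> decay_const m * c"
  proof (cases "Im w \<le> real (width A)")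
    case True
    have "1 * c \<le> decay_const m * c" using decay_const_ge_1 c0 by (intro mult_right_mono) auto
    thus ?thesis using thick[OF w3 True] w by simp
  next
    case False
    have "invnorm (real m / 2) f (moebius_action A w) \<le> decay_const m * c"
      by (rule invnorm_cusp_decay[OF f A]) (use False thick h in \<open>simp_all add: \<kappa>_def\<close>)
    thus ?thesis using w by (simp add: \<kappa>_def)
  qed
  hence "ennreal (invnorm \<kappa> f z) \<le> ennreal (decay_const m * c)" by (rule ennreal_leI)
  also have "\<dots> = ennreal (sup_const m) * energy \<kappa> f"
    using c[of "decay_const m"] decay_const_pos[of m] by (simp add: sup_const_def)
  finally show ?thesis by (simp add: \<kappa>_def)
qed

end

section \<open>Orthonormal bases\<close>

lemma mult_cnj_eq_cmod: "z * cnj z = of_real ((cmod z)\<^sup>2)"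
  by (rule complex_norm_square[symmetric])

lemma cusp_forms_sum:
  assumes "finite T" "T \<subseteq> cusp_forms \<kappa> \<Gamma> J"
  shows "(\<lambda>z. \<Sum>b\<in>T. c b * b z) \<in> cusp_forms \<kappa> \<Gamma> J"
proof -
  have T: "b \<in> cusp_forms \<kappa> \<Gamma> J" if "b \<in> T" for b using that assms by auto
  have "((\<lambda>z. denom A z powr (- of_real \<kappa>) * (\<Sum>b\<in>T. c b * b (moebius_action A z))) \<longlongrightarrow> 0) (filtercomap Im at_top)"
    if A: "A \<in> SL2Z" for A
  proof -
    have "((\<lambda>z. \<Sum>b\<in>T. c b * (denom A z powr (- of_real \<kappa>) * b (moebius_action A z))) \<longlongrightarrow> (\<Sum>b\<in>T. c b * 0))
        (filtercomap Im at_top)"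
      using T A by (intro tendsto_sum tendsto_mult tendsto_const) (auto simp: cusp_forms_def)
    thus ?thesis by (simp add: sum_distrib_left mult_ac)
  qed
  moreover have "(\<lambda>z. \<Sum>b\<in>T. c b * b z) holomorphic_on \<H>"
    using T by (intro holomorphic_intros) (auto simp: cusp_forms_def)
  moreover have "(\<Sum>b\<in>T. c b * b (moebius_action A z)) = J A z * (\<Sum>b\<in>T. c b * b z)"
    if "A \<in> \<Gamma>" "z \<in> \<H>" for A z
    using T that by (auto simp: cusp_forms_def sum_distrib_left mult_ac intro!: sum.cong)
  moreover have "(\<Sum>b\<in>T. c b * b z) = 0" if "z \<notin> \<H>" for z
    using T that by (auto simp: cusp_forms_def intro!: sum.neutral)
  ultimately show ?thesis unfolding cusp_forms_def mem_Collect_eq by blast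
qed

section \<open>The Petersson product as a sesquilinear form\<close>

context congruence_group
begin

definition cell_integrand :: "real \<Rightarrow> (complex \<Rightarrow> complex) \<Rightarrow> (complex \<Rightarrow> complex) \<Rightarrow> int^2^2 \<Rightarrow> complex \<Rightarrow> complex" where
  "cell_integrand \<kappa> f g A z =
     f (moebius_action A z) * cnj (g (moebius_action A z)) * of_real (Im (moebius_action A z) powr \<kappa> / (Im z)\<^sup>2)"

lemma petersson_eq: "petersson \<kappa> \<Gamma> f g = (\<Sum>C\<in>pm_cosets \<Gamma>. LINT z : \<F> | lborel. cell_integrand \<kappa> f g (rep C) z)"
  by (simp add: petersson_def cell_integrand_def rep_def Let_def)

lemma cell_integrand_self:
  "cell_integrand \<kappa> f f A z = of_real (invnorm \<kappa> f (moebius_action A z) / (Im z)\<^sup>2)"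
  by (simp add: cell_integrand_def invnorm_def mult_cnj_eq_cmod)

lemma measurable_cell_integrand:
  assumes f: "weak_form m f" and g: "weak_form m g" and A: "A \<in> SL2Z"
  shows "(\<lambda>z. indicator \<F> z *\<^sub>R cell_integrand \<kappa> f g A z) \<in> borel_measurable borel"
proof (rule borel_measurable_continuous_on_indicator[OF sets_F])
  have FH: "\<F> \<subseteq> \<H>" using F_subset_H by auto
  have comp: "continuous_on \<F> (\<lambda>z. f (moebius_action A z))" if "weak_form m f" for f
  proof -
    have "moebius_action A ` \<F> \<subseteq> \<H>" using A F_subset_H by auto
    moreover have "moebius_action A holomorphic_on \<F>" "f holomorphic_on \<H>"
      using holomorphic_on_subset[OF holomorphic_moebius[OF A] FH] that by (auto simp: weak_form_def)
    ultimately have "(f \<circ> moebius_action A) holomorphic_on \<F>" using holomorphic_on_compose_gen by blast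
    thus ?thesis using holomorphic_on_imp_continuous_on by (simp add: o_def)
  qed
  have "continuous_on \<F> (moebius_action A)"
    using holomorphic_on_subset[OF holomorphic_moebius[OF A] FH] holomorphic_on_imp_continuous_on by blast
  moreover have "Im (moebius_action A z) \<noteq> 0" "Im z \<noteq> 0" if "z \<in> \<F>" for z
    using Im_moebius_pos[OF A F_subset_H[OF that]] F_subset_H[OF that] by auto
  ultimately show "continuous_on \<F> (cell_integrand \<kappa> f g A)"
    unfolding cell_integrand_def[abs_def]
    by (intro continuous_intros comp[OF f] comp[OF g]) auto
qed

text \<open>By \<open>|f| |g| \<le> |f|^2 + |g|^2\<close> the integrand is dominated by the two cell
  energies. Integrability matters because a Bochner integral that does not exist is 0 and need not
  be additive.\<close>

lemma integrable_cell_integrand: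
  assumes f: "weak_form m f" and g: "weak_form m g" and A: "A \<in> SL2Z"
  shows "set_integrable lborel \<F> (cell_integrand (real m / 2) f g A)"
  unfolding set_integrable_def
proof (rule integrableI_bounded)
  define \<kappa> where "\<kappa> = real m / 2"
  show "(\<lambda>z. indicat_real \<F> z *\<^sub>R cell_integrand (real m / 2) f g A z) \<in> borel_measurable lborel"
    using measurable_cell_integrand[OF assms] by simp
  have inv: "(\<lambda>z. indicator \<F> z * ennreal (invnorm \<kappa> f (moebius_action A z) / (Im z)\<^sup>2)) \<in> borel_measurable lborel"
    if "weak_form m f" for f
  proof -
    have "(\<lambda>z. ennreal (cmod (indicator \<F> z *\<^sub>R cell_integrand \<kappa> f f A z))) \<in> borel_measurable borel"
      using measurable_cell_integrand[OF that that A] by measurable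
    also have "(\<lambda>z. ennreal (cmod (indicator \<F> z *\<^sub>R cell_integrand \<kappa> f f A z)))
        = (\<lambda>z. indicator \<F> z * ennreal (invnorm \<kappa> f (moebius_action A z) / (Im z)\<^sup>2))"
      by (auto simp: fun_eq_iff cell_integrand_self norm_mult norm_divide norm_power split: split_indicator)
    finally show ?thesis by simp
  qed
  have "(\<integral>\<^sup>+z. ennreal (norm (indicat_real \<F> z *\<^sub>R cell_integrand \<kappa> f g A z)) \<partial>lborel)
      \<le> (\<integral>\<^sup>+z. indicator \<F> z * ennreal (invnorm \<kappa> f (moebius_action A z) / (Im z)\<^sup>2)
              + indicator \<F> z * ennreal (invnorm \<kappa> g (moebius_action A z) / (Im z)\<^sup>2) \<partial>lborel)"
  proof (intro nn_integral_mono)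
    fix z :: complex
    define a where "a = cmod (f (moebius_action A z))"
    define b where "b = cmod (g (moebius_action A z))"
    define t where "t = Im (moebius_action A z) powr \<kappa> / (Im z)\<^sup>2"
    have t: "t \<ge> 0" by (simp add: t_def)
    have "0 \<le> (a - b)\<^sup>2" "0 \<le> a * b" by (simp_all add: a_def b_def)
    hence "a * b \<le> a\<^sup>2 + b\<^sup>2" unfolding power2_diff by linarith
    hence ab: "a * b * t \<le> (a\<^sup>2 + b\<^sup>2) * t" using t by (rule mult_right_mono)
    have "norm (cell_integrand \<kappa> f g A z) = a * b * t"
      by (simp add: cell_integrand_def a_def b_def t_def norm_mult norm_divide norm_power)
    also note ab
    also have "(a\<^sup>2 + b\<^sup>2) * t = invnorm \<kappa> f (moebius_action A z) / (Im z)\<^sup>2 + invnorm \<kappa> g (moebius_action A z) / (Im z)\<^sup>2"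
      by (simp add: a_def b_def t_def invnorm_def algebra_simps add_divide_distrib)
    finally have "ennreal (norm (cell_integrand \<kappa> f g A z))
       \<le> ennreal (invnorm \<kappa> f (moebius_action A z) / (Im z)\<^sup>2 + invnorm \<kappa> g (moebius_action A z) / (Im z)\<^sup>2)"
      by (rule ennreal_leI)
    also have "\<dots> = ennreal (invnorm \<kappa> f (moebius_action A z) / (Im z)\<^sup>2) + ennreal (invnorm \<kappa> g (moebius_action A z) / (Im z)\<^sup>2)"
      by (rule ennreal_plus) auto
    finally have "ennreal (norm (cell_integrand \<kappa> f g A z))
       \<le> ennreal (invnorm \<kappa> f (moebius_action A z) / (Im z)\<^sup>2) + ennreal (invnorm \<kappa> g (moebius_action A z) / (Im z)\<^sup>2)" .
    thus "ennreal (norm (indicat_real \<F> z *\<^sub>R cell_integrand \<kappa> f g A z))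
       \<le> indicator \<F> z * ennreal (invnorm \<kappa> f (moebius_action A z) / (Im z)\<^sup>2)
              + indicator \<F> z * ennreal (invnorm \<kappa> g (moebius_action A z) / (Im z)\<^sup>2)"
      by (auto split: split_indicator)
  qed
  also have "\<dots> = cell_energy \<kappa> f A + cell_energy \<kappa> g A"
    unfolding cell_energy_def using inv f g by (intro nn_integral_add) auto
  also have "\<dots> < \<infinity>"
    using cell_energy_finite[OF f A] cell_energy_finite[OF g A] by (simp add: \<kappa>_def)
  finally show "(\<integral>\<^sup>+z. ennreal (norm (indicat_real \<F> z *\<^sub>R cell_integrand (real m / 2) f g A z)) \<partial>lborel) < \<infinity>"
    by (simp add: \<kappa>_def)
qed

lemma petersson_self:
  assumes f: "weak_form m f"
  shows "petersson (real m / 2) \<Gamma> f f = of_real (enn2real (energy (real m / 2) f))"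
proof -
  define \<kappa> where "\<kappa> = real m / 2"
  have cell: "(LINT z : \<F> | lborel. cell_integrand \<kappa> f f A z) = of_real (enn2real (cell_energy \<kappa> f A))"
    if A: "A \<in> SL2Z" for A
  proof -
    have "(LINT z : \<F> | lborel. cell_integrand \<kappa> f f A z)
        = of_real (LINT z | lborel. indicator \<F> z * (invnorm \<kappa> f (moebius_action A z) / (Im z)\<^sup>2))"
      unfolding set_lebesgue_integral_def cell_integrand_self integral_complex_of_real[symmetric]
      by (intro Bochner_Integration.integral_cong refl) (auto split: split_indicator)
    also have "(LINT z | lborel. indicator \<F> z * (invnorm \<kappa> f (moebius_action A z) / (Im z)\<^sup>2))
        = enn2real (\<integral>\<^sup>+z. ennreal (indicator \<F> z * (invnorm \<kappa> f (moebius_action A z) / (Im z)\<^sup>2)) \<partial>lborel)"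
    proof (rule integral_eq_nn_integral)
      have "(\<lambda>z. Re (indicator \<F> z *\<^sub>R cell_integrand \<kappa> f f A z)) \<in> borel_measurable borel"
        using measurable_cell_integrand[OF f f A] by measurable
      also have "(\<lambda>z. Re (indicator \<F> z *\<^sub>R cell_integrand \<kappa> f f A z))
         = (\<lambda>z. indicator \<F> z * (invnorm \<kappa> f (moebius_action A z) / (Im z)\<^sup>2))"
        by (simp add: cell_integrand_self fun_eq_iff del: of_real_divide of_real_power)
      finally show "(\<lambda>z. indicator \<F> z * (invnorm \<kappa> f (moebius_action A z) / (Im z)\<^sup>2)) \<in> borel_measurable lborel" by simp
    qed (auto split: split_indicator)
    also have "(\<integral>\<^sup>+z. ennreal (indicator \<F> z * (invnorm \<kappa> f (moebius_action A z) / (Im z)\<^sup>2)) \<partial>lborel) = cell_energy \<kappa> f A"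
      unfolding cell_energy_def by (intro nn_integral_cong) (auto split: split_indicator)
    finally show ?thesis .
  qed
  have "petersson \<kappa> \<Gamma> f f = of_real (\<Sum>C\<in>pm_cosets \<Gamma>. enn2real (cell_energy \<kappa> f (rep C)))"
    unfolding petersson_eq of_real_sum by (intro sum.cong refl cell rep_in_SL2Z)
  also have "(\<Sum>C\<in>pm_cosets \<Gamma>. enn2real (cell_energy \<kappa> f (rep C))) = enn2real (energy \<kappa> f)"
    unfolding energy_def \<kappa>_def
    by (subst enn2real_sum) (use cell_energy_finite[OF f] rep_in_SL2Z in auto)
  finally show ?thesis by (simp add: \<kappa>_def)
qed

lemma petersson_sum:
  assumes T: "finite T" "\<And>b. b \<in> T \<Longrightarrow> weak_form m b"
  shows "petersson (real m / 2) \<Gamma> (\<lambda>z. \<Sum>b\<in>T. c b * b z) (\<lambda>z. \<Sum>b\<in>T. c b * b z)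
     = (\<Sum>b\<in>T. \<Sum>b'\<in>T. c b * cnj (c b') * petersson (real m / 2) \<Gamma> b b')"
proof -
  define \<kappa> where "\<kappa> = real m / 2"
  define F where "F = (\<lambda>z. \<Sum>b\<in>T. c b * b z)"
  have cell: "(LINT z : \<F> | lborel. cell_integrand \<kappa> F F A z)
      = (\<Sum>b\<in>T. \<Sum>b'\<in>T. c b * cnj (c b') * (LINT z : \<F> | lborel. cell_integrand \<kappa> b b' A z))" if A: "A \<in> SL2Z" for A
  proof -
    have int: "integrable lborel (\<lambda>z. indicator \<F> z *\<^sub>R cell_integrand \<kappa> b b' A z)" if "b \<in> T" "b' \<in> T" for b b'
      using integrable_cell_integrand[OF T(2) T(2) A] that unfolding set_integrable_def \<kappa>_def by blast
    have "(LINT z : \<F> | lborel. cell_integrand \<kappa> F F A z)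
       = (LINT z | lborel. (\<Sum>b\<in>T. \<Sum>b'\<in>T. c b * cnj (c b') * (indicator \<F> z *\<^sub>R cell_integrand \<kappa> b b' A z)))"
      unfolding set_lebesgue_integral_def
    proof (intro Bochner_Integration.integral_cong refl)
      fix z :: complex
      have "cell_integrand \<kappa> F F A z = (\<Sum>b\<in>T. \<Sum>b'\<in>T. c b * cnj (c b') * cell_integrand \<kappa> b b' A z)"
        unfolding cell_integrand_def F_def cnj_sum sum_product sum_distrib_right
        by (intro sum.cong refl) (simp add: sum_distrib_left sum_divide_distrib mult_ac)
      thus "indicator \<F> z *\<^sub>R cell_integrand \<kappa> F F A z
         = (\<Sum>b\<in>T. \<Sum>b'\<in>T. c b * cnj (c b') * (indicator \<F> z *\<^sub>R cell_integrand \<kappa> b b' A z))"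
        by (auto split: split_indicator)
    qed
    also have "\<dots> = (\<Sum>b\<in>T. \<Sum>b'\<in>T. c b * cnj (c b') * (LINT z : \<F> | lborel. cell_integrand \<kappa> b b' A z))"
    proof -
      define K where "K = (\<lambda>b b' z. indicat_real \<F> z *\<^sub>R cell_integrand \<kappa> b b' A z)"
      have K: "integrable lborel (\<lambda>z. c b * cnj (c b') * K b b' z)" if "b \<in> T" "b' \<in> T" for b b'
        using int[OF that] unfolding K_def by (intro integrable_mult_right) auto
      have "(LINT z | lborel. (\<Sum>b\<in>T. \<Sum>b'\<in>T. c b * cnj (c b') * K b b' z))
          = (\<Sum>b\<in>T. LINT z | lborel. (\<Sum>b'\<in>T. c b * cnj (c b') * K b b' z))"
        by (rule Bochner_Integration.integral_sum) (auto intro!: Bochner_Integration.integrable_sum K)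
      also have "\<dots> = (\<Sum>b\<in>T. \<Sum>b'\<in>T. LINT z | lborel. c b * cnj (c b') * K b b' z)"
        by (intro sum.cong refl Bochner_Integration.integral_sum K)
      also have "\<dots> = (\<Sum>b\<in>T. \<Sum>b'\<in>T. c b * cnj (c b') * (LINT z | lborel. K b b' z))"
        by (simp only: integral_mult_right_zero)
      finally show ?thesis unfolding K_def set_lebesgue_integral_def .
    qed
    finally show ?thesis .
  qed
  have "petersson \<kappa> \<Gamma> F F = (\<Sum>C\<in>pm_cosets \<Gamma>. \<Sum>b\<in>T. \<Sum>b'\<in>T. c b * cnj (c b') * (LINT z : \<F> | lborel. cell_integrand \<kappa> b b' (rep C) z))"
    unfolding petersson_eq by (intro sum.cong refl cell rep_in_SL2Z)
  also have "\<dots> = (\<Sum>b\<in>T. \<Sum>C\<in>pm_cosets \<Gamma>. \<Sum>b'\<in>T. c b * cnj (c b') * (LINT z : \<F> | lborel. cell_integrand \<kappa> b b' (rep C) z))"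
    by (rule sum.swap)
  also have "\<dots> = (\<Sum>b\<in>T. \<Sum>b'\<in>T. \<Sum>C\<in>pm_cosets \<Gamma>. c b * cnj (c b') * (LINT z : \<F> | lborel. cell_integrand \<kappa> b b' (rep C) z))"
    by (intro sum.cong refl sum.swap)
  also have "\<dots> = (\<Sum>b\<in>T. \<Sum>b'\<in>T. c b * cnj (c b') * petersson \<kappa> \<Gamma> b b')"
    by (simp add: petersson_eq sum_distrib_left)
  finally show ?thesis by (simp add: \<kappa>_def F_def)
qed

text \<open>Parseval's identity for finite parts of the basis. These suffice, as forms are finite
  combinations of basis elements and the sum over the basis is a supremum of finite sums.\<close>

lemma energy_orthonormal_sum:
  assumes B: "orthonormal_basis (real m / 2) \<Gamma> V B" and V: "V = cusp_forms (real m / 2) \<Gamma> J"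
    and weak: "\<And>f. f \<in> V \<Longrightarrow> weak_form m f" and T: "finite T" "T \<subseteq> B"
  shows "enn2real (energy (real m / 2) (\<lambda>z. \<Sum>b\<in>T. c b * b z)) = (\<Sum>b\<in>T. (cmod (c b))\<^sup>2)"
proof -
  have TV: "T \<subseteq> V" using B T by (auto simp: orthonormal_basis_def)
  have "complex_of_real (enn2real (energy (real m / 2) (\<lambda>z. \<Sum>b\<in>T. c b * b z)))
      = petersson (real m / 2) \<Gamma> (\<lambda>z. \<Sum>b\<in>T. c b * b z) (\<lambda>z. \<Sum>b\<in>T. c b * b z)"
    using cusp_forms_sum[OF T(1), of "real m / 2" \<Gamma> J c] TV V by (intro petersson_self[symmetric] weak) auto
  also have "\<dots> = (\<Sum>b\<in>T. \<Sum>b'\<in>T. c b * cnj (c b') * petersson (real m / 2) \<Gamma> b b')"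
    using TV weak by (intro petersson_sum T(1)) auto
  also have "\<dots> = (\<Sum>b\<in>T. \<Sum>b'\<in>T. if b = b' then c b * cnj (c b') else 0)"
    using B T(2) by (intro sum.cong refl) (auto simp: orthonormal_basis_def subset_iff)
  also have "\<dots> = (\<Sum>b\<in>T. c b * cnj (c b))"
    using T(1) by (simp add: sum.delta')
  also have "\<dots> = of_real (\<Sum>b\<in>T. (cmod (c b))\<^sup>2)"
    by (simp add: mult_cnj_eq_cmod)
  finally show ?thesis by (simp only: of_real_eq_iff)
qed

section \<open>Pointwise bounds and the supremum over a basis\<close>

text \<open>The test form is a truncated reproducing kernel, whose value at \<tau> and whose squared
  norm are the same number s. The pointwise bound becomes s^2 Im^\<kappa> \<le> C s, and s
  cancels.\<close>

theorem basis_sup_le: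
  assumes B: "orthonormal_basis (real m / 2) \<Gamma> V B" and V: "V = cusp_forms (real m / 2) \<Gamma> J"
    and weak: "\<And>f. f \<in> V \<Longrightarrow> weak_form m f"
  shows "basis_sup (real m / 2) B \<le> ennreal (sup_const m)"
  unfolding basis_sup_def
proof (intro SUP_least infsum_le_finite_sums)
  fix \<tau> T assume \<tau>: "\<tau> \<in> \<H>" and T: "finite T" "T \<subseteq> B"
  define F where "F = (\<lambda>z. \<Sum>b\<in>T. cnj (b \<tau>) * b z)"
  define s where "s = (\<Sum>b\<in>T. (cmod (b \<tau>))\<^sup>2)"
  have s0: "s \<ge> 0" by (simp add: s_def sum_nonneg)
  have FV: "F \<in> V" unfolding F_def V using T B V
    by (intro cusp_forms_sum) (auto simp: orthonormal_basis_def)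
  have "F \<tau> = of_real s"
    by (simp add: F_def s_def mult_cnj_eq_cmod mult.commute[of "cnj _"])
  hence inv: "invnorm (real m / 2) F \<tau> = s\<^sup>2 * Im \<tau> powr (real m / 2)" by (simp add: invnorm_def)
  have "ennreal (enn2real (energy (real m / 2) F)) = energy (real m / 2) F"
    using energy_finite[OF weak[OF FV]] by (simp add: less_top)
  moreover have "enn2real (energy (real m / 2) F) = s"
    using energy_orthonormal_sum[OF B V weak T, of "\<lambda>b. cnj (b \<tau>)"] by (simp add: F_def s_def)
  ultimately have "ennreal (s\<^sup>2 * Im \<tau> powr (real m / 2)) \<le> ennreal (sup_const m) * ennreal s"
    using invnorm_le_energy[OF weak[OF FV], of \<tau>] \<tau> inv by simp
  also have "\<dots> = ennreal (sup_const m * s)" using sup_const_pos[of m] s0 by (simp add: ennreal_mult)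
  finally have le: "s\<^sup>2 * Im \<tau> powr (real m / 2) \<le> sup_const m * s"
    using s0 sup_const_pos[of m] by (subst (asm) ennreal_le_iff) auto
  have "s * Im \<tau> powr (real m / 2) \<le> sup_const m"
  proof (cases "s = 0")
    case False
    hence "s > 0" using s0 by simp
    have "s * (s * Im \<tau> powr (real m / 2)) \<le> s * sup_const m"
      using le by (simp add: power2_eq_square mult_ac)
    thus ?thesis using \<open>s > 0\<close> by (simp only: mult_le_cancel_left_pos)
  qed (use sup_const_pos[of m] in simp)
  moreover have "(\<Sum>f\<in>T. ennreal (Im \<tau> powr (real m / 2) * (cmod (f \<tau>))\<^sup>2)) = ennreal (s * Im \<tau> powr (real m / 2))"
    by (subst sum_ennreal) (auto simp: s_def sum_distrib_left mult.commute)
  ultimately show "(\<Sum>f\<in>T. ennreal (Im \<tau> powr (real m / 2) * (cmod (f \<tau>))\<^sup>2)) \<le> ennreal (sup_const m)"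
    by (simp add: ennreal_leI)
qed (auto intro: nonneg_summable_on_complete)

text \<open>Cauchy-Schwarz for the coefficients of f in the basis. Through this inequality any
  single form yields a lower bound.\<close>

theorem invnorm_le_basis_sup:
  assumes B: "orthonormal_basis (real m / 2) \<Gamma> V B" and V: "V = cusp_forms (real m / 2) \<Gamma> J"
    and weak: "\<And>f. f \<in> V \<Longrightarrow> weak_form m f" and f: "f \<in> V" and \<tau>: "Im \<tau> > 0"
  shows "ennreal (invnorm (real m / 2) f \<tau>) \<le> ennreal (enn2real (energy (real m / 2) f)) * basis_sup (real m / 2) B"
proof -
  obtain T c where T: "finite T" "T \<subseteq> B" and fT: "f = (\<lambda>z. \<Sum>b\<in>T. c b * b z)"
    using B f by (auto simp: orthonormal_basis_def)
  define s where "s = (\<Sum>b\<in>T. (cmod (b \<tau>))\<^sup>2)"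
  define e where "e = (\<Sum>b\<in>T. (cmod (c b))\<^sup>2)"
  have e: "enn2real (energy (real m / 2) f) = e"
    unfolding e_def fT by (rule energy_orthonormal_sum[OF B V weak T])
  have s0: "s \<ge> 0" and e0: "e \<ge> 0" by (simp_all add: s_def e_def sum_nonneg)
  have "cmod (f \<tau>) \<le> (\<Sum>b\<in>T. cmod (c b) * cmod (b \<tau>))"
    unfolding fT by (rule order_trans[OF norm_sum]) (simp add: norm_mult)
  hence "(cmod (f \<tau>))\<^sup>2 \<le> (\<Sum>b\<in>T. cmod (c b) * cmod (b \<tau>))\<^sup>2" by (intro power_mono) auto
  also have "\<dots> \<le> e * s" unfolding e_def s_def by (rule Cauchy_Schwarz_ineq_sum)
  finally have "invnorm (real m / 2) f \<tau> \<le> e * (s * Im \<tau> powr (real m / 2))"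
    unfolding invnorm_def mult.assoc[symmetric] by (rule mult_right_mono) simp
  hence "ennreal (invnorm (real m / 2) f \<tau>) \<le> ennreal e * ennreal (s * Im \<tau> powr (real m / 2))"
    using e0 s0 by (simp add: ennreal_leI flip: ennreal_mult)
  also have "ennreal (s * Im \<tau> powr (real m / 2)) = (\<Sum>f\<in>T. ennreal (Im \<tau> powr (real m / 2) * (cmod (f \<tau>))\<^sup>2))"
    by (subst sum_ennreal) (auto simp: s_def sum_distrib_left mult.commute)
  also have "\<dots> \<le> (\<Sum>\<^sub>\<infinity>f\<in>B. ennreal (Im \<tau> powr (real m / 2) * (cmod (f \<tau>))\<^sup>2))"
    using T by (subst nonneg_infsum_complete) (auto intro!: SUP_upper)
  also have "\<dots> \<le> basis_sup (real m / 2) B"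
    unfolding basis_sup_def using \<tau> by (intro SUP_upper) auto
  finally show ?thesis by (simp add: e mult_left_mono)
qed

corollary basis_sup_ge:
  assumes B: "orthonormal_basis (real m / 2) \<Gamma> V B" and V: "V = cusp_forms (real m / 2) \<Gamma> J"
    and weak: "\<And>f. f \<in> V \<Longrightarrow> weak_form m f" and f: "f \<in> V" and \<tau>: "Im \<tau> > 0"
    and e: "e > 0" "energy (real m / 2) f \<le> ennreal e"
  shows "ennreal (invnorm (real m / 2) f \<tau> / e) \<le> basis_sup (real m / 2) B"
proof -
  have "enn2real (energy (real m / 2) f) \<le> e" using e by (simp add: enn2real_leI)
  hence "ennreal (invnorm (real m / 2) f \<tau>) \<le> ennreal e * basis_sup (real m / 2) B"
    using invnorm_le_basis_sup[OF B V weak f \<tau>]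
    by (meson ennreal_leI mult_right_mono order_trans zero_le)
  hence "ennreal (1 / e) * ennreal (invnorm (real m / 2) f \<tau>) \<le> ennreal (1 / e) * (ennreal e * basis_sup (real m / 2) B)"
    by (rule mult_left_mono) simp
  also have "\<dots> = basis_sup (real m / 2) B"
    using e by (simp add: mult.assoc[symmetric] flip: ennreal_mult)
  finally show ?thesis using e by (simp flip: ennreal_mult)
qed

text \<open>The constant comes from some form and some point where it does not vanish, so it may
  depend on the group. It takes care of small levels.\<close>

corollary basis_sup_ge_nontrivial:
  assumes V: "V = cusp_forms (real m / 2) \<Gamma> J" and weak: "\<And>f. f \<in> V \<Longrightarrow> weak_form m f" and ne: "V \<noteq> {\<lambda>z. 0}"
  shows "\<exists>c>0. \<forall>B. orthonormal_basis (real m / 2) \<Gamma> V B \<longrightarrow> ennreal c \<le> basis_sup (real m / 2) B"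
proof -
  have "(\<lambda>z. 0) \<in> V" using cusp_forms_sum[of "{}" "real m / 2" \<Gamma> J] by (simp add: V)
  then obtain f where f: "f \<in> V" "f \<noteq> (\<lambda>z. 0)" using ne by blast
  then obtain \<tau> where "f \<tau> \<noteq> 0" by auto
  hence \<tau>: "Im \<tau> > 0" using f V by (auto simp: cusp_forms_def)
  \<comment> \<open>The summand 1 provides a positive denominator without proving that a nonzero
    form has positive norm.\<close>
  define e where "e = enn2real (energy (real m / 2) f) + 1"
  have e: "e > 0" "energy (real m / 2) f \<le> ennreal e"
  proof -
    have fin: "ennreal (enn2real (energy (real m / 2) f)) = energy (real m / 2) f"
      using energy_finite[OF weak[OF f(1)]] by (simp add: less_top)
    have "ennreal (enn2real (energy (real m / 2) f)) \<le> ennreal e" unfolding e_def by (intro ennreal_leI) simp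
    thus "energy (real m / 2) f \<le> ennreal e" unfolding fin .
    have "enn2real (energy (real m / 2) f) \<ge> 0" by simp
    thus "e > 0" unfolding e_def by linarith
  qed
  have "invnorm (real m / 2) f \<tau> > 0" using \<tau> \<open>f \<tau> \<noteq> 0\<close> by (simp add: invnorm_def)
  thus ?thesis
    using basis_sup_ge[OF _ V weak f(1) \<tau> e] e by (intro exI[of _ "invnorm (real m / 2) f \<tau> / e"]) auto
qed

end

section \<open>Lattice sums\<close>

text \<open>The maximum gives n = 0 the weight 1. For a > 1 the value is 2 (1 + zeta(a)), which
  bounds the corresponding sum over all integers.\<close>

definition zeta_const :: "real \<Rightarrow> real" where
  "zeta_const a = 2 * (\<Sum>n. max 1 (real n) powr (- a))"

lemma summable_max_powr:
  assumes "a > 1" shows "summable (\<lambda>n. max 1 (real n) powr (- a))"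
proof (rule summable_comparison_test_ev)
  show "summable (\<lambda>n. real n powr (- a))" using assms by (simp add: summable_real_powr_iff)
  show "\<forall>\<^sub>F n in sequentially. norm (max 1 (real n) powr (- a)) \<le> real n powr (- a)"
    using eventually_ge_at_top[of 1] by eventually_elim (auto simp: max_def)
qed

lemma zeta_const_pos: "a > 1 \<Longrightarrow> zeta_const a > 0"
  unfolding zeta_const_def using suminf_pos[OF summable_max_powr[of a]] by simp

lemma sum_int_max_powr_le:
  assumes a: "a > 1" and D: "finite D"
  shows "(\<Sum>d\<in>D. max 1 \<bar>real_of_int d\<bar> powr (- a)) \<le> zeta_const a"
proof -
  define g where "g = (\<lambda>n. max 1 (real n) powr (- a))"
  have part: "(\<Sum>d\<in>E. max 1 \<bar>real_of_int d\<bar> powr (- a)) \<le> suminf g" if E: "E \<subseteq> D" and inj: "inj_on (\<lambda>d. nat \<bar>d\<bar>) E" for E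
  proof -
    have "(\<Sum>d\<in>E. max 1 \<bar>real_of_int d\<bar> powr (- a)) = (\<Sum>d\<in>E. g (nat \<bar>d\<bar>))" by (simp add: g_def)
    also have "\<dots> = (\<Sum>n\<in>(\<lambda>d. nat \<bar>d\<bar>) ` E. g n)" using sum.reindex[OF inj, of g] by simp
    also have "\<dots> \<le> suminf g"
      using summable_max_powr[OF a] E D by (intro sum_le_suminf) (auto simp: g_def intro: finite_subset)
    finally show ?thesis .
  qed
  have "(\<Sum>d\<in>D. max 1 \<bar>real_of_int d\<bar> powr (- a)) = (\<Sum>d\<in>{d\<in>D. d \<ge> 0}. max 1 \<bar>real_of_int d\<bar> powr (- a))
      + (\<Sum>d\<in>{d\<in>D. d < 0}. max 1 \<bar>real_of_int d\<bar> powr (- a))"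
    using D by (subst sum.union_disjoint[symmetric]) (auto intro!: sum.cong)
  also have "\<dots> \<le> suminf g + suminf g" by (intro add_mono part) (auto simp: inj_on_def)
  finally show ?thesis by (simp add: zeta_const_def g_def)
qed

text \<open>Replacing s by its floor changes |s + d| by at most 1, hence the maximum with 1 by at
  most a factor 2.\<close>

lemma sum_int_shift_max_powr_le:
  assumes a: "a > 1" and D: "finite D"
  shows "(\<Sum>d\<in>D. max 1 \<bar>s + real_of_int d\<bar> powr (- a)) \<le> 2 powr a * zeta_const a"
proof -
  have "max 1 \<bar>s + real_of_int d\<bar> powr (- a) \<le> 2 powr a * max 1 \<bar>real_of_int (d + \<lfloor>s\<rfloor>)\<bar> powr (- a)" for d
  proof -
    have "\<bar>real_of_int (d + \<lfloor>s\<rfloor>)\<bar> \<le> \<bar>s + real_of_int d\<bar> + 1" by linarith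
    hence "1 / 2 * max 1 \<bar>real_of_int (d + \<lfloor>s\<rfloor>)\<bar> \<le> max 1 \<bar>s + real_of_int d\<bar>"
      unfolding max_def by (simp del: of_int_add)
    hence "max 1 \<bar>s + real_of_int d\<bar> powr (- a) \<le> (1 / 2 * max 1 \<bar>real_of_int (d + \<lfloor>s\<rfloor>)\<bar>) powr (- a)"
      using a by (intro powr_mono2') auto
    also have "\<dots> = (1/2) powr (- a) * max 1 \<bar>real_of_int (d + \<lfloor>s\<rfloor>)\<bar> powr (- a)" by (rule powr_mult)
    also have "(1/2::real) powr (- a) = 2 powr a" by (simp add: powr_divide powr_minus_divide)
    finally show ?thesis .
  qed
  hence "(\<Sum>d\<in>D. max 1 \<bar>s + real_of_int d\<bar> powr (- a)) \<le> (\<Sum>d\<in>D. 2 powr a * max 1 \<bar>real_of_int (d + \<lfloor>s\<rfloor>)\<bar> powr (- a))"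
    by (intro sum_mono)
  also have "\<dots> = 2 powr a * (\<Sum>d\<in>(\<lambda>d. d + \<lfloor>s\<rfloor>) ` D. max 1 \<bar>real_of_int d\<bar> powr (- a))"
    by (subst sum.reindex) (auto simp: sum_distrib_left inj_on_def)
  also have "\<dots> \<le> 2 powr a * zeta_const a"
    using a D by (intro mult_left_mono sum_int_max_powr_le) auto
  finally show ?thesis .
qed

text \<open>One factor \<open>2 powr a\<close> stems from the bound of |c z + d| by half a maximum,
  the other from shifting the real part.\<close>

definition lattice_const :: "real \<Rightarrow> real" where
  "lattice_const a = (4 powr a) * (zeta_const a)\<^sup>2"

lemma lattice_const_pos: "a > 1 \<Longrightarrow> lattice_const a > 0"
  using zeta_const_pos[of a] by (simp add: lattice_const_def)

text \<open>|c z + d| is at least |c| v and at least half the maximum of 1 and |c x + d|. Giving the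
  exponent a to each bound separates the sums over c and d, and writing c as a multiple of N
  produces the decay in N that makes the terms with c = 0 dominate at high level.\<close>

lemma lattice_sum_le:
  fixes T :: "(int \<times> int) set"
  assumes a: "a > 1" and z: "Im z \<ge> 1 / 2" and N: "N > 0" and T: "finite T"
    and TN: "\<And>c d. (c, d) \<in> T \<Longrightarrow> c \<noteq> 0 \<and> int N dvd c"
  shows "(\<Sum>(c, d)\<in>T. cmod (of_int c * z + of_int d) powr (- (2 * a))) \<le> lattice_const a * (real N * Im z) powr (- a)"
proof -
  define x v where "x = Re z" and "v = Im z"
  have v: "v \<ge> 1/2" using z by (simp add: v_def)
  define C D where "C = fst ` T" and "D = snd ` T"
  have fin: "finite C" "finite D" using T by (auto simp: C_def D_def)
  have CN: "c \<noteq> 0 \<and> int N dvd c" if "c \<in> C" for c using that TN by (auto simp: C_def)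
  have summand: "cmod (of_int c * z + of_int d) powr (- (2 * a))
      \<le> \<bar>of_int c * v\<bar> powr (- a) * (2 powr a * max 1 \<bar>of_int c * x + of_int d\<bar> powr (- a))" if "c \<in> C" for c d
  proof -
    define n where "n = cmod (of_int c * z + of_int d)"
    have "1 \<le> \<bar>c\<bar>" using CN[OF that] by auto
    hence "real_of_int 1 \<le> real_of_int \<bar>c\<bar>" by (simp only: of_int_le_iff)
    hence c1: "\<bar>real_of_int c\<bar> \<ge> 1" by simp
    have n1: "\<bar>of_int c * v\<bar> \<le> n"
      using abs_Im_le_cmod[of "of_int c * z + of_int d"] by (simp add: n_def v_def)
    have n2: "\<bar>of_int c * x + of_int d\<bar> \<le> n"
      using abs_Re_le_cmod[of "of_int c * z + of_int d"] by (simp add: n_def x_def)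
    have cv: "\<bar>of_int c * v\<bar> \<ge> 1/2"
      using mult_mono[OF c1 v] v by (simp add: abs_mult)
    have n3: "1 / 2 * max 1 \<bar>of_int c * x + of_int d\<bar> \<le> n" using n1 n2 cv unfolding max_def by (auto split: if_splits)
    have n0: "n > 0" using n1 cv by linarith
    have "n powr (- (2 * a)) = n powr (- a) * n powr (- a)" by (simp flip: powr_add)
    also have "\<dots> \<le> \<bar>of_int c * v\<bar> powr (- a) * (1 / 2 * max 1 \<bar>of_int c * x + of_int d\<bar>) powr (- a)"
      using n1 n3 cv a by (intro mult_mono powr_mono2') auto
    also have "(1 / 2 * max 1 \<bar>of_int c * x + of_int d\<bar>) powr (- a) = 2 powr a * max 1 \<bar>of_int c * x + of_int d\<bar> powr (- a)"
      unfolding powr_mult by (simp add: powr_divide powr_minus_divide)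
    finally show ?thesis by (simp add: n_def)
  qed
  have "(\<Sum>(c, d)\<in>T. cmod (of_int c * z + of_int d) powr (- (2 * a)))
      \<le> (\<Sum>(c, d)\<in>C \<times> D. cmod (of_int c * z + of_int d) powr (- (2 * a)))"
    using fin by (intro sum_mono2) (force simp: C_def D_def)+
  also have "\<dots> = (\<Sum>c\<in>C. \<Sum>d\<in>D. cmod (of_int c * z + of_int d) powr (- (2 * a)))"
    by (simp add: sum.cartesian_product)
  also have "\<dots> \<le> (\<Sum>c\<in>C. \<Sum>d\<in>D. \<bar>of_int c * v\<bar> powr (- a) * (2 powr a * max 1 \<bar>of_int c * x + of_int d\<bar> powr (- a)))"
    by (intro sum_mono summand)
  also have "\<dots> = (\<Sum>c\<in>C. \<bar>of_int c * v\<bar> powr (- a) * (2 powr a * (\<Sum>d\<in>D. max 1 \<bar>of_int c * x + of_int d\<bar> powr (- a))))"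
    by (simp add: sum_distrib_left)
  also have "\<dots> \<le> (\<Sum>c\<in>C. \<bar>of_int c * v\<bar> powr (- a) * (2 powr a * (2 powr a * zeta_const a)))"
    using fin a by (intro sum_mono mult_left_mono sum_int_shift_max_powr_le) auto
  also have "\<dots> = 4 powr a * zeta_const a * (\<Sum>c\<in>C. \<bar>of_int c * v\<bar> powr (- a))"
  proof -
    have "(2::real) powr a * 2 powr a = 4 powr a" by (simp flip: powr_mult)
    hence "x * (2 powr a * (2 powr a * zeta_const a)) = 4 powr a * zeta_const a * x" for x
      by (metis mult.assoc mult.commute)
    thus ?thesis by (simp only: sum_distrib_left)
  qed
  also have "(\<Sum>c\<in>C. \<bar>of_int c * v\<bar> powr (- a)) \<le> (real N * v) powr (- a) * zeta_const a"
  proof -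
    have "\<bar>of_int c * v\<bar> powr (- a) = (real N * v) powr (- a) * max 1 \<bar>real_of_int (c div int N)\<bar> powr (- a)" if c: "c \<in> C" for c
    proof -
      obtain k where k: "c = int N * k" "k \<noteq> 0" using CN[OF c] by (auto elim: dvdE)
      hence "max 1 \<bar>real_of_int k\<bar> = \<bar>real_of_int k\<bar>" by simp
      moreover have "\<bar>of_int c * v\<bar> = (real N * v) * \<bar>real_of_int k\<bar>" using k v by (simp add: abs_mult)
      ultimately show ?thesis using k N by (simp add: powr_mult)
    qed
    hence "(\<Sum>c\<in>C. \<bar>of_int c * v\<bar> powr (- a)) = (real N * v) powr (- a) * (\<Sum>c\<in>C. max 1 \<bar>real_of_int (c div int N)\<bar> powr (- a))"
      by (simp add: sum_distrib_left)
    also have "(\<Sum>c\<in>C. max 1 \<bar>real_of_int (c div int N)\<bar> powr (- a)) = (\<Sum>k\<in>(\<lambda>c. c div int N) ` C. max 1 \<bar>real_of_int k\<bar> powr (- a))"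
    proof (subst sum.reindex)
      show "inj_on (\<lambda>c. c div int N) C"
        using CN by (auto simp: inj_on_def) (metis dvd_div_mult_self)
    qed simp
    also have "(real N * v) powr (- a) * \<dots> \<le> (real N * v) powr (- a) * zeta_const a"
      using fin a by (intro mult_left_mono sum_int_max_powr_le) auto
    finally show ?thesis .
  qed
  hence "4 powr a * zeta_const a * (\<Sum>c\<in>C. \<bar>of_int c * v\<bar> powr (- a))
     \<le> 4 powr a * zeta_const a * ((real N * v) powr (- a) * zeta_const a)"
    using zeta_const_pos[OF a] by (intro mult_left_mono) auto
  also have "\<dots> = lattice_const a * (real N * Im z) powr (- a)"
    by (simp add: lattice_const_def v_def power2_eq_square)
  finally show ?thesis .
qed

text \<open>On a compact set |c z + d| is at least \<epsilon> times the larger of |c| and |d|; the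
  exponent is again shared evenly between c and d. This provides the locally uniform
  convergence.\<close>

lemma lattice_majorant:
  assumes a: "a > 1" and K: "compact K" "K \<subseteq> \<H>"
  obtains M :: "int \<times> int \<Rightarrow> real" where "M summable_on UNIV"
    "\<And>z c d. z \<in> K \<Longrightarrow> (c, d) \<noteq> (0, 0) \<Longrightarrow> cmod (of_int c * z + of_int d) powr (- (2 * a)) \<le> M (c, d)"
proof -
  obtain \<delta> R where \<delta>: "\<delta> > 0" and R: "R > 0" and KR: "\<And>z. z \<in> K \<Longrightarrow> Im z \<ge> \<delta> \<and> cmod z \<le> R"
  proof (cases "K = {}")
    case True
    thus ?thesis using that[of 1 1] by auto
  next
    case False
    obtain z0 where z0: "z0 \<in> K" "\<And>z. z \<in> K \<Longrightarrow> Im z0 \<le> Im z"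
      using continuous_attains_inf[OF K(1) False continuous_on_Im[OF continuous_on_id]] by auto
    obtain B where "B > 0" "\<And>z. z \<in> K \<Longrightarrow> cmod z \<le> B"
      using compact_imp_bounded[OF K(1)] by (auto simp: bounded_pos)
    thus ?thesis using that[of "Im z0" B] z0 K(2) by auto
  qed
  \<comment> \<open>The first entry belongs to |c| \<delta> \<le> |c z + d|, the second to |d| \<le>
    |c z + d| + |c| R \<le> (1 + R/\<delta>) |c z + d|.\<close>
  define \<epsilon> where "\<epsilon> = min \<delta> (\<delta> / (\<delta> + R))"
  have \<epsilon>: "\<epsilon> > 0" using \<delta> R by (simp add: \<epsilon>_def)
  define M where "M = (\<lambda>(c::int, d::int). \<epsilon> powr (- (2 * a)) * (max 1 \<bar>real_of_int c\<bar> powr (- a) * max 1 \<bar>real_of_int d\<bar> powr (- a)))"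
  show ?thesis
  proof (rule that[of M])
    show "M summable_on UNIV"
    proof (rule nonneg_bdd_above_summable_on)
      have "sum M T \<le> \<epsilon> powr (- (2 * a)) * (zeta_const a * zeta_const a)" if T: "finite T" for T
      proof -
        define C D where "C = fst ` T" and "D = snd ` T"
        have fin: "finite C" "finite D" using T by (auto simp: C_def D_def)
        have "sum M T \<le> sum M (C \<times> D)"
          using fin by (intro sum_mono2) (force simp: C_def D_def M_def)+
        also have "\<dots> = \<epsilon> powr (- (2 * a)) * ((\<Sum>c\<in>C. max 1 \<bar>real_of_int c\<bar> powr (- a)) * (\<Sum>d\<in>D. max 1 \<bar>real_of_int d\<bar> powr (- a)))"
        proof -
          have "sum M (C \<times> D) = (\<Sum>c\<in>C. \<Sum>d\<in>D. \<epsilon> powr (- (2 * a)) * (max 1 \<bar>real_of_int c\<bar> powr (- a) * max 1 \<bar>real_of_int d\<bar> powr (- a)))"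
            by (simp add: M_def sum.cartesian_product)
          also have "\<dots> = \<epsilon> powr (- (2 * a)) * (\<Sum>c\<in>C. \<Sum>d\<in>D. max 1 \<bar>real_of_int c\<bar> powr (- a) * max 1 \<bar>real_of_int d\<bar> powr (- a))"
            by (simp only: sum_distrib_left)
          finally show ?thesis by (simp only: sum_product)
        qed
        also have "\<dots> \<le> \<epsilon> powr (- (2 * a)) * (zeta_const a * zeta_const a)"
          using fin zeta_const_pos[OF a] by (intro mult_left_mono mult_mono sum_int_max_powr_le a) (auto intro!: sum_nonneg)
        finally show ?thesis .
      qed
      thus "bdd_above (sum M ` {F. F \<subseteq> UNIV \<and> finite F})" by (intro bdd_aboveI) auto
    qed (auto simp: M_def)
    fix z c d assume z: "z \<in> K" and cd: "(c, d) \<noteq> (0::int, 0::int)"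
    define n where "n = cmod (of_int c * z + of_int d)"
    have zK: "Im z \<ge> \<delta>" "cmod z \<le> R" using KR[OF z] by auto
    have "\<bar>real_of_int c\<bar> * \<delta> \<le> \<bar>real_of_int c\<bar> * Im z" using zK by (intro mult_left_mono) auto
    also have "\<dots> = \<bar>Im (of_int c * z + of_int d)\<bar>" using zK \<delta> by (simp add: abs_mult)
    also have "\<dots> \<le> n" unfolding n_def by (rule abs_Im_le_cmod)
    finally have n1: "\<bar>real_of_int c\<bar> * \<delta> \<le> n" .
    have "\<bar>real_of_int d\<bar> = cmod ((of_int c * z + of_int d) - of_int c * z)" by simp
    also have "\<dots> \<le> n + \<bar>real_of_int c\<bar> * cmod z"
      unfolding n_def by (rule order_trans[OF norm_triangle_ineq4]) (simp add: norm_mult)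
    also have "\<dots> \<le> n + \<bar>real_of_int c\<bar> * R" using zK by (intro add_left_mono mult_left_mono) auto
    finally have "\<delta> * \<bar>real_of_int d\<bar> \<le> \<delta> * (n + \<bar>real_of_int c\<bar> * R)" using \<delta> by (intro mult_left_mono) auto
    also have "\<dots> = \<delta> * n + (\<bar>real_of_int c\<bar> * \<delta>) * R" by (simp add: algebra_simps)
    also have "\<dots> \<le> \<delta> * n + n * R" using n1 R by (intro add_left_mono mult_right_mono) auto
    finally have n2: "\<delta> / (\<delta> + R) * \<bar>real_of_int d\<bar> \<le> n" using \<delta> R by (simp add: field_simps)
    define p where "p = max 1 \<bar>real_of_int c\<bar>"
    define q where "q = max 1 \<bar>real_of_int d\<bar>"
    have "\<epsilon> * \<bar>real_of_int c\<bar> \<le> n" "\<epsilon> * \<bar>real_of_int d\<bar> \<le> n"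
      using n1 n2 mult_right_mono[of \<epsilon> \<delta> "\<bar>real_of_int c\<bar>"] mult_right_mono[of \<epsilon> "\<delta> / (\<delta> + R)" "\<bar>real_of_int d\<bar>"]
      by (auto simp: \<epsilon>_def mult.commute)
    \<comment> \<open>A nonzero integer pair has an entry of modulus at least 1, so the maxima with
      1 do not raise the larger one.\<close>
    moreover have "max p q = max \<bar>real_of_int c\<bar> \<bar>real_of_int d\<bar>"
      using cd by (auto simp: p_def q_def max_def)
    ultimately have n3: "\<epsilon> * p \<le> n" "\<epsilon> * q \<le> n"
      using \<epsilon> by (smt (verit) max.cobounded1 max.cobounded2 mult_left_mono)+
    have pq: "p \<ge> 1" "q \<ge> 1" by (auto simp: p_def q_def)
    have "n powr (- (2 * a)) = n powr (- a) * n powr (- a)" by (simp flip: powr_add)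
    also have "\<dots> \<le> (\<epsilon> * p) powr (- a) * (\<epsilon> * q) powr (- a)"
      using n3 pq \<epsilon> a by (intro mult_mono powr_mono2') auto
    also have "\<dots> = \<epsilon> powr (- (2 * a)) * (p powr (- a) * q powr (- a))"
      by (simp add: powr_mult mult_ac flip: powr_add)
    finally show "cmod (of_int c * z + of_int d) powr (- (2 * a)) \<le> M (c, d)"
      by (simp add: n_def M_def p_def q_def)
  qed
qed

section \<open>Poincare series\<close>

text \<open>Weierstrass' theorem along the filter of finite subsets; it serves the Poincare series,
  the theta constants and the periodised Gaussian.\<close>

lemma holomorphic_infsum:
  fixes f :: "'a \<Rightarrow> complex \<Rightarrow> complex"
  assumes S: "open S" and hol: "\<And>x. x \<in> X \<Longrightarrow> f x holomorphic_on S"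
    and maj: "\<And>K. compact K \<Longrightarrow> K \<subseteq> S \<Longrightarrow> \<exists>M. M summable_on X \<and> (\<forall>x\<in>X. \<forall>z\<in>K. cmod (f x z) \<le> M x)"
  shows "(\<lambda>z. \<Sum>\<^sub>\<infinity>x\<in>X. f x z) holomorphic_on S"
proof (rule holomorphic_onI)
  fix z assume "z \<in> S"
  then obtain r where r: "r > 0" "cball z r \<subseteq> S" using S open_contains_cball by blast
  obtain M where M: "M summable_on X" "\<And>x y. x \<in> X \<Longrightarrow> y \<in> cball z r \<Longrightarrow> norm (f x y) \<le> M x"
    using maj[OF compact_cball r(2)] by blast
  have ul: "uniform_limit (cball z r) (\<lambda>X y. \<Sum>x\<in>X. f x y) (\<lambda>y. \<Sum>\<^sub>\<infinity>x\<in>X. f x y) (finite_subsets_at_top X)"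
    by (rule Weierstrass_m_test_general[OF M(2) M(1)])
  have "\<forall>\<^sub>F Y in finite_subsets_at_top X. continuous_on (cball z r) (\<lambda>y. \<Sum>x\<in>Y. f x y) \<and> (\<lambda>y. \<Sum>x\<in>Y. f x y) holomorphic_on ball z r"
  proof (rule eventually_finite_subsets_at_top_weakI)
    fix Y assume Y: "finite Y" "Y \<subseteq> X"
    have h: "(\<lambda>y. \<Sum>x\<in>Y. f x y) holomorphic_on S" using Y by (intro holomorphic_on_sum hol) auto
    show "continuous_on (cball z r) (\<lambda>y. \<Sum>x\<in>Y. f x y) \<and> (\<lambda>y. \<Sum>x\<in>Y. f x y) holomorphic_on ball z r"
      using holomorphic_on_subset[OF h] r(2) ball_subset_cball[of z r]
      by (meson holomorphic_on_imp_continuous_on order_trans)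
  qed
  from holomorphic_uniform_limit[OF this ul] have "(\<lambda>y. \<Sum>\<^sub>\<infinity>x\<in>X. f x y) holomorphic_on ball z r" by auto
  thus "(\<lambda>y. \<Sum>\<^sub>\<infinity>x\<in>X. f x y) field_differentiable at z within S"
    using r(1) by (meson centre_in_ball field_differentiable_at_within holomorphic_on_imp_differentiable_at open_ball)
qed

definition bottom_row :: "int^2^2 \<Rightarrow> int \<times> int" where "bottom_row A = (A$2$1, A$2$2)"

text \<open>The modulus of the term of a Poincare series that belongs to the bottom row \<open>(c, d)\<close>, with the
  factor \<open>Im z powr a\<close> left out.\<close>

definition poincare_majorant :: "real \<Rightarrow> real \<Rightarrow> complex \<Rightarrow> int \<times> int \<Rightarrow> real" where
  "poincare_majorant a h z = (\<lambda>(c, d). cmod (of_int c * z + of_int d) powr (- (2 * a)) *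
     exp (- (2 * pi * (Im z / (cmod (of_int c * z + of_int d))\<^sup>2) / h)))"

lemma poincare_majorant_nonneg: "poincare_majorant a h z r \<ge> 0"
  by (simp add: poincare_majorant_def split: prod.splits)

lemma poincare_majorant_row:
  "poincare_majorant a h z (bottom_row A) = cmod (denom A z) powr (- (2 * a)) * exp (- (2 * pi * (Im z / (cmod (denom A z))\<^sup>2) / h))"
  by (simp add: poincare_majorant_def bottom_row_def denom_def)

lemma poincare_majorant_le:
  assumes "Im z > 0" "h > 0"
  shows "poincare_majorant a h z (c, d) \<le> cmod (of_int c * z + of_int d) powr (- (2 * a))"
  using assms by (auto simp: poincare_majorant_def intro!: mult_left_le)

text \<open>A row of determinant 1 with c = 0 is (0, 1) or (0, -1), and only these keep the
  exponential. In all other rows it is bounded by 1 and the lattice sum with N = 1 takes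
  over.\<close>

lemma sum_poincare_majorant_le:
  assumes a: "a > 1" and z: "Im z \<ge> 1 / 2" and h: "h > 0" and X: "finite X" "X \<subseteq> bottom_row ` SL2Z"
  shows "(\<Sum>r\<in>X. poincare_majorant a h z r) \<le> 2 * exp (- (2 * pi * Im z / h)) + lattice_const a * Im z powr (- a)"
proof -
  have z0: "Im z > 0" using z by linarith
  define X0 X1 where "X0 = {r\<in>X. fst r = 0}" and "X1 = {r\<in>X. fst r \<noteq> 0}"
  have fin: "finite X0" "finite X1" using X by (auto simp: X0_def X1_def)
  have X0: "X0 \<subseteq> {(0, 1), (0, -1)}"
  proof
    fix r assume "r \<in> X0"
    then obtain A where A: "A \<in> SL2Z" "r = bottom_row A" "A$2$1 = 0" using X by (auto simp: X0_def bottom_row_def)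
    hence "A$1$1 * A$2$2 = 1" by (simp add: SL2Z_iff)
    hence "A$2$2 = 1 \<or> A$2$2 = -1" by (auto simp: zmult_eq_1_iff)
    thus "r \<in> {(0, 1), (0, -1)}" using A by (auto simp: bottom_row_def)
  qed
  have "(\<Sum>r\<in>X. poincare_majorant a h z r) = (\<Sum>r\<in>X0. poincare_majorant a h z r) + (\<Sum>r\<in>X1. poincare_majorant a h z r)"
    using X(1) by (subst sum.union_disjoint[symmetric]) (auto simp: X0_def X1_def intro!: sum.cong)
  also have "(\<Sum>r\<in>X0. poincare_majorant a h z r) \<le> (\<Sum>r\<in>{(0, 1), (0, -1)}. poincare_majorant a h z r)"
    using X0 by (intro sum_mono2) (auto simp: poincare_majorant_nonneg)
  also have "\<dots> = 2 * exp (- (2 * pi * Im z / h))" by (simp add: poincare_majorant_def)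
  also have "(\<Sum>r\<in>X1. poincare_majorant a h z r) \<le> (\<Sum>(c, d)\<in>X1. cmod (of_int c * z + of_int d) powr (- (2 * a)))"
    using poincare_majorant_le[OF z0 h] by (intro sum_mono) auto
  also have "\<dots> \<le> lattice_const a * (real 1 * Im z) powr (- a)"
    using fin by (intro lattice_sum_le a z) (auto simp: X1_def)
  finally show ?thesis by simp
qed

lemma majorant_tendsto_0:
  fixes a h K :: real
  assumes "a > 0" "h > 0"
  shows "((\<lambda>y. 2 * exp (- (2 * pi * y / h)) + K * y powr (- a)) \<longlongrightarrow> 0) at_top"
proof -
  have "((\<lambda>y. exp (- (2 * pi * y / h))) \<longlongrightarrow> 0) at_top" using assms by real_asymp
  moreover have "((\<lambda>y. y powr (- a)) \<longlongrightarrow> 0) at_top" using assms by real_asymp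
  ultimately have "((\<lambda>y. 2 * exp (- (2 * pi * y / h)) + K * y powr (- a)) \<longlongrightarrow> 2 * 0 + K * 0) at_top"
    by (intro tendsto_intros)
  thus ?thesis by simp
qed

lemma cmod_eq_powr_if_power4:
  fixes x y :: complex
  assumes "x ^ 4 = y ^ (2 * m)" "y \<noteq> 0"
  shows "cmod x = cmod y powr (real m / 2)"
proof -
  have "cmod x ^ 4 = cmod y ^ (2 * m)" using assms(1) by (metis norm_power)
  also have "\<dots> = cmod y powr (real (2 * m))" using assms(2) by (intro powr_realpow[symmetric]) simp
  also have "\<dots> = (cmod y powr (real m / 2)) powr (real 4)" by (simp add: powr_powr)
  also have "\<dots> = (cmod y powr (real m / 2)) ^ 4" using assms(2) by (intro powr_realpow) simp
  finally show ?thesis by (rule power_eq_imp_eq_base) auto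
qed

lemma (in congruence_group) weak_form_if_cusp_form:
  assumes J: "\<And>G z. G \<in> \<Gamma> \<Longrightarrow> Im z > 0 \<Longrightarrow> J G z ^ 4 = denom G z ^ (2 * m)"
    and f: "f \<in> cusp_forms (real m / 2) \<Gamma> J"
  shows "weak_form m f"
proof -
  have "f (moebius_action G z) ^ 4 = denom G z ^ (2 * m) * f z ^ 4" if "G \<in> \<Gamma>" "z \<in> \<H>" for G z
    using f that J[of G z] by (auto simp: cusp_forms_def power_mult_distrib)
  thus ?thesis using f unfolding weak_form_def cusp_forms_def slash_def[abs_def] by auto
qed

section \<open>Construction of the Poincare series\<close>

text \<open>What the Poincare series needs from a multiplier, with weight m/2. The conditions on
  matrices with lower left entry 0 say that infinity is a regular cusp of width h; only the fourth
  power of J is prescribed, so that powers of the denominator and of the theta factor are both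
  covered.\<close>

locale automorphy_factor = congruence_group +
  fixes J :: "int^2^2 \<Rightarrow> complex \<Rightarrow> complex" and m h N :: nat
  assumes m: "m > 4" and h: "h > 0" and N: "N > 0"
    and J_holomorphic: "G \<in> \<Gamma> \<Longrightarrow> J G holomorphic_on \<H>"
    and J_power4: "G \<in> \<Gamma> \<Longrightarrow> Im z > 0 \<Longrightarrow> J G z ^ 4 = denom G z ^ (2 * m)"
    and J_mult: "G \<in> \<Gamma> \<Longrightarrow> H \<in> \<Gamma> \<Longrightarrow> Im z > 0 \<Longrightarrow> J (G ** H) z = J G (moebius_action H z) * J H z"
    and J_unipotent: "G \<in> \<Gamma> \<Longrightarrow> G$2$1 = 0 \<Longrightarrow> Im z > 0 \<Longrightarrow> J G z = 1"
    and unipotent_action: "G \<in> \<Gamma> \<Longrightarrow> G$2$1 = 0 \<Longrightarrow> \<exists>n::int. \<forall>z. Im z > 0 \<longrightarrow> moebius_action G z = z + of_int n * of_nat h"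
    and unipotent_in: "Tm (int h) \<in> \<Gamma>"
    and level: "G \<in> \<Gamma> \<Longrightarrow> int N dvd G$2$1"
begin

definition \<kappa> :: real where "\<kappa> = real m / 2"

text \<open>Half the weight: the modulus of a form times \<open>Im z powr a\<close> is invariant,
  and a > 1 is the condition for convergence.\<close>

definition a :: real where "a = real m / 4"

lemma a_gt_1: "a > 1" and \<kappa>_eq: "\<kappa> = 2 * a"
  using m by (simp_all add: a_def \<kappa>_def)

lemma in_SL2Z: "G \<in> \<Gamma> \<Longrightarrow> G \<in> SL2Z"
  using sub by blast

lemma J_norm: "G \<in> \<Gamma> \<Longrightarrow> Im z > 0 \<Longrightarrow> cmod (J G z) = cmod (denom G z) powr (real m / 2)"
  by (rule cmod_eq_powr_if_power4[OF J_power4 denom_nonzero[OF in_SL2Z]])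

lemma J_nonzero: "G \<in> \<Gamma> \<Longrightarrow> Im z > 0 \<Longrightarrow> J G z \<noteq> 0"
  using J_norm[of G z] denom_nonzero[OF in_SL2Z, of G z] by auto

lemma cusp_forms_weak: "f \<in> cusp_forms \<kappa> \<Gamma> J \<Longrightarrow> weak_form m f"
  using weak_form_if_cusp_form[of J m f] J_power4 by (simp add: \<kappa>_def)

definition pterm :: "int^2^2 \<Rightarrow> complex \<Rightarrow> complex" where
  "pterm G z = exp (2 * of_real pi * \<i> * moebius_action G z / of_nat h) / J G z"

definition rows :: "(int \<times> int) set" where "rows = bottom_row ` \<Gamma>"

text \<open>The quotient of the group by its translations is represented by bottom rows, and the
  choice of a matrix with a given row is immaterial by \<open>pterm_same_row\<close>. A row and its
  negative count separately if both occur.\<close>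

definition lift :: "int \<times> int \<Rightarrow> int^2^2" where "lift r = (SOME G. G \<in> \<Gamma> \<and> bottom_row G = r)"

lemma lift: "r \<in> rows \<Longrightarrow> lift r \<in> \<Gamma>" "r \<in> rows \<Longrightarrow> bottom_row (lift r) = r"
proof -
  assume "r \<in> rows"
  hence "\<exists>G. G \<in> \<Gamma> \<and> bottom_row G = r" by (auto simp: rows_def)
  from someI_ex[OF this] show "lift r \<in> \<Gamma>" "bottom_row (lift r) = r" by (auto simp: lift_def)
qed

lemma row_in_rows: "G \<in> \<Gamma> \<Longrightarrow> bottom_row G \<in> rows" by (simp add: rows_def)

lemma row_mult_right: "bottom_row (A ** B) = (fst (bottom_row A) * B$1$1 + snd (bottom_row A) * B$2$1, fst (bottom_row A) * B$1$2 + snd (bottom_row A) * B$2$2)"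
  by (simp add: bottom_row_def mult2_nth)

lemma row_mult_cong: "bottom_row A = bottom_row B \<Longrightarrow> bottom_row (A ** C) = bottom_row (B ** C)"
  by (simp add: row_mult_right)

text \<open>Matrices with the same row differ by a translation in the group. It moves the argument
  by a multiple of h, the period of the exponential, and has trivial automorphy factor.\<close>

lemma pterm_same_row:
  assumes G: "G \<in> \<Gamma>" "H \<in> \<Gamma>" and r: "bottom_row G = bottom_row H" and z: "Im z > 0"
  shows "pterm G z = pterm H z"
proof -
  obtain n where n: "H = Tm n ** G"
    using SL2Z_same_row[of G H] G r in_SL2Z by (auto simp: bottom_row_def)
  have "Tm n = H ** adj2 G" using n G in_SL2Z by simp
  hence T: "Tm n \<in> \<Gamma>" using G by (simp add: mult inv)
  have Gz: "Im (moebius_action G z) > 0" using G in_SL2Z z by simp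
  obtain k :: int where k: "moebius_action (Tm n) (moebius_action G z) = moebius_action G z + of_int k * of_nat h"
    using unipotent_action[OF T] Gz by auto
  have "moebius_action H z = moebius_action G z + of_int k * of_nat h"
    unfolding n using k G in_SL2Z z by (subst moebius_mult) auto
  hence "2 * of_real pi * \<i> * moebius_action H z / of_nat h = 2 * of_real pi * \<i> * moebius_action G z / of_nat h + 2 * of_real pi * \<i> * of_int k"
    using h by (simp add: field_simps)
  hence "exp (2 * of_real pi * \<i> * moebius_action H z / of_nat h) = exp (2 * of_real pi * \<i> * moebius_action G z / of_nat h)"
    using exp_integer_2pi[of "of_int k"] by (simp add: exp_add mult_ac)
  moreover have "J H z = J G z"
    unfolding n using J_mult[OF T G(1) z] J_unipotent[OF T _ Gz] by simp
  ultimately show ?thesis by (simp add: pterm_def)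
qed

lemma pterm_lift: "G \<in> \<Gamma> \<Longrightarrow> Im z > 0 \<Longrightarrow> pterm (lift (bottom_row G)) z = pterm G z"
  by (rule pterm_same_row) (use lift row_in_rows in auto)

lemma pterm_moebius:
  assumes G: "G \<in> \<Gamma>" "H \<in> \<Gamma>" and z: "Im z > 0"
  shows "pterm G (moebius_action H z) = J H z * pterm (G ** H) z"
  using J_mult[OF G z] J_nonzero[OF G(2) z] in_SL2Z[OF G(1)] in_SL2Z[OF G(2)] z
  by (simp add: pterm_def moebius_mult)

lemma norm_exp_moebius:
  assumes "A \<in> SL2Z" "Im z > 0"
  shows "cmod (exp (2 * of_real pi * \<i> * moebius_action A z / of_nat h)) = exp (- (2 * pi * (Im z / (cmod (denom A z))\<^sup>2) / real h))"
proof -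
  have "Re (2 * of_real pi * \<i> * moebius_action A z / of_nat h) = - (2 * pi * Im (moebius_action A z) / real h)"
    by (simp add: Re_divide_of_nat)
  thus ?thesis using assms by (simp add: norm_exp_eq_Re Im_moebius)
qed

text \<open>The denominators of G at A z and of A at z combine by the cocycle relation. The terms of
  the slashed series are thus governed by the rows of G A, which lie in the full modular
  group.\<close>

lemma norm_pterm:
  assumes G: "G \<in> \<Gamma>" and A: "A \<in> SL2Z" and z: "Im z > 0"
  shows "cmod (denom A z) powr (- \<kappa>) * cmod (pterm G (moebius_action A z)) = poincare_majorant a (real h) z (bottom_row (G ** A))"
proof -
  have Az: "Im (moebius_action A z) > 0" using A z by simp
  have GA: "G ** A \<in> SL2Z" using G in_SL2Z A by (simp add: SL2Z_mult)
  have d: "denom (G ** A) z = denom G (moebius_action A z) * denom A z" using A z by (simp add: denom_mult)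
  have "cmod (pterm G (moebius_action A z)) = exp (- (2 * pi * (Im z / (cmod (denom (G ** A) z))\<^sup>2) / real h)) / cmod (denom G (moebius_action A z)) powr \<kappa>"
    using norm_exp_moebius[OF GA z] G A z in_SL2Z
    by (simp add: pterm_def norm_divide J_norm[OF G Az] \<kappa>_def moebius_mult)
  moreover have "cmod (denom (G ** A) z) powr (- \<kappa>) = cmod (denom G (moebius_action A z)) powr (- \<kappa>) * cmod (denom A z) powr (- \<kappa>)"
    unfolding d norm_mult by (rule powr_mult)
  ultimately show ?thesis
    unfolding poincare_majorant_row \<kappa>_eq[symmetric] by (simp add: powr_minus_divide)
qed

lemma norm_pterm_lift:
  assumes r: "r \<in> rows" and z: "Im z > 0"
  shows "cmod (pterm (lift r) z) = poincare_majorant a (real h) z r"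
  using norm_pterm[OF lift(1)[OF r] one_in_SL2Z z] lift(2)[OF r] by simp

lemma rows_nonzero: "(c, d) \<in> rows \<Longrightarrow> (c, d) \<noteq> (0, 0)"
proof
  assume "(c, d) \<in> rows" "(c, d) = (0, 0)"
  then obtain G where "G \<in> \<Gamma>" "G$2$1 = 0" "G$2$2 = 0" by (auto simp: rows_def bottom_row_def)
  thus False using in_SL2Z[of G] by (simp add: SL2Z_iff)
qed

definition poincare :: "complex \<Rightarrow> complex" where
  "poincare z = (if z \<in> \<H> then \<Sum>\<^sub>\<infinity>r\<in>rows. pterm (lift r) z else 0)"

lemma pterm_summable:
  assumes z: "Im z > 0" shows "(\<lambda>r. cmod (pterm (lift r) z)) summable_on rows"
proof -
  have K: "compact {z}" "{z} \<subseteq> \<H>" using z by auto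
  obtain M :: "int \<times> int \<Rightarrow> real" where M: "M summable_on UNIV"
    "\<And>y c d. y \<in> {z} \<Longrightarrow> (c, d) \<noteq> (0, 0) \<Longrightarrow> cmod (of_int c * y + of_int d) powr (- (2 * a)) \<le> M (c, d)"
    using lattice_majorant[OF a_gt_1 K] by blast
  have "M summable_on rows" using M(1) summable_on_subset_banach by blast
  thus ?thesis
  proof (rule summable_on_comparison_test)
    fix r assume r: "r \<in> rows"
    obtain c d where cd: "r = (c, d)" by (cases r)
    show "cmod (pterm (lift r) z) \<le> M r"
      using norm_pterm_lift[OF r z] poincare_majorant_le[of z "real h" a c d] M(2)[OF singletonI rows_nonzero[of c d]] r z h
      by (simp add: cd)
  qed auto
qed

lemma poincare_holomorphic: "poincare holomorphic_on \<H>"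
proof -
  have "(\<lambda>z. \<Sum>\<^sub>\<infinity>r\<in>rows. pterm (lift r) z) holomorphic_on \<H>"
  proof (rule holomorphic_infsum[OF open_H])
    fix r assume r: "r \<in> rows"
    have "lift r \<in> SL2Z" using lift(1)[OF r] in_SL2Z by blast
    thus "pterm (lift r) holomorphic_on \<H>"
      unfolding pterm_def[abs_def] using lift(1)[OF r] J_nonzero[of "lift r"] h
      by (intro holomorphic_intros holomorphic_moebius J_holomorphic) auto
  next
    fix K assume K: "compact K" "K \<subseteq> \<H>"
    obtain M :: "int \<times> int \<Rightarrow> real" where M: "M summable_on UNIV"
      "\<And>z c d. z \<in> K \<Longrightarrow> (c, d) \<noteq> (0, 0) \<Longrightarrow> cmod (of_int c * z + of_int d) powr (- (2 * a)) \<le> M (c, d)"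
      using lattice_majorant[OF a_gt_1 K] by blast
    have "cmod (pterm (lift r) z) \<le> M r" if r: "r \<in> rows" and z: "z \<in> K" for r z
    proof -
      obtain c d where cd: "r = (c, d)" by (cases r)
      have "Im z > 0" using z K by auto
      thus ?thesis
        using norm_pterm_lift[OF r, of z] poincare_majorant_le[of z "real h" a c d] M(2)[OF z rows_nonzero[of c d]] r h
        by (simp add: cd)
    qed
    moreover have "M summable_on rows" using M(1) summable_on_subset_banach by blast
    ultimately show "\<exists>M. M summable_on rows \<and> (\<forall>r\<in>rows. \<forall>z\<in>K. cmod (pterm (lift r) z) \<le> M r)" by blast
  qed
  thus ?thesis by (rule holomorphic_transform) (simp add: poincare_def)
qed

text \<open>This is right multiplication of rows by H; \<open>lift\<close> merely completes a row to
  a matrix.\<close>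

lemma bij_betw_rows_mult:
  assumes H: "H \<in> \<Gamma>"
  shows "bij_betw (\<lambda>r. bottom_row (lift r ** H)) rows rows"
proof (rule bij_betwI[where g = "\<lambda>r. bottom_row (lift r ** adj2 H)"])
  have HS: "H \<in> SL2Z" using H in_SL2Z by blast
  show "(\<lambda>r. bottom_row (lift r ** H)) \<in> rows \<rightarrow> rows" "(\<lambda>r. bottom_row (lift r ** adj2 H)) \<in> rows \<rightarrow> rows"
    using lift H by (auto intro!: row_in_rows mult inv)
  fix r assume r: "r \<in> rows"
  have "bottom_row (lift (bottom_row (lift r ** H))) = bottom_row (lift r ** H)" "bottom_row (lift (bottom_row (lift r ** adj2 H))) = bottom_row (lift r ** adj2 H)"
    using lift(1)[OF r] H by (auto intro!: lift(2) row_in_rows mult inv)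
  from this[THEN row_mult_cong, of "adj2 H"] this[THEN row_mult_cong, of "H"]
  show "bottom_row (lift (bottom_row (lift r ** H)) ** adj2 H) = r" "bottom_row (lift (bottom_row (lift r ** adj2 H)) ** H) = r"
    using lift(2)[OF r] HS by simp_all
qed

lemma poincare_automorphic:
  assumes H: "H \<in> \<Gamma>" and z: "Im z > 0"
  shows "poincare (moebius_action H z) = J H z * poincare z"
proof -
  have HS: "H \<in> SL2Z" using H in_SL2Z by blast
  have "poincare (moebius_action H z) = (\<Sum>\<^sub>\<infinity>r\<in>rows. pterm (lift r) (moebius_action H z))"
    using HS z by (simp add: poincare_def)
  also have "\<dots> = (\<Sum>\<^sub>\<infinity>r\<in>rows. J H z * pterm (lift (bottom_row (lift r ** H))) z)"
    using lift(1) H z by (intro infsum_cong) (simp add: pterm_moebius pterm_lift mult)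
  also have "\<dots> = J H z * (\<Sum>\<^sub>\<infinity>r\<in>rows. pterm (lift (bottom_row (lift r ** H))) z)"
    by (simp add: infsum_cmult_right')
  also have "(\<Sum>\<^sub>\<infinity>r\<in>rows. pterm (lift (bottom_row (lift r ** H))) z) = (\<Sum>\<^sub>\<infinity>r\<in>rows. pterm (lift r) z)"
    by (rule infsum_reindex_bij_betw[OF bij_betw_rows_mult[OF H]])
  finally show ?thesis using z by (simp add: poincare_def)
qed

lemma norm_slash_poincare_le:
  assumes A: "A \<in> SL2Z" and z: "Im z > 0"
  shows "cmod (slash \<kappa> poincare A z) \<le> (\<Sum>\<^sub>\<infinity>r\<in>rows. poincare_majorant a (real h) z (bottom_row (lift r ** A)))"
    and "(\<lambda>r. poincare_majorant a (real h) z (bottom_row (lift r ** A))) summable_on rows"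
proof -
  have Az: "Im (moebius_action A z) > 0" using A z by simp
  have eq: "cmod (denom A z) powr (- \<kappa>) * cmod (pterm (lift r) (moebius_action A z)) = poincare_majorant a (real h) z (bottom_row (lift r ** A))"
    if "r \<in> rows" for r
    using norm_pterm[OF lift(1)[OF that] A z] .
  have abs: "(\<lambda>r. cmod (pterm (lift r) (moebius_action A z))) summable_on rows"
    using pterm_summable[OF Az] by simp
  show "(\<lambda>r. poincare_majorant a (real h) z (bottom_row (lift r ** A))) summable_on rows"
  proof -
    have "(\<lambda>r. cmod (denom A z) powr (- \<kappa>) * cmod (pterm (lift r) (moebius_action A z))) summable_on rows"
      by (rule summable_on_cmult_right[OF abs])
    also have "?this \<longleftrightarrow> ?thesis" by (rule summable_on_cong) (rule eq)
    finally show ?thesis .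
  qed
  have "cmod (poincare (moebius_action A z)) \<le> (\<Sum>\<^sub>\<infinity>r\<in>rows. cmod (pterm (lift r) (moebius_action A z)))"
    using Az norm_infsum_bound[OF pterm_summable[OF Az]] by (simp add: poincare_def)
  hence "cmod (slash \<kappa> poincare A z) \<le> cmod (denom A z) powr (- \<kappa>) * (\<Sum>\<^sub>\<infinity>r\<in>rows. cmod (pterm (lift r) (moebius_action A z)))"
    unfolding slash_def norm_mult by (simp add: norm_powr_real_powr' mult_left_mono)
  also have "\<dots> = (\<Sum>\<^sub>\<infinity>r\<in>rows. cmod (denom A z) powr (- \<kappa>) * cmod (pterm (lift r) (moebius_action A z)))"
    by (simp add: infsum_cmult_right')
  also have "\<dots> = (\<Sum>\<^sub>\<infinity>r\<in>rows. poincare_majorant a (real h) z (bottom_row (lift r ** A)))"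
    by (intro infsum_cong eq)
  finally show "cmod (slash \<kappa> poincare A z) \<le> \<dots>" .
qed

lemma inj_rows_mult:
  assumes A: "A \<in> SL2Z" shows "inj_on (\<lambda>r. bottom_row (lift r ** A)) rows"
proof (rule inj_onI)
  fix r s assume rs: "r \<in> rows" "s \<in> rows" "bottom_row (lift r ** A) = bottom_row (lift s ** A)"
  from row_mult_cong[OF rs(3), of "adj2 A"] show "r = s"
    using rs lift(2) A by simp
qed

text \<open>Multiplication by A maps the rows injectively to rows of the full modular group, so one
  bound holds at every cusp. Both of its terms tend to 0 with growing height.\<close>

lemma norm_slash_poincare_le':
  assumes A: "A \<in> SL2Z" and z: "Im z \<ge> 1 / 2"
  shows "cmod (slash \<kappa> poincare A z) \<le> 2 * exp (- (2 * pi * Im z / real h)) + lattice_const a * Im z powr (- a)"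
proof -
  have z0: "Im z > 0" using z by linarith
  have "(\<Sum>\<^sub>\<infinity>r\<in>rows. poincare_majorant a (real h) z (bottom_row (lift r ** A)))
      \<le> 2 * exp (- (2 * pi * Im z / real h)) + lattice_const a * Im z powr (- a)"
  proof (rule infsum_le_finite_sums)
    fix X assume X: "finite X" "X \<subseteq> rows"
    have "(\<Sum>r\<in>X. poincare_majorant a (real h) z (bottom_row (lift r ** A))) = (\<Sum>r\<in>(\<lambda>r. bottom_row (lift r ** A)) ` X. poincare_majorant a (real h) z r)"
      using inj_on_subset[OF inj_rows_mult[OF A] X(2)] by (simp add: sum.reindex)
    also have "\<dots> \<le> 2 * exp (- (2 * pi * Im z / real h)) + lattice_const a * Im z powr (- a)"
    proof (intro sum_poincare_majorant_le a_gt_1 z)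
      have "lift r ** A \<in> SL2Z" if "r \<in> X" for r
        using that X(2) by (intro SL2Z_mult[OF in_SL2Z[OF lift(1)] A]) auto
      thus "(\<lambda>r. bottom_row (lift r ** A)) ` X \<subseteq> bottom_row ` SL2Z" by blast
    qed (use X h in auto)
    finally show "(\<Sum>r\<in>X. poincare_majorant a (real h) z (bottom_row (lift r ** A))) \<le> \<dots>" .
  qed (rule norm_slash_poincare_le(2)[OF A z0])
  thus ?thesis using norm_slash_poincare_le(1)[OF A z0] by linarith
qed

lemma poincare_cusp_form: "poincare \<in> cusp_forms \<kappa> \<Gamma> J"
proof -
  have "(slash \<kappa> poincare A \<longlongrightarrow> 0) (filtercomap Im at_top)" if A: "A \<in> SL2Z" for A
  proof (rule Lim_null_comparison)
    show "\<forall>\<^sub>F z in filtercomap Im at_top. norm (slash \<kappa> poincare A z)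
        \<le> 2 * exp (- (2 * pi * Im z / real h)) + lattice_const a * Im z powr (- a)"
      unfolding eventually_filtercomap_at_top_linorder using norm_slash_poincare_le'[OF A] by blast
    have "((\<lambda>y. 2 * exp (- (2 * pi * y / real h)) + lattice_const a * y powr (- a)) \<longlongrightarrow> 0) at_top"
      using a_gt_1 h by (intro majorant_tendsto_0) auto
    thus "((\<lambda>z. 2 * exp (- (2 * pi * Im z / real h)) + lattice_const a * Im z powr (- a)) \<longlongrightarrow> 0) (filtercomap Im at_top)"
      using filterlim_compose[OF _ filterlim_filtercomap] by blast
  qed
  thus ?thesis
    using poincare_holomorphic poincare_automorphic
    by (auto simp: cusp_forms_def slash_def[abs_def] poincare_def)
qed

end

section \<open>The norm of the Poincare series\<close>

lemma bottom_row_Tm [simp]: "bottom_row (Tm n ** A) = bottom_row A"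
  by (simp add: bottom_row_def mult2_nth)

lemma has_sum_finite_sum:
  fixes f :: "'i \<Rightarrow> 'a \<Rightarrow> 'b::topological_comm_monoid_add"
  assumes "finite I" "\<And>i. i \<in> I \<Longrightarrow> (f i has_sum s i) A"
  shows "((\<lambda>x. \<Sum>i\<in>I. f i x) has_sum (\<Sum>i\<in>I. s i)) A"
  using assms by (induction I rule: finite_induct) (auto intro: has_sum_add has_sum_0)

lemma nn_integral_powr_le:
  fixes a h :: real
  assumes a: "a > 1" and h: "h \<ge> 1"
  shows "(\<integral>\<^sup>+y. indicator {1/2..h} y * ennreal (y powr (a - 2)) \<partial>lborel) \<le> ennreal (h powr (a - 1) / (a - 1))"
proof -
  have "(\<integral>\<^sup>+y. ennreal (y powr (a - 2)) * indicator {1/2..h} y \<partial>lborel) = ennreal (h powr (a - 1) / (a - 1) - (1/2) powr (a - 1) / (a - 1))"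
  proof (rule nn_integral_FTC_Icc)
    show "DERIV (\<lambda>y. y powr (a - 1) / (a - 1)) y :> y powr (a - 2)" if "y \<in> {1/2..h}" for y
      using that a by (auto intro!: derivative_eq_intros)
  qed (use h in auto)
  also have "\<dots> \<le> ennreal (h powr (a - 1) / (a - 1))" using a by (intro ennreal_leI) simp
  finally show ?thesis by (simp add: mult.commute)
qed

lemma nn_integral_inverse_square:
  fixes h :: real
  assumes h: "h > 0"
  shows "(\<integral>\<^sup>+y. indicator {h..} y * ennreal (1 / y\<^sup>2) \<partial>lborel) = ennreal (1 / h)"
proof -
  have "(\<integral>\<^sup>+y. ennreal (1 / y\<^sup>2) * indicator {h..} y \<partial>lborel) = ennreal (0 - (- (1 / h)))"
  proof (rule nn_integral_FTC_atLeast)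
    show "((\<lambda>y::real. - (1 / y)) \<longlongrightarrow> 0) at_top" by real_asymp
    show "DERIV (\<lambda>y. - (1 / y)) y :> 1 / y\<^sup>2" if "h \<le> y" for y :: real
      using that h by (auto intro!: derivative_eq_intros simp: power2_eq_square)
  qed auto
  thus ?thesis by (simp add: mult.commute)
qed

text \<open>The three summands bound the integrals of \<open>u1\<close>, \<open>u2\<close> and
  \<open>u3\<close> in \<open>nn_integral_profile_le\<close>, after the common factor
  \<open>h powr (a - 1)\<close> is taken out.\<close>

definition energy_const :: "nat \<Rightarrow> real" where
  "energy_const m = 2 / (real m / 4 - 1) + 2 * decay_const m + 2 * lattice_const (real m / 4)"

lemma energy_const_pos: "m > 4 \<Longrightarrow> energy_const m > 0"
  unfolding energy_const_def using decay_const_pos[of m] lattice_const_pos[of "real m / 4"]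
  by (intro add_pos_pos) auto

text \<open>Up to height h the exponential is bounded by 1 and y^(a - 2) integrates to at most h^(a
  - 1)/(a - 1), where a > 1 enters. Above h the exponential reduces y^a to a multiple of h^a, and
  1/y^2 contributes 1/h. In the lattice part the powers of y cancel to 1/y^2.\<close>

lemma nn_integral_profile_le:
  fixes a h :: real
  assumes m: "m > 4" and h: "h \<ge> 1" and a: "a = real m / 4"
  shows "(\<integral>\<^sup>+y. indicator {1/2..} y * ennreal (y powr a / y\<^sup>2 * (2 * exp (- (2 * pi * y / h)) + lattice_const a * y powr (- a))) \<partial>lborel)
     \<le> ennreal (energy_const m * h powr (a - 1))"
proof -
  have a1: "a > 1" using m a by simp
  note LC = lattice_const_pos[OF a1]
  define D where "D = decay_const m"
  have D: "D > 0" unfolding D_def by (rule decay_const_pos)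
  define u1 where "u1 = (\<lambda>y::real. ennreal 2 * (indicator {1/2..h} y * ennreal (y powr (a - 2))))"
  define u2 where "u2 = (\<lambda>y::real. ennreal (2 * (D * h powr a)) * (indicator {h..} y * ennreal (1 / y\<^sup>2)))"
  define u3 where "u3 = (\<lambda>y::real. ennreal (lattice_const a) * (indicator {1/2..} y * ennreal (1 / y\<^sup>2)))"
  have [measurable]: "u1 \<in> borel_measurable borel" "u2 \<in> borel_measurable borel" "u3 \<in> borel_measurable borel"
    unfolding u1_def u2_def u3_def by measurable
  have pt: "indicator {1/2..} y * ennreal (y powr a / y\<^sup>2 * (2 * exp (- (2 * pi * y / h)) + lattice_const a * y powr (- a)))
      \<le> u1 y + (u2 y + u3 y)" for y :: real
  proof (cases "y \<ge> 1/2")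
    case True
    hence y: "y > 0" by simp
    have e: "y powr a / y\<^sup>2 * (2 * exp (- (2 * pi * y / h)) + lattice_const a * y powr (- a))
       = 2 * (y powr a / y\<^sup>2 * exp (- (2 * pi * y / h))) + lattice_const a * (1 / y\<^sup>2)"
      using y by (simp add: powr_minus field_simps)
    have "ennreal (2 * (y powr a / y\<^sup>2 * exp (- (2 * pi * y / h)))) \<le> u1 y + u2 y"
    proof (cases "y \<le> h")
      case True
      have "y powr a / y\<^sup>2 * exp (- (2 * pi * y / h)) \<le> y powr a / y\<^sup>2 * 1"
        using y h by (intro mult_left_mono) auto
      also have "\<dots> = y powr (a - 2)" using y by (simp add: powr_diff powr_numeral)
      finally have "ennreal (2 * (y powr a / y\<^sup>2 * exp (- (2 * pi * y / h)))) \<le> ennreal (2 * y powr (a - 2))"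
        by (intro ennreal_leI mult_left_mono) auto
      also have "\<dots> = u1 y" using True \<open>y \<ge> 1/2\<close> by (simp add: u1_def ennreal_mult)
      finally show ?thesis by (simp add: add_increasing2)
    next
      case False
      define t where "t = y / h"
      have t: "t \<ge> 1" using False h by (simp add: t_def)
      have "y powr a = h powr a * t powr a" using y h by (simp add: t_def powr_divide)
      moreover have "t powr a * exp (- (2 * pi * t)) \<le> D"
      proof -
        have "0 \<le> pi * t" using t by simp
        have "t powr a \<le> t powr (real m)" using t a by (intro powr_mono) auto
        also have "\<dots> = t ^ m" using t by (intro powr_realpow) auto
        finally have "t powr a * exp (- (2 * pi * t)) \<le> t ^ m * exp (- (pi * (t - 1)))"
        proof (rule mult_mono)
          have "- (2 * pi * t) \<le> - (pi * (t - 1))"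
            unfolding right_diff_distrib using \<open>0 \<le> pi * t\<close> pi_gt_zero by linarith
          thus "exp (- (2 * pi * t)) \<le> exp (- (pi * (t - 1)))" by simp
        qed (use t in auto)
        also have "\<dots> \<le> D" unfolding D_def decay_const_def by (rule power_exp_decay[OF t])
        finally show ?thesis .
      qed
      ultimately have "y powr a * exp (- (2 * pi * y / h)) \<le> h powr a * D"
        by (simp add: t_def mult.assoc mult_left_mono)
      hence "(y powr a * exp (- (2 * pi * y / h))) * (1 / y\<^sup>2) \<le> (h powr a * D) * (1 / y\<^sup>2)"
        by (rule mult_right_mono) simp
      hence "2 * ((y powr a * exp (- (2 * pi * y / h))) * (1 / y\<^sup>2)) \<le> 2 * ((h powr a * D) * (1 / y\<^sup>2))" by linarith
      moreover have "2 * ((y powr a * exp (- (2 * pi * y / h))) * (1 / y\<^sup>2)) = 2 * (y powr a / y\<^sup>2 * exp (- (2 * pi * y / h)))"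
        by simp
      moreover have "2 * ((h powr a * D) * (1 / y\<^sup>2)) = 2 * (D * h powr a) * (1 / y\<^sup>2)" by simp
      ultimately have "2 * (y powr a / y\<^sup>2 * exp (- (2 * pi * y / h))) \<le> 2 * (D * h powr a) * (1 / y\<^sup>2)" by (simp only:)
      hence "ennreal (2 * (y powr a / y\<^sup>2 * exp (- (2 * pi * y / h)))) \<le> ennreal (2 * (D * h powr a) * (1 / y\<^sup>2))"
        by (rule ennreal_leI)
      also have "\<dots> = ennreal (2 * (D * h powr a)) * ennreal (1 / y\<^sup>2)" using D by (intro ennreal_mult) auto
      also have "\<dots> = u2 y" using False by (simp add: u2_def)
      finally show ?thesis by (simp add: add_increasing)
    qed
    moreover have "ennreal (lattice_const a * (1 / y\<^sup>2)) = u3 y"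
      using True LC by (simp add: u3_def flip: ennreal_mult)
    moreover have "ennreal (2 * (y powr a / y\<^sup>2 * exp (- (2 * pi * y / h))) + lattice_const a * (1 / y\<^sup>2))
       = ennreal (2 * (y powr a / y\<^sup>2 * exp (- (2 * pi * y / h)))) + ennreal (lattice_const a * (1 / y\<^sup>2))"
      using LC by (intro ennreal_plus) auto
    ultimately have "ennreal (y powr a / y\<^sup>2 * (2 * exp (- (2 * pi * y / h)) + lattice_const a * y powr (- a))) \<le> (u1 y + u2 y) + u3 y"
      unfolding e by (simp add: add_right_mono)
    thus ?thesis using True by (simp add: add.assoc)
  qed simp
  have i1: "(\<integral>\<^sup>+y. u1 y \<partial>lborel) \<le> ennreal (2 * (h powr (a - 1) / (a - 1)))"
  proof -
    have "(\<integral>\<^sup>+y. u1 y \<partial>lborel) = ennreal 2 * (\<integral>\<^sup>+y. indicator {1/2..h} y * ennreal (y powr (a - 2)) \<partial>lborel)"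
      unfolding u1_def by (rule nn_integral_cmult) measurable
    also have "\<dots> \<le> ennreal 2 * ennreal (h powr (a - 1) / (a - 1))"
      by (intro mult_left_mono nn_integral_powr_le a1 h) simp
    also have "\<dots> = ennreal (2 * (h powr (a - 1) / (a - 1)))" using a1 by (intro ennreal_mult[symmetric]) auto
    finally show ?thesis .
  qed
  have i2: "(\<integral>\<^sup>+y. u2 y \<partial>lborel) = ennreal (2 * D * h powr (a - 1))"
  proof -
    have "(\<integral>\<^sup>+y. u2 y \<partial>lborel) = ennreal (2 * (D * h powr a)) * (\<integral>\<^sup>+y. indicator {h..} y * ennreal (1 / y\<^sup>2) \<partial>lborel)"
      unfolding u2_def by (rule nn_integral_cmult) measurable
    also have "\<dots> = ennreal (2 * (D * h powr a)) * ennreal (1 / h)" using h by (simp add: nn_integral_inverse_square)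
    also have "\<dots> = ennreal (2 * (D * h powr a) * (1 / h))" using D h by (intro ennreal_mult[symmetric]) auto
    also have "2 * (D * h powr a) * (1 / h) = 2 * D * h powr (a - 1)" using h by (simp add: powr_diff)
    finally show ?thesis .
  qed
  have i3: "(\<integral>\<^sup>+y. u3 y \<partial>lborel) = ennreal (lattice_const a * 2)"
  proof -
    have "(\<integral>\<^sup>+y. u3 y \<partial>lborel) = ennreal (lattice_const a) * (\<integral>\<^sup>+y. indicator {1/2..} y * ennreal (1 / y\<^sup>2) \<partial>lborel)"
      unfolding u3_def by (rule nn_integral_cmult) measurable
    also have "\<dots> = ennreal (lattice_const a) * ennreal 2" by (simp only: nn_integral_inverse_square_half ennreal_numeral)
    also have "\<dots> = ennreal (lattice_const a * 2)" using LC by (intro ennreal_mult[symmetric]) auto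
    finally show ?thesis .
  qed
  have "(\<integral>\<^sup>+y. indicator {1/2..} y * ennreal (y powr a / y\<^sup>2 * (2 * exp (- (2 * pi * y / h)) + lattice_const a * y powr (- a))) \<partial>lborel)
      \<le> (\<integral>\<^sup>+y. u1 y + (u2 y + u3 y) \<partial>lborel)"
    by (intro nn_integral_mono pt)
  also have "\<dots> = (\<integral>\<^sup>+y. u1 y \<partial>lborel) + ((\<integral>\<^sup>+y. u2 y \<partial>lborel) + (\<integral>\<^sup>+y. u3 y \<partial>lborel))"
    by (simp add: nn_integral_add)
  also have "\<dots> \<le> ennreal (2 * (h powr (a - 1) / (a - 1))) + (ennreal (2 * D * h powr (a - 1)) + ennreal (lattice_const a * 2))"
    unfolding i2 i3 by (intro add_right_mono i1)
  also have "\<dots> = ennreal (2 * (h powr (a - 1) / (a - 1)) + (2 * D * h powr (a - 1) + lattice_const a * 2))"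
    using a1 D LC by (simp add: ennreal_plus)
  also have "\<dots> \<le> ennreal (energy_const m * h powr (a - 1))"
  proof (rule ennreal_leI)
    have "h powr (a - 1) \<ge> 1" using a1 h by (intro ge_one_powr_ge_zero) auto
    hence "lattice_const a * 2 * 1 \<le> lattice_const a * 2 * h powr (a - 1)" using LC by (intro mult_left_mono) auto
    moreover have "energy_const m * h powr (a - 1)
        = 2 * (h powr (a - 1) / (a - 1)) + 2 * D * h powr (a - 1) + lattice_const a * 2 * h powr (a - 1)"
      by (simp add: energy_const_def D_def a[symmetric] ring_distribs)
    ultimately show "2 * (h powr (a - 1) / (a - 1)) + (2 * D * h powr (a - 1) + lattice_const a * 2) \<le> energy_const m * h powr (a - 1)"
      by linarith
  qed
  finally show ?thesis .
qed

section \<open>Unfolding the norm over the cosets\<close>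

context automorphy_factor
begin

lemma Tm_multiple_in: "Tm (k * int h) \<in> \<Gamma>"
proof -
  have nat: "Tm (int j * int h) \<in> \<Gamma>" for j
  proof (induction j)
    case (Suc j)
    have "Tm (int (Suc j) * int h) = Tm (int h) ** Tm (int j * int h)" by (simp add: Tm_add algebra_simps)
    thus ?case using Suc unipotent_in mult by simp
  qed (use one in simp)
  show ?thesis
  proof (cases k)
    case (neg j)
    have "Tm (k * int h) = adj2 (Tm (int (Suc j) * int h))" by (simp add: neg algebra_simps)
    thus ?thesis using nat inv by metis
  qed (use nat in auto)
qed

text \<open>A given bottom row determines the matrix up to \<open>Tm n\<close> on the left, and only the class of \<open>n\<close>
  modulo \<open>h\<close> matters.\<close>

lemma fibre_card_le:
  assumes X: "finite X" "X \<subseteq> pm_cosets \<Gamma> \<times> rows"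
  shows "card {x \<in> X. bottom_row (lift (snd x) ** rep (fst x)) = y} \<le> h"
proof (cases "{x \<in> X. bottom_row (lift (snd x) ** rep (fst x)) = y} = {}")
  case False
  define S where "S = {x \<in> X. bottom_row (lift (snd x) ** rep (fst x)) = y}"
  define B where "B = (\<lambda>x. lift (snd x) ** rep (fst x))"
  obtain x0 where x0: "x0 \<in> S" using False by (auto simp: S_def)
  have mem: "lift (snd x) \<in> \<Gamma>" "lift (snd x) \<in> SL2Z" "rep (fst x) \<in> SL2Z" "B x \<in> SL2Z" "bottom_row (B x) = y"
    "bottom_row (lift (snd x)) = snd x" "fst x \<in> pm_cosets \<Gamma>" if "x \<in> S" for x
  proof -
    have x: "fst x \<in> pm_cosets \<Gamma>" "snd x \<in> rows" using that X by (auto simp: S_def)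
    show "lift (snd x) \<in> \<Gamma>" "bottom_row (lift (snd x)) = snd x" "fst x \<in> pm_cosets \<Gamma>" using lift x by auto
    thus l: "lift (snd x) \<in> SL2Z" using in_SL2Z by blast
    show r: "rep (fst x) \<in> SL2Z" using rep_in_SL2Z x by blast
    show "B x \<in> SL2Z" unfolding B_def using l r by (rule SL2Z_mult)
    show "bottom_row (B x) = y" using that by (simp add: S_def B_def)
  qed
  have "\<exists>n. B x = Tm n ** B x0" if "x \<in> S" for x
    using SL2Z_same_row[of "B x0" "B x"] mem(4,5)[OF x0] mem(4,5)[OF that] by (auto simp: bottom_row_def)
  then obtain n where n: "\<And>x. x \<in> S \<Longrightarrow> B x = Tm (n x) ** B x0" by metis
  \<comment> \<open>If the shifts agree modulo h, the translation between the two products lies in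
    the group. This identifies first the cosets, hence their representatives, and after cancelling
    these the rows.\<close>
  have "inj_on (\<lambda>x. n x mod int h) S"
  proof (rule inj_onI)
    fix x x' assume x: "x \<in> S" "x' \<in> S" "n x mod int h = n x' mod int h"
    then obtain k where k: "n x - n x' = k * int h" by (metis mod_eq_dvd_iff dvdE mult.commute)
    have "B x = Tm (n x - n x') ** B x'" using n[OF x(1)] n[OF x(2)] by (simp add: matrix_mul_assoc Tm_add)
    hence eq: "lift (snd x) ** rep (fst x) = (Tm (k * int h) ** lift (snd x')) ** rep (fst x')"
      by (simp add: B_def k matrix_mul_assoc)
    have "rep (fst x) = adj2 (lift (snd x)) ** (lift (snd x) ** rep (fst x))" using mem[OF x(1)] by simp
    also have "\<dots> = (adj2 (lift (snd x)) ** (Tm (k * int h) ** lift (snd x'))) ** rep (fst x')"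
      unfolding eq by (simp add: matrix_mul_assoc)
    finally have "rep (fst x) \<in> coset (rep (fst x'))"
      unfolding coset_def using mem(1)[OF x(1)] mem(1)[OF x(2)] mult inv Tm_multiple_in by blast
    hence "coset (rep (fst x')) = coset (rep (fst x))" by (simp add: coset_eq_iff)
    hence f: "fst x' = fst x" using coset_rep mem(7) x by metis
    have "(lift (snd x) ** rep (fst x)) ** adj2 (rep (fst x)) = ((Tm (k * int h) ** lift (snd x')) ** rep (fst x)) ** adj2 (rep (fst x))"
      using eq f by simp
    hence "lift (snd x) = Tm (k * int h) ** lift (snd x')" using mem(3)[OF x(1)] by simp
    hence "snd x = snd x'" using mem(6)[OF x(1)] mem(6)[OF x(2)] by (metis bottom_row_Tm)
    thus "x = x'" using f by (simp add: prod_eq_iff)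
  qed
  moreover have "(\<lambda>x. n x mod int h) ` S \<subseteq> {0..<int h}" using h by auto
  ultimately have "card S \<le> card {0..<int h}" by (intro card_inj_on_le) auto
  thus ?thesis by (simp add: S_def)
next
  case True
  thus ?thesis by (simp only: card.empty)
qed

text \<open>Pairs of a coset and a row of the group are sent to rows of the full modular group with
  at most h pairs over each. The sum over all cosets therefore costs a factor h, whatever the
  index.\<close>

lemma sum_cosets_slash_poincare_le:
  assumes z: "Im z \<ge> 1 / 2"
  shows "(\<Sum>C\<in>pm_cosets \<Gamma>. cmod (slash \<kappa> poincare (rep C) z))
     \<le> real h * (2 * exp (- (2 * pi * Im z / real h)) + lattice_const a * Im z powr (- a))"
proof -
  have z0: "Im z > 0" using z by linarith
  define \<psi> where "\<psi> = (\<lambda>C r. poincare_majorant a (real h) z (bottom_row (lift r ** rep C)))"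
  have sm: "\<psi> C summable_on rows" if "C \<in> pm_cosets \<Gamma>" for C
    unfolding \<psi>_def using norm_slash_poincare_le(2)[OF rep_in_SL2Z[OF that] z0] .
  have bound: "(\<Sum>C\<in>pm_cosets \<Gamma>. cmod (slash \<kappa> poincare (rep C) z)) \<le> (\<Sum>C\<in>pm_cosets \<Gamma>. \<Sum>\<^sub>\<infinity>r\<in>rows. \<psi> C r)"
    unfolding \<psi>_def by (intro sum_mono norm_slash_poincare_le(1) rep_in_SL2Z z0)
  have hs: "((\<lambda>r. \<Sum>C\<in>pm_cosets \<Gamma>. \<psi> C r) has_sum (\<Sum>C\<in>pm_cosets \<Gamma>. \<Sum>\<^sub>\<infinity>r\<in>rows. \<psi> C r)) rows"
    using sm by (intro has_sum_finite_sum finite_cosets has_sum_infsum)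
  have "(\<Sum>C\<in>pm_cosets \<Gamma>. \<Sum>\<^sub>\<infinity>r\<in>rows. \<psi> C r) = (\<Sum>\<^sub>\<infinity>r\<in>rows. \<Sum>C\<in>pm_cosets \<Gamma>. \<psi> C r)"
    using infsumI[OF hs] by simp
  also have "\<dots> \<le> real h * (2 * exp (- (2 * pi * Im z / real h)) + lattice_const a * Im z powr (- a))"
  proof (rule infsum_le_finite_sums)
    show "(\<lambda>r. \<Sum>C\<in>pm_cosets \<Gamma>. \<psi> C r) summable_on rows" using hs by (rule has_sum_imp_summable)
    fix T assume T: "finite T" "T \<subseteq> rows"
    define X where "X = pm_cosets \<Gamma> \<times> T"
    define \<rho> where "\<rho> = (\<lambda>x. bottom_row (lift (snd x) ** rep (fst x)))"
    have X: "finite X" "X \<subseteq> pm_cosets \<Gamma> \<times> rows" using T finite_cosets by (auto simp: X_def)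
    have "(\<Sum>r\<in>T. \<Sum>C\<in>pm_cosets \<Gamma>. \<psi> C r) = (\<Sum>C\<in>pm_cosets \<Gamma>. \<Sum>r\<in>T. \<psi> C r)" by (rule sum.swap)
    also have "\<dots> = (\<Sum>x\<in>X. poincare_majorant a (real h) z (\<rho> x))"
      unfolding X_def \<rho>_def \<psi>_def by (simp add: sum.cartesian_product split_beta)
    also have "\<dots> \<le> of_nat h * (\<Sum>r\<in>\<rho> ` X. poincare_majorant a (real h) z r)"
      by (rule sum_fibres_le) (use X fibre_card_le[OF X] in \<open>auto simp: \<rho>_def poincare_majorant_nonneg\<close>)
    also have "\<dots> \<le> of_nat h * (2 * exp (- (2 * pi * Im z / real h)) + lattice_const a * Im z powr (- a))"
    proof (intro mult_left_mono sum_poincare_majorant_le a_gt_1 z)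
      have "lift (snd x) ** rep (fst x) \<in> SL2Z" if "x \<in> X" for x
        using that X(2) by (intro SL2Z_mult[OF in_SL2Z[OF lift(1)] rep_in_SL2Z]) auto
      thus "\<rho> ` X \<subseteq> bottom_row ` SL2Z" unfolding \<rho>_def by blast
    qed (use X h in auto)
    finally show "(\<Sum>r\<in>T. \<Sum>C\<in>pm_cosets \<Gamma>. \<psi> C r) \<le> \<dots>" by simp
  qed
  finally show ?thesis using bound by linarith
qed

lemma poincare_weak: "weak_form m poincare"
  by (rule cusp_forms_weak[OF poincare_cusp_form])

text \<open>With C the constant of the pointwise bound and e the energy, e is at most sqrt (C e)
  times the L^1 norm. As e is finite, squaring and cancelling e leaves C times the square of the L^1
  norm, which is at most a constant times h^a.\<close>

lemma energy_poincare_le: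
  "energy \<kappa> poincare \<le> ennreal (sup_const m * (energy_const m)\<^sup>2 * real h powr \<kappa>)"
proof -
  define e where "e = enn2real (energy \<kappa> poincare)"
  have e: "energy \<kappa> poincare = ennreal e" "e \<ge> 0"
    using energy_finite[OF poincare_weak] by (simp_all add: e_def \<kappa>_def less_top)
  \<comment> \<open>Q bounds |P| Im^a everywhere, although it is expressed by the energy that is
    still to be estimated.\<close>
  define Q where "Q = sqrt (sup_const m * e)"
  have Q0: "Q \<ge> 0" using sup_const_pos[of m] e by (simp add: Q_def)
  have inv: "invnorm \<kappa> poincare w \<le> Q\<^sup>2" if "Im w > 0" for w
  proof -
    have "ennreal (invnorm \<kappa> poincare w) \<le> ennreal (sup_const m * e)"
      using invnorm_le_energy[OF poincare_weak that] e sup_const_pos[of m] by (simp add: \<kappa>_def ennreal_mult)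
    thus ?thesis using e sup_const_pos[of m] by (simp add: Q_def)
  qed
  have h1: "real h \<ge> 1" using h by simp
  define k where "k = (\<lambda>C z. ennreal (indicator \<F> z *\<^sub>R (cmod (slash \<kappa> poincare (rep C) z) * (Im z powr a / (Im z)\<^sup>2))))"
  have km: "k C \<in> borel_measurable borel" if C: "C \<in> pm_cosets \<Gamma>" for C
  proof -
    have "slash \<kappa> poincare (rep C) holomorphic_on \<F>"
      by (rule holomorphic_on_subset[OF holomorphic_slash[OF rep_in_SL2Z[OF C] poincare_holomorphic]]) (use F_subset_H in auto)
    moreover have "Im z \<noteq> 0" if "z \<in> \<F>" for z using F_subset_H[OF that] by simp
    ultimately show ?thesis unfolding k_def
      by (intro measurable_compose[OF _ measurable_ennreal] borel_measurable_continuous_on_indicator sets_F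
          continuous_intros holomorphic_on_imp_continuous_on) auto
  qed
  have cell: "cell_energy \<kappa> poincare (rep C) \<le> ennreal Q * (\<integral>\<^sup>+z. k C z \<partial>lborel)" if C: "C \<in> pm_cosets \<Gamma>" for C
  proof -
    have "cell_energy \<kappa> poincare (rep C) \<le> (\<integral>\<^sup>+z. ennreal Q * k C z \<partial>lborel)"
      unfolding cell_energy_def
    proof (intro nn_integral_mono)
      fix z :: complex
      show "indicator \<F> z * ennreal (invnorm \<kappa> poincare (moebius_action (rep C) z) / (Im z)\<^sup>2) \<le> ennreal Q * k C z"
      proof (cases "z \<in> \<F>")
        case True
        have z: "Im z > 0" using F_subset_H[OF True] .
        define s where "s = cmod (slash \<kappa> poincare (rep C) z) * Im z powr a"
        have "Im z powr \<kappa> = (Im z powr a)\<^sup>2" using z by (simp add: powr_real_power2 \<kappa>_eq)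
        hence i: "invnorm \<kappa> poincare (moebius_action (rep C) z) = s\<^sup>2"
          unfolding invnorm_slash[OF rep_in_SL2Z[OF C] z] by (simp add: invnorm_def s_def power_mult_distrib)
        hence "s\<^sup>2 \<le> Q\<^sup>2" using inv[of "moebius_action (rep C) z"] rep_in_SL2Z[OF C] z by simp
        hence "s \<le> Q" using Q0 by (rule power2_le_imp_le)
        \<comment> \<open>One of the two factors |P| Im^a is replaced by Q; the other one remains to
          be integrated.\<close>
        hence "s * s \<le> Q * s" by (intro mult_right_mono) (auto simp: s_def)
        hence "s\<^sup>2 / (Im z)\<^sup>2 \<le> Q * s / (Im z)\<^sup>2" by (intro divide_right_mono) (auto simp: power2_eq_square)
        hence "ennreal (s\<^sup>2 / (Im z)\<^sup>2) \<le> ennreal (Q * s / (Im z)\<^sup>2)" by (rule ennreal_leI)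
        also have "Q * s / (Im z)\<^sup>2 = Q * (cmod (slash \<kappa> poincare (rep C) z) * (Im z powr a / (Im z)\<^sup>2))"
          by (simp add: s_def)
        also have "ennreal \<dots> = ennreal Q * ennreal (cmod (slash \<kappa> poincare (rep C) z) * (Im z powr a / (Im z)\<^sup>2))"
          using Q0 by (intro ennreal_mult) auto
        also have "\<dots> = ennreal Q * k C z" using True by (simp add: k_def)
        finally show ?thesis using True by (simp add: i)
      qed simp
    qed
    also have "\<dots> = ennreal Q * (\<integral>\<^sup>+z. k C z \<partial>lborel)" using km[OF C] by (intro nn_integral_cmult) simp
    finally show ?thesis .
  qed
  define g where "g = (\<lambda>y. y powr a / y\<^sup>2 * (2 * exp (- (2 * pi * y / real h)) + lattice_const a * y powr (- a)))"
  have "energy \<kappa> poincare \<le> (\<Sum>C\<in>pm_cosets \<Gamma>. ennreal Q * (\<integral>\<^sup>+z. k C z \<partial>lborel))"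
    unfolding energy_def by (intro sum_mono cell)
  also have "\<dots> = ennreal Q * (\<integral>\<^sup>+z. (\<Sum>C\<in>pm_cosets \<Gamma>. k C z) \<partial>lborel)"
    using km by (subst nn_integral_sum) (auto simp: sum_distrib_left)
  also have "(\<integral>\<^sup>+z. (\<Sum>C\<in>pm_cosets \<Gamma>. k C z) \<partial>lborel) \<le> (\<integral>\<^sup>+z. indicator \<F> z * (ennreal (real h) * ennreal (g (Im z))) \<partial>lborel)"
  proof (intro nn_integral_mono)
    fix z :: complex
    show "(\<Sum>C\<in>pm_cosets \<Gamma>. k C z) \<le> indicator \<F> z * (ennreal (real h) * ennreal (g (Im z)))"
    proof (cases "z \<in> \<F>")
      case True
      have z: "Im z \<ge> 1 / 2" using F_Im_ge[OF True] .
      have "(\<Sum>C\<in>pm_cosets \<Gamma>. k C z) = ennreal ((\<Sum>C\<in>pm_cosets \<Gamma>. cmod (slash \<kappa> poincare (rep C) z)) * (Im z powr a / (Im z)\<^sup>2))"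
        unfolding k_def using True by (subst sum_ennreal) (auto simp: sum_distrib_right sum_divide_distrib)
      also have "\<dots> \<le> ennreal (real h * (2 * exp (- (2 * pi * Im z / real h)) + lattice_const a * Im z powr (- a)) * (Im z powr a / (Im z)\<^sup>2))"
        by (intro ennreal_leI mult_right_mono sum_cosets_slash_poincare_le z) simp
      also have "\<dots> = ennreal (real h * g (Im z))" by (simp add: g_def mult_ac)
      also have "\<dots> = ennreal (real h) * ennreal (g (Im z))"
        using lattice_const_pos[OF a_gt_1] by (intro ennreal_mult) (auto simp: g_def)
      finally show ?thesis using True by simp
    qed (simp add: k_def)
  qed
  also have "\<dots> = (\<integral>\<^sup>+z. ennreal (real h) * (indicator \<F> z * ennreal (g (Im z))) \<partial>lborel)"
    by (simp add: mult_ac)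
  also have "\<dots> = ennreal (real h) * (\<integral>\<^sup>+z. indicator \<F> z * ennreal (g (Im z)) \<partial>lborel)"
    unfolding g_def by (rule nn_integral_cmult) measurable
  also have "\<dots> \<le> ennreal (real h) * (\<integral>\<^sup>+y. indicator {1/2..} y * ennreal (g y) \<partial>lborel)"
    unfolding g_def by (intro mult_left_mono nn_integral_F_le[where g = "\<lambda>y. ennreal (y powr a / y\<^sup>2 * (2 * exp (- (2 * pi * y / real h)) + lattice_const a * y powr (- a)))"]) auto
  also have "\<dots> \<le> ennreal (real h) * ennreal (energy_const m * real h powr (a - 1))"
    unfolding g_def by (intro mult_left_mono nn_integral_profile_le[OF m h1 a_def]) auto
  also have "\<dots> = ennreal (real h * (energy_const m * real h powr (a - 1)))"
    using energy_const_pos[OF m] by (intro ennreal_mult[symmetric]) auto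
  also have "real h * (energy_const m * real h powr (a - 1)) = energy_const m * real h powr a"
    using h1 by (simp add: powr_diff)
  finally have "ennreal e \<le> ennreal Q * ennreal (energy_const m * real h powr a)"
    unfolding e(1) by (simp add: mult_left_mono)
  also have "\<dots> = ennreal (Q * (energy_const m * real h powr a))"
    using Q0 energy_const_pos[OF m] by (intro ennreal_mult[symmetric]) auto
  finally have le: "e \<le> Q * (energy_const m * real h powr a)"
    using Q0 energy_const_pos[OF m] by (subst (asm) ennreal_le_iff) auto
  have "e \<le> sup_const m * (energy_const m * real h powr a)\<^sup>2"
  proof (cases "e = 0")
    case False
    hence "e > 0" using e(2) by simp
    have "e\<^sup>2 \<le> (Q * (energy_const m * real h powr a))\<^sup>2" using le e(2) by (rule power_mono)
    also have "\<dots> = (sup_const m * e) * (energy_const m * real h powr a)\<^sup>2"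
      using sup_const_pos[of m] e by (simp add: Q_def power_mult_distrib)
    finally have "e * e \<le> e * (sup_const m * (energy_const m * real h powr a)\<^sup>2)"
      by (simp add: power2_eq_square mult_ac)
    thus ?thesis using \<open>e > 0\<close> by (simp only: mult_le_cancel_left_pos)
  qed (use sup_const_pos[of m] in simp)
  also have "\<dots> = sup_const m * (energy_const m)\<^sup>2 * real h powr \<kappa>"
    using h1 by (simp add: power_mult_distrib powr_real_power2 \<kappa>_eq)
  finally show ?thesis unfolding e(1) by (rule ennreal_leI)
qed

text \<open>At i h each row with c = 0 contributes exactly exp (-2 pi), so these terms cannot
  cancel. The other rows add up to at most half of one such term, by the assumption on N.\<close>

lemma poincare_lower:
  assumes small: "lattice_const a * real N powr (- a) \<le> exp (- (2 * pi)) / 2"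
  defines "\<tau> \<equiv> Complex 0 (real h)"
  shows "cmod (poincare \<tau>) \<ge> exp (- (2 * pi)) / 2"
proof -
  have \<tau>: "Im \<tau> = real h" "Re \<tau> = 0" by (simp_all add: \<tau>_def)
  have h1: "real h \<ge> 1" using h by simp
  have \<tau>0: "Im \<tau> > 0" using h \<tau> by simp
  define R0 R1 where "R0 = {r\<in>rows. fst r = 0}" and "R1 = {r\<in>rows. fst r \<noteq> 0}"
  have R: "rows = R0 \<union> R1" "R0 \<inter> R1 = {}" by (auto simp: R0_def R1_def)
  have finR0: "finite R0"
  proof -
    have "R0 \<subseteq> {(0, 1), (0, -1)}"
    proof
      fix r assume "r \<in> R0"
      then obtain A where A: "A \<in> \<Gamma>" "r = bottom_row A" "A$2$1 = 0" by (auto simp: R0_def rows_def bottom_row_def)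
      hence "A$1$1 * A$2$2 = 1" using in_SL2Z[OF A(1)] by (simp add: SL2Z_iff)
      hence "A$2$2 = 1 \<or> A$2$2 = -1" by (auto simp: zmult_eq_1_iff)
      thus "r \<in> {(0, 1), (0, -1)}" using A by (auto simp: bottom_row_def)
    qed
    thus ?thesis by (rule finite_subset) simp
  qed
  have sum: "(\<lambda>r. cmod (pterm (lift r) \<tau>)) summable_on rows" by (rule pterm_summable[OF \<tau>0])
  have abs1: "(\<lambda>r. cmod (pterm (lift r) \<tau>)) summable_on R1"
    using summable_on_subset_banach[OF sum, of R1] R by blast
  have s0: "(\<lambda>r. pterm (lift r) \<tau>) summable_on R0" and s1: "(\<lambda>r. pterm (lift r) \<tau>) summable_on R1"
    using summable_on_subset_banach[OF abs_summable_summable[OF sum]] R by blast+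
  have "poincare \<tau> = (\<Sum>\<^sub>\<infinity>r\<in>R0. pterm (lift r) \<tau>) + (\<Sum>\<^sub>\<infinity>r\<in>R1. pterm (lift r) \<tau>)"
    using \<tau>0 infsum_Un_disjoint[OF s0 s1 R(2)] by (simp add: poincare_def R(1))
  moreover have "(\<Sum>\<^sub>\<infinity>r\<in>R0. pterm (lift r) \<tau>) = of_nat (card R0) * of_real (exp (- (2 * pi)))"
  proof -
    have "pterm (lift r) \<tau> = of_real (exp (- (2 * pi)))" if "r \<in> R0" for r
    proof -
      have r: "r \<in> rows" "fst r = 0" using that by (auto simp: R0_def)
      have "fst (bottom_row (lift r)) = 0" using lift(2)[OF r(1)] r(2) by simp
      hence G: "lift r \<in> \<Gamma>" "lift r $ 2 $ 1 = 0" using lift(1)[OF r(1)] by (auto simp: bottom_row_def)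
      obtain n :: int where n: "moebius_action (lift r) \<tau> = \<tau> + of_int n * of_nat h"
        using unipotent_action[OF G] \<tau>0 by auto
      have "2 * of_real pi * \<i> * moebius_action (lift r) \<tau> / of_nat h = of_real (- (2 * pi)) + 2 * of_real pi * \<i> * of_int n"
        unfolding n using h by (simp add: \<tau>_def Complex_eq field_simps)
      moreover have "exp (2 * of_real pi * \<i> * of_int n) = 1"
        using exp_integer_2pi[of "of_int n"] by (simp add: mult_ac)
      ultimately have "exp (2 * of_real pi * \<i> * moebius_action (lift r) \<tau> / of_nat h) = exp (of_real (- (2 * pi)))"
        by (simp only: exp_add mult_1_right)
      thus ?thesis unfolding pterm_def using J_unipotent[OF G \<tau>0] by (simp only: exp_of_real div_by_1)
    qed
    hence "(\<Sum>\<^sub>\<infinity>r\<in>R0. pterm (lift r) \<tau>) = (\<Sum>\<^sub>\<infinity>r\<in>R0. of_real (exp (- (2 * pi))))"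
      by (intro infsum_cong) auto
    thus ?thesis using finR0 by simp
  qed
  moreover have "card R0 \<ge> 1"
  proof -
    have "bottom_row (mat 1) \<in> R0" using row_in_rows[OF one] by (simp add: R0_def bottom_row_def)
    thus ?thesis using finR0 by (metis One_nat_def Suc_leI card_gt_0_iff empty_iff)
  qed
  moreover have "cmod (\<Sum>\<^sub>\<infinity>r\<in>R1. pterm (lift r) \<tau>) \<le> exp (- (2 * pi)) / 2"
  proof -
    have "cmod (\<Sum>\<^sub>\<infinity>r\<in>R1. pterm (lift r) \<tau>) \<le> (\<Sum>\<^sub>\<infinity>r\<in>R1. cmod (pterm (lift r) \<tau>))"
      by (rule norm_infsum_bound[OF abs1])
    also have "\<dots> \<le> lattice_const a * (real N * Im \<tau>) powr (- a)"
    proof (rule infsum_le_finite_sums[OF abs1])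
      fix T assume T: "finite T" "T \<subseteq> R1"
      have "(\<Sum>r\<in>T. cmod (pterm (lift r) \<tau>)) \<le> (\<Sum>(c, d)\<in>T. cmod (of_int c * \<tau> + of_int d) powr (- (2 * a)))"
      proof (rule sum_mono)
        fix r assume "r \<in> T"
        hence r: "r \<in> rows" using T by (auto simp: R1_def)
        obtain c d where "r = (c, d)" by (cases r)
        thus "cmod (pterm (lift r) \<tau>) \<le> (case r of (c, d) \<Rightarrow> cmod (of_int c * \<tau> + of_int d) powr (- (2 * a)))"
          using norm_pterm_lift[OF r \<tau>0] poincare_majorant_le[OF \<tau>0, of "real h" a c d] h by simp
      qed
      also have "\<dots> \<le> lattice_const a * (real N * Im \<tau>) powr (- a)"
      proof (rule lattice_sum_le[OF a_gt_1 _ N T(1)])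
        fix c d assume "(c, d) \<in> T"
        hence "(c, d) \<in> rows" "c \<noteq> 0" using T by (auto simp: R1_def)
        thus "c \<noteq> 0 \<and> int N dvd c" using level by (auto simp: rows_def bottom_row_def)
      qed (use h1 \<tau> in simp)
      finally show "(\<Sum>r\<in>T. cmod (pterm (lift r) \<tau>)) \<le> \<dots>" .
    qed
    also have "\<dots> \<le> lattice_const a * real N powr (- a)"
    proof (intro mult_left_mono powr_mono2')
      have "real N * 1 \<le> real N * Im \<tau>" using h1 \<tau> by (intro mult_left_mono) auto
      thus "real N \<le> real N * Im \<tau>" by simp
    qed (use lattice_const_pos[OF a_gt_1] a_gt_1 N in auto)
    finally show ?thesis using small by linarith
  qed
  moreover have "cmod (x + y) \<ge> cmod x - cmod y" for x y :: complex
    using norm_diff_ineq by blast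
  ultimately have "cmod (poincare \<tau>) \<ge> cmod (of_nat (card R0) * of_real (exp (- (2 * pi)))) - exp (- (2 * pi)) / 2"
    by (smt (verit))
  moreover have "cmod (of_nat (card R0) * of_real (exp (- (2 * pi)))) \<ge> 1 * exp (- (2 * pi))"
    unfolding norm_mult using \<open>card R0 \<ge> 1\<close> by (intro mult_mono) auto
  ultimately show ?thesis by linarith
qed

text \<open>Both the lower bound for |P|^2 Im^\<kappa> at i h and the upper bound for the energy are
  constants times h^\<kappa>, so their quotient is free of h.\<close>

theorem lower_const_le_basis_sup:
  assumes small: "lattice_const (real m / 4) * real N powr (- (real m / 4)) \<le> exp (- (2 * pi)) / 2"
    and B: "orthonormal_basis (real m / 2) \<Gamma> (cusp_forms (real m / 2) \<Gamma> J) B"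
  shows "ennreal ((exp (- (2 * pi)) / 2)\<^sup>2 / (sup_const m * (energy_const m)\<^sup>2)) \<le> basis_sup (real m / 2) B"
proof -
  define \<tau> where "\<tau> = Complex 0 (real h)"
  define e where "e = sup_const m * (energy_const m)\<^sup>2 * real h powr \<kappa>"
  have \<tau>: "Im \<tau> > 0" using h by (simp add: \<tau>_def)
  have e: "e > 0" using sup_const_pos[of m] energy_const_pos[OF m] h by (simp add: e_def)
  have "cmod (poincare \<tau>) \<ge> exp (- (2 * pi)) / 2"
    unfolding \<tau>_def using small by (intro poincare_lower) (simp add: a_def)
  hence "(cmod (poincare \<tau>))\<^sup>2 \<ge> (exp (- (2 * pi)) / 2)\<^sup>2" by (intro power_mono) auto
  hence "(exp (- (2 * pi)) / 2)\<^sup>2 * real h powr \<kappa> \<le> invnorm \<kappa> poincare \<tau>"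
    by (simp add: invnorm_def \<tau>_def mult_right_mono del: power_divide)
  hence "(exp (- (2 * pi)) / 2)\<^sup>2 * real h powr \<kappa> / e \<le> invnorm \<kappa> poincare \<tau> / e"
    using e by (intro divide_right_mono) auto
  moreover have "(exp (- (2 * pi)) / 2)\<^sup>2 * real h powr \<kappa> / e = (exp (- (2 * pi)) / 2)\<^sup>2 / (sup_const m * (energy_const m)\<^sup>2)"
    using h by (simp add: e_def)
  ultimately have "ennreal ((exp (- (2 * pi)) / 2)\<^sup>2 / (sup_const m * (energy_const m)\<^sup>2)) \<le> ennreal (invnorm \<kappa> poincare \<tau> / e)"
    by (intro ennreal_leI) simp
  also have "\<dots> \<le> basis_sup (real m / 2) B"
    using basis_sup_ge[OF B refl _ _ \<tau> e, of poincare] cusp_forms_weak poincare_cusp_form energy_poincare_le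
    by (simp add: e_def \<kappa>_def)
  finally show ?thesis .
qed

end

section \<open>Poisson summation for Gaussians\<close>

lemma sum_symmetric_int_Suc:
  fixes f :: "int \<Rightarrow> 'a::comm_monoid_add"
  shows "(\<Sum>n\<in>{- int (Suc K)..int (Suc K)}. f n) = f (- int (Suc K)) + (\<Sum>n\<in>{- int K..int K}. f n) + f (int (Suc K))"
proof -
  have "{- int (Suc K)..int (Suc K)} = insert (- int (Suc K)) (insert (int (Suc K)) {- int K..int K})" by auto
  thus ?thesis by (simp add: add_ac)
qed

text \<open>Telescoping controls symmetric partial sums only; this links them to unordered sums over
  the integers.\<close>

lemma filterlim_symmetric_int:
  "filterlim (\<lambda>K. {- int K..int K}) (finite_subsets_at_top UNIV) sequentially"
  unfolding filterlim_finite_subsets_at_top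
proof (intro allI impI)
  fix X :: "int set" assume X: "finite X \<and> X \<subseteq> UNIV"
  define N where "N = nat (Max (insert 0 (abs ` X)))"
  have *: "X \<subseteq> {- int K..int K}" if "K \<ge> N" for K
  proof
    fix x assume "x \<in> X"
    hence "\<bar>x\<bar> \<le> Max (insert 0 (abs ` X))" using X by (intro Max_ge) auto
    also have "\<dots> \<le> int K" using that unfolding N_def by linarith
    finally show "x \<in> {- int K..int K}" by auto
  qed
  thus "\<forall>\<^sub>F K in sequentially. finite {- int K..int K} \<and> X \<subseteq> {- int K..int K} \<and> {- int K..int K} \<subseteq> UNIV"
    by (intro eventually_mono[OF eventually_ge_at_top[of N]]) (use * in auto)
qed

lemma has_sum_symmetric_int:
  "(f has_sum s) (UNIV :: int set) \<Longrightarrow> (\<lambda>K. \<Sum>n\<in>{- int K..int K}. f n) \<longlonglongrightarrow> s"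
  unfolding has_sum_def using filterlim_compose[OF _ filterlim_symmetric_int] by blast

text \<open>The character e(-k w), with complex argument so that derivatives along the real line
  come from holomorphic functions.\<close>

definition fexp :: "int \<Rightarrow> complex \<Rightarrow> complex" where
  "fexp k w = exp (- (2 * of_real pi * \<i> * of_int k * w))"

lemma fexp_add: "fexp k (x + y) = fexp k x * fexp k y"
  by (simp add: fexp_def ring_distribs exp_diff exp_minus field_simps exp_add)

lemma fexp_of_int [simp]: "fexp k (of_int n) = 1"
  using exp_integer_2pi[of "of_int (- (k * n))"] by (simp add: fexp_def mult_ac)

lemma norm_fexp_real [simp]: "cmod (fexp k (of_real x)) = 1"
  by (simp add: fexp_def norm_exp_eq_Re)

lemma fexp_derivative:
  "((\<lambda>w. fexp k w) has_field_derivative (- (2 * of_real pi * \<i> * of_int k)) * fexp k z) (at z within S)"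
  unfolding fexp_def by (auto intro!: derivative_eq_intros)

lemma fexp_shift: "fexp (k - 1) w = fexp k w * exp (2 * of_real pi * \<i> * w)"
  unfolding fexp_def exp_add[symmetric] by (simp add: algebra_simps)

lemma continuous_on_fexp [continuous_intros]: "continuous_on S f \<Longrightarrow> continuous_on S (\<lambda>x. fexp k (f x))"
  unfolding fexp_def by (intro continuous_intros)

lemma integral_fexp:
  "integral {-1/2..1/2} (\<lambda>x. fexp k (of_real x)) = (if k = 0 then 1 else 0)"
proof (cases "k = 0")
  case True
  thus ?thesis by (simp add: fexp_def)
next
  case False
  define c where "c = - (2 * of_real pi * \<i> * of_int k)"
  have c: "c \<noteq> 0" using False by (simp add: c_def)
  have "((\<lambda>x. fexp k (of_real x)) has_integral (fexp k (of_real (1/2)) / c - fexp k (of_real (-1/2)) / c)) {-1/2..1/2::real}"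
  proof (rule fundamental_theorem_of_calculus)
    fix x :: real
    have "((\<lambda>w. fexp k w / c) has_field_derivative fexp k (of_real x)) (at (of_real x))"
      using DERIV_cdivide[OF fexp_derivative[of k "of_real x" UNIV], of c] c by (simp add: c_def)
    thus "((\<lambda>x. fexp k (of_real x) / c) has_vector_derivative fexp k (of_real x)) (at x within {-1/2..1/2})"
      using has_vector_derivative_real_field by blast
  qed simp
  moreover have "fexp k (of_real (1/2)) = fexp k (of_real (-1/2))"
    using fexp_add[of k "of_real (-1/2)" "of_int 1"] fexp_of_int[of k 1] by simp
  ultimately show ?thesis using False by (simp add: integral_unique)
qed

text \<open>Chernoff's argument: \<open>(F x - F 0) / (exp (2 \<pi> i x) - 1)\<close> is again smooth, and the Fourier
  coefficients of \<open>F - F 0\<close> are the differences of its Fourier coefficients, so that their sum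
  telescopes.\<close>

lemma fourier_series_at_0:
  assumes F: "F holomorphic_on UNIV"
  shows "(\<lambda>K. \<Sum>k\<in>{- int K..int K}. integral {-1/2..1/2} (\<lambda>x. F (of_real x) * fexp k (of_real x))) \<longlonglongrightarrow> F 0"
proof -
  \<comment> \<open>P and Q are the difference quotients at 0 of F and of exp (2 pi i w), with the
    singularity filled in. In the unit disc Q has no zeros, as exp (2 pi i w) = 1 holds only at the
    integers; so E = P/Q is a holomorphic version of (F - F 0)/(exp (2 pi i w) - 1).\<close>
  define P where "P = (\<lambda>w. if w = 0 then deriv F 0 else (F w - F 0) / (w - 0))"
  define ex where "ex = (\<lambda>w. exp (2 * of_real pi * \<i> * w))"
  define Q where "Q = (\<lambda>w. if w = 0 then deriv ex 0 else (ex w - ex 0) / (w - 0))"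
  have ex: "ex holomorphic_on UNIV" unfolding ex_def by (intro holomorphic_intros)
  have P: "P holomorphic_on UNIV" unfolding P_def by (rule pole_lemma[OF F]) simp
  have Q: "Q holomorphic_on UNIV" unfolding Q_def by (rule pole_lemma[OF ex]) simp
  have "(ex has_field_derivative (2 * of_real pi * \<i>)) (at 0)"
    unfolding ex_def by (auto intro!: derivative_eq_intros)
  hence dex: "deriv ex 0 = 2 * of_real pi * \<i>" by (rule DERIV_imp_deriv)
  have Q0: "Q w \<noteq> 0" if w: "w \<in> ball 0 1" for w
  proof
    assume Qw: "Q w = 0"
    hence wne: "w \<noteq> 0" by (auto simp: Q_def dex)
    with Qw have "ex w = 1" by (simp add: Q_def ex_def)
    then obtain n :: int where n: "Re (2 * of_real pi * \<i> * w) = 0" "Im (2 * of_real pi * \<i> * w) = of_int (2 * n) * pi"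
      unfolding ex_def exp_eq_1 by blast
    hence "Im w = 0" "Re w = of_int n" by auto
    moreover have "\<bar>Re w\<bar> < 1" using w abs_Re_le_cmod[of w] by simp
    ultimately have "w = 0" by (auto simp: complex_eq_iff)
    thus False using wne by simp
  qed
  define E where "E = (\<lambda>w. P w / Q w)"
  have E: "E holomorphic_on ball 0 1"
    unfolding E_def using Q0 by (intro holomorphic_on_divide holomorphic_on_subset[OF P] holomorphic_on_subset[OF Q]) auto
  have Eeq: "E w * (ex w - 1) = F w - F 0" if "w \<in> ball 0 1" for w
    using Q0[OF that] by (cases "w = 0") (auto simp: E_def P_def Q_def ex_def)
  define I where "I = {-1/2..1/2::real}"
  have IB: "complex_of_real x \<in> ball 0 1" if "x \<in> I" for x using that by (auto simp: I_def)
  have cI: "continuous_on I (\<lambda>x. f (of_real x))" if "f holomorphic_on ball 0 1" for f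
    by (rule continuous_on_compose2[OF holomorphic_on_imp_continuous_on[OF that]])
       (use IB in \<open>auto intro!: continuous_intros\<close>)
  have int: "(\<lambda>x. f (of_real x) * fexp k (of_real x)) integrable_on I" if "f holomorphic_on ball 0 1" for f k
    unfolding I_def by (intro integrable_continuous_interval continuous_intros cI[OF that, unfolded I_def])
  define Eh where "Eh = (\<lambda>k. integral I (\<lambda>x. E (of_real x) * fexp k (of_real x)))"
  have FB: "F holomorphic_on ball 0 1" by (rule holomorphic_on_subset[OF F]) simp
  \<comment> \<open>On the disc F = E (ex - 1) + F 0, and multiplication by ex lowers the frequency
    by one.\<close>
  have coeff: "integral I (\<lambda>x. F (of_real x) * fexp k (of_real x)) = (Eh (k - 1) - Eh k) + (if k = 0 then F 0 else 0)" for k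
  proof -
    have "integral I (\<lambda>x. F (of_real x) * fexp k (of_real x))
       = integral I (\<lambda>x. (E (of_real x) * fexp (k - 1) (of_real x) - E (of_real x) * fexp k (of_real x)) + F 0 * fexp k (of_real x))"
    proof (intro integral_cong)
      fix x assume "x \<in> I"
      hence *: "F (of_real x) = E (of_real x) * (ex (of_real x) - 1) + F 0" using Eeq[OF IB] by simp
      thus "F (of_real x) * fexp k (of_real x) = (E (of_real x) * fexp (k - 1) (of_real x) - E (of_real x) * fexp k (of_real x)) + F 0 * fexp k (of_real x)"
        unfolding * fexp_shift ex_def by algebra
    qed
    also have "\<dots> = (Eh (k - 1) - Eh k) + F 0 * integral I (\<lambda>x. fexp k (of_real x))"
      unfolding Eh_def using int[OF E] int[of "\<lambda>_. F 0" k]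
      by (simp add: integral_add integral_diff integrable_diff)
    finally show ?thesis using integral_fexp[of k] by (simp add: I_def)
  qed
  define G where "G = (\<lambda>k. integral I (\<lambda>x. F (of_real x) * fexp k (of_real x)))"
  have G: "G k = (Eh (k - 1) - Eh k) + (if k = 0 then F 0 else 0)" for k
    unfolding G_def by (rule coeff)
  have sum: "(\<Sum>k\<in>{- int K..int K}. G k) = F 0 + (Eh (- int K - 1) - Eh (int K))" for K
  proof (induction K)
    case 0
    thus ?case by (simp add: G)
  next
    case (Suc K)
    have "- int (Suc K) = - int K - 1" "int (Suc K) - 1 = int K" by simp_all
    hence e: "Eh (- int (Suc K)) = Eh (- int K - 1)" "Eh (int (Suc K) - 1) = Eh (int K)" by (simp_all only:)
    have "(\<Sum>k\<in>{- int (Suc K)..int (Suc K)}. G k) = G (- int (Suc K)) + (F 0 + (Eh (- int K - 1) - Eh (int K))) + G (int (Suc K))"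
      by (simp only: sum_symmetric_int_Suc Suc)
    also have "G (- int (Suc K)) = Eh (- int (Suc K) - 1) - Eh (- int K - 1)"
      unfolding e(1)[symmetric] G by (simp del: of_nat_Suc)
    also have "G (int (Suc K)) = Eh (int K) - Eh (int (Suc K))"
      unfolding e(2)[symmetric] G by (simp del: of_nat_Suc)
    finally show ?case by algebra
  qed
  \<comment> \<open>One integration by parts. E need not have period 1, hence the boundary terms,
    which account for 2 * B1; the factor 2 pi of the derivative is given away.\<close>
  obtain C where C: "\<And>k. k \<noteq> 0 \<Longrightarrow> cmod (Eh k) \<le> C / \<bar>of_int k\<bar>"
  proof -
    have dE: "deriv E holomorphic_on ball 0 1" using E by (intro holomorphic_deriv) auto
    have bnd: "\<exists>B. \<forall>x\<in>I. cmod (f (of_real x)) \<le> B" if "f holomorphic_on ball 0 1" for f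
    proof -
      have "compact ((\<lambda>x. f (of_real x)) ` I)" by (intro compact_continuous_image cI that) (simp add: I_def)
      from compact_imp_bounded[OF this] obtain B where "\<forall>y\<in>(\<lambda>x. f (of_real x)) ` I. cmod y \<le> B"
        unfolding bounded_iff by (elim exE)
      thus ?thesis by (intro exI[of _ B]) simp
    qed
    obtain B1 where B1: "\<forall>x\<in>I. cmod (E (of_real x)) \<le> B1" using bnd[OF E] by (elim exE)
    obtain B2 where B2: "\<forall>x\<in>I. cmod (deriv E (of_real x)) \<le> B2" using bnd[OF dE] by (elim exE)
    show ?thesis
    proof (rule that[of "(2 * B1 + B2)"])
      fix k :: int assume k: "k \<noteq> 0"
      define c where "c = - (2 * of_real pi * \<i> * of_int k)"
      have der: "((\<lambda>x. E (of_real x) * fexp k (of_real x)) has_vector_derivative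
          (deriv E (of_real x) * fexp k (of_real x) + c * (E (of_real x) * fexp k (of_real x)))) (at x within I)" if "x \<in> I" for x
      proof -
        have "(E has_field_derivative deriv E (of_real x)) (at (of_real x))"
          using E IB[OF that] by (intro holomorphic_derivI) auto
        from DERIV_mult[OF this fexp_derivative[of k]]
        have "((\<lambda>w. E w * fexp k w) has_field_derivative (deriv E (of_real x) * fexp k (of_real x) + c * (E (of_real x) * fexp k (of_real x)))) (at (of_real x))"
          by (simp add: c_def algebra_simps)
        thus ?thesis using has_vector_derivative_real_field by blast
      qed
      have "((\<lambda>x. deriv E (of_real x) * fexp k (of_real x) + c * (E (of_real x) * fexp k (of_real x))) has_integral
         (E (of_real (1/2)) * fexp k (of_real (1/2)) - E (of_real (-1/2)) * fexp k (of_real (-1/2)))) {-1/2..1/2}"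
        using der unfolding I_def by (intro fundamental_theorem_of_calculus) auto
      hence "integral I (\<lambda>x. deriv E (of_real x) * fexp k (of_real x) + c * (E (of_real x) * fexp k (of_real x)))
         = E (of_real (1/2)) * fexp k (of_real (1/2)) - E (of_real (-1/2)) * fexp k (of_real (-1/2))"
        unfolding I_def by (rule integral_unique)
      moreover have "integral I (\<lambda>x. deriv E (of_real x) * fexp k (of_real x) + c * (E (of_real x) * fexp k (of_real x)))
         = integral I (\<lambda>x. deriv E (of_real x) * fexp k (of_real x)) + c * Eh k"
        unfolding Eh_def using int[OF E, of k] int[OF dE, of k] by (subst integral_add) (auto intro: integrable_on_mult_right)
      ultimately have "c * Eh k = E (of_real (1/2)) * fexp k (of_real (1/2)) - E (of_real (-1/2)) * fexp k (of_real (-1/2))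
          - integral I (\<lambda>x. deriv E (of_real x) * fexp k (of_real x))" by (simp add: algebra_simps)
      moreover have "cmod (x - y - z) \<le> cmod x + cmod y + cmod z" for x y z :: complex
        using norm_triangle_ineq4[of "x - y" z] norm_triangle_ineq4[of x y] by linarith
      ultimately have "cmod (c * Eh k) \<le> cmod (E (of_real (1/2)) * fexp k (of_real (1/2))) + cmod (E (of_real (-1/2)) * fexp k (of_real (-1/2)))
          + cmod (integral I (\<lambda>x. deriv E (of_real x) * fexp k (of_real x)))"
        by simp
      moreover have "cmod (integral I (\<lambda>x. deriv E (of_real x) * fexp k (of_real x))) \<le> B2 * (1/2 - (-1/2))"
        unfolding I_def
      proof (rule integral_bound)
        show "continuous_on {-1/2..1/2} (\<lambda>x. deriv E (of_real x) * fexp k (of_real x))"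
          by (intro continuous_intros cI[OF dE, unfolded I_def])
        show "cmod (deriv E (of_real x) * fexp k (of_real x)) \<le> B2" if "x \<in> {-1/2..1/2}" for x
          using bspec[OF B2, of x] that unfolding norm_mult norm_fexp_real by (simp add: I_def)
      qed simp
      moreover have "cmod (E (of_real (1/2)) * fexp k (of_real (1/2))) \<le> B1"
        using bspec[OF B1, of "1/2"] unfolding norm_mult norm_fexp_real by (simp add: I_def)
      moreover have "cmod (E (of_real (-1/2)) * fexp k (of_real (-1/2))) \<le> B1"
        using bspec[OF B1, of "-1/2"] unfolding norm_mult norm_fexp_real by (simp add: I_def)
      moreover have "n \<le> 2 * B1 + B2" if "n \<le> u + v + w" "w \<le> B2 * (1/2 - (-1/2))" "u \<le> B1" "v \<le> B1" for n u v w :: real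
        using that by simp
      ultimately have "cmod (c * Eh k) \<le> 2 * B1 + B2" by blast
      moreover have "1 * (\<bar>real_of_int k\<bar> * cmod (Eh k)) \<le> (2 * pi) * (\<bar>real_of_int k\<bar> * cmod (Eh k))"
        using pi_ge_two by (intro mult_right_mono) auto
      ultimately have "\<bar>real_of_int k\<bar> * cmod (Eh k) \<le> 2 * B1 + B2"
        by (simp add: c_def norm_mult)
      thus "cmod (Eh k) \<le> (2 * B1 + B2) / \<bar>of_int k\<bar>" using k by (simp add: field_simps)
    qed
  qed
  have "(\<lambda>K. Eh (- int K - 1)) \<longlonglongrightarrow> 0"
  proof (rule Lim_null_comparison)
    show "\<forall>\<^sub>F K in sequentially. norm (Eh (- int K - 1)) \<le> C / \<bar>of_int (- int K - 1)\<bar>" by (intro always_eventually allI C) auto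
    show "(\<lambda>K. C / \<bar>of_int (- int K - 1)\<bar>) \<longlonglongrightarrow> 0" by real_asymp
  qed
  moreover have "(\<lambda>K. Eh (int K)) \<longlonglongrightarrow> 0"
  proof (rule Lim_null_comparison)
    show "\<forall>\<^sub>F K in sequentially. norm (Eh (int K)) \<le> C / \<bar>of_int (int K)\<bar>"
      using eventually_gt_at_top[of 0] by eventually_elim (intro C, auto)
    show "(\<lambda>K. C / \<bar>of_int (int K)\<bar>) \<longlonglongrightarrow> 0" by real_asymp
  qed
  ultimately have "(\<lambda>K. F 0 + (Eh (- int K - 1) - Eh (int K))) \<longlonglongrightarrow> F 0 + (0 - 0)"
    by (intro tendsto_intros)
  thus ?thesis unfolding sum[symmetric] by (simp add: I_def G_def)
qed

text \<open>The characteristic function of the standard normal distribution, after a linear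
  substitution.\<close>

lemma gaussian_fourier:
  fixes t :: real and k :: int
  assumes t: "t > 0"
  shows "integrable lborel (\<lambda>y. of_real (exp (- pi * t * y\<^sup>2)) * fexp k (of_real y))"
    and "(LINT y|lborel. of_real (exp (- pi * t * y\<^sup>2)) * fexp k (of_real y)) = of_real (exp (- pi * (of_int k)\<^sup>2 / t) / sqrt t)"
proof -
  \<comment> \<open>Chosen so that (c y)^2 / 2 = pi t y^2; then s is the frequency with s c = -2 pi
    k.\<close>
  define c where "c = sqrt (2 * pi * t)"
  have c: "c > 0" "c\<^sup>2 = 2 * pi * t" using t by (simp_all add: c_def)
  define s where "s = - (2 * pi * of_int k) / c"
  define g where "g = (\<lambda>y::real. complex_of_real (exp (- pi * t * y\<^sup>2)) * fexp k (of_real y))"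
  have "of_real (exp (- (s\<^sup>2) / 2)) = char std_normal_distribution s" by (simp add: char_std_normal_distribution)
  also have "\<dots> = (LINT x|lborel. std_normal_density x *\<^sub>R iexp (s * x))"
    unfolding char_def by (subst integral_density) auto
  also have "\<dots> = \<bar>c\<bar> *\<^sub>R (LINT y|lborel. std_normal_density (0 + c * y) *\<^sub>R iexp (s * (0 + c * y)))"
    using c by (intro lborel_integral_real_affine) auto
  also have "(\<lambda>y. std_normal_density (0 + c * y) *\<^sub>R iexp (s * (0 + c * y))) = (\<lambda>y. complex_of_real (1 / sqrt (2 * pi)) * g y)"
  proof
    fix y :: real
    have "(c * y)\<^sup>2 / 2 = pi * t * y\<^sup>2" by (simp add: power_mult_distrib c)
    moreover have "s * (c * y) = - (2 * pi * of_int k * y)" using c by (simp add: s_def)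
    ultimately show "std_normal_density (0 + c * y) *\<^sub>R iexp (s * (0 + c * y)) = complex_of_real (1 / sqrt (2 * pi)) * g y"
      by (simp add: std_normal_density_def g_def fexp_def scaleR_conv_of_real mult_ac)
  qed
  also have "\<bar>c\<bar> *\<^sub>R (LINT y|lborel. complex_of_real (1 / sqrt (2 * pi)) * g y) = of_real (sqrt t) * (LINT y|lborel. g y)"
    using c by (simp add: scaleR_conv_of_real c_def real_sqrt_mult)
  finally have eq: "of_real (sqrt t) * (LINT y|lborel. g y) = of_real (exp (- (s\<^sup>2) / 2))" ..
  have "s\<^sup>2 / 2 = pi * (of_int k)\<^sup>2 / t" using t c pi_gt_zero by (simp add: s_def power_divide power_mult_distrib power2_eq_square)
  hence "of_real (sqrt t) * (LINT y|lborel. g y) = of_real (exp (- pi * (of_int k)\<^sup>2 / t))" using eq by simp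
  thus val: "(LINT y|lborel. of_real (exp (- pi * t * y\<^sup>2)) * fexp k (of_real y)) = of_real (exp (- pi * (of_int k)\<^sup>2 / t) / sqrt t)"
    using t by (simp add: g_def field_simps)
  \<comment> \<open>The Bochner integral of a function that is not integrable is 0, whereas the
    value just found is positive.\<close>
  show "integrable lborel (\<lambda>y. of_real (exp (- pi * t * y\<^sup>2)) * fexp k (of_real y))"
  proof (rule ccontr)
    assume "\<not> ?thesis"
    hence "(LINT y|lborel. of_real (exp (- pi * t * y\<^sup>2)) * fexp k (of_real y)) = 0" by (rule not_integrable_integral_eq)
    hence "exp (- pi * (of_int k)\<^sup>2 / t) / sqrt t = 0" unfolding val by (simp only: of_real_eq_0_iff)
    thus False using t by simp
  qed
qed

lemma sum_powers_le:
  assumes r: "0 \<le> r" "r < (1::real)" and Y: "finite Y" "Y \<subseteq> {1..}"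
  shows "(\<Sum>n\<in>Y. r ^ n) \<le> r / (1 - r)"
proof -
  have "(\<Sum>n\<in>Y. r ^ n) = r * (\<Sum>n\<in>Y. r ^ (n - 1))"
    unfolding sum_distrib_left using Y by (intro sum.cong refl) (metis atLeast_iff subsetD power_Suc Suc_pred' less_eq_Suc_le One_nat_def)
  also have "(\<Sum>n\<in>Y. r ^ (n - 1)) = (\<Sum>n\<in>(\<lambda>n. n - 1) ` Y. r ^ n)"
  proof (subst sum.reindex)
    show "inj_on (\<lambda>n. n - 1) Y"
    proof (rule inj_onI)
      fix x y assume "x \<in> Y" "y \<in> Y" "x - 1 = y - 1"
      moreover from this have "x \<ge> 1" "y \<ge> 1" using Y by auto
      ultimately show "x = y" by linarith
    qed
  qed simp
  also have "\<dots> \<le> (\<Sum>n. r ^ n)" using r Y by (intro sum_le_suminf summable_geometric) auto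
  also have "\<dots> = 1 / (1 - r)" using r by (intro suminf_geometric) auto
  finally show ?thesis using r by (simp add: mult_left_mono)
qed

text \<open>The exceptions are the integers from b + 1 to 0: with b = -1 only n = 0, with b = -2 the
  two equal leading terms n = -1, 0 of the theta constant with characteristic 1/2.\<close>

lemma sum_int_tails_le:
  fixes f :: "int \<Rightarrow> real"
  assumes r: "0 \<le> r" "r < 1" and c: "c \<ge> 0" and X: "finite X" "X \<subseteq> {1..} \<union> {..b}" and b: "b < 1"
    and pos: "\<And>n. n \<ge> 1 \<Longrightarrow> f n \<le> c * r ^ nat n" and neg: "\<And>n. n \<le> b \<Longrightarrow> f n \<le> c * r ^ nat (b + 1 - n)"
  shows "(\<Sum>n\<in>X. f n) \<le> 2 * (c * (r / (1 - r)))"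
proof -
  have part: "(\<Sum>n\<in>Y. f n) \<le> c * (r / (1 - r))" if Y: "Y \<subseteq> X" and inj: "inj_on g Y" and g: "\<And>n. n \<in> Y \<Longrightarrow> g n \<ge> 1 \<and> f n \<le> c * r ^ g n"
    for Y and g :: "int \<Rightarrow> nat"
  proof -
    have fin: "finite Y" using Y X finite_subset by blast
    have "(\<Sum>n\<in>Y. f n) \<le> (\<Sum>n\<in>Y. c * r ^ g n)" using g by (intro sum_mono) auto
    also have "\<dots> = c * (\<Sum>n\<in>g ` Y. r ^ n)" using inj by (simp add: sum.reindex sum_distrib_left)
    also have "\<dots> \<le> c * (r / (1 - r))" using r c fin g by (intro mult_left_mono sum_powers_le) auto
    finally show ?thesis .
  qed
  have "(\<Sum>n\<in>X. f n) = (\<Sum>n\<in>{n\<in>X. n \<ge> 1}. f n) + (\<Sum>n\<in>{n\<in>X. n \<le> b}. f n)"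
    using X b by (subst sum.union_disjoint[symmetric]) (auto intro!: sum.cong)
  also have "\<dots> \<le> c * (r / (1 - r)) + c * (r / (1 - r))"
    by (intro add_mono part[where g = nat] part[where g = "\<lambda>n. nat (b + 1 - n)"]) (auto simp: inj_on_def pos neg)
  finally show ?thesis by simp
qed

lemma summable_on_int_geometric:
  assumes "0 \<le> r" "r < (1::real)" shows "(\<lambda>n::int. c * r ^ nat \<bar>n\<bar>) summable_on UNIV"
proof -
  have "(\<lambda>n::int. r ^ nat \<bar>n\<bar>) summable_on UNIV"
  proof (rule nonneg_bdd_above_summable_on)
    have "(\<Sum>n\<in>X. r ^ nat \<bar>n\<bar>) \<le> 1 + 2 * (1 * (r / (1 - r)))" if X: "finite X" for X :: "int set"
    proof -
      have "(\<Sum>n\<in>X. r ^ nat \<bar>n\<bar>) \<le> (\<Sum>n\<in>insert 0 (X - {0}). r ^ nat \<bar>n\<bar>)"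
        using X assms by (intro sum_mono2) auto
      also have "\<dots> = 1 + (\<Sum>n\<in>X - {0}. r ^ nat \<bar>n\<bar>)" using X by (subst sum.insert) auto
      also have "(\<Sum>n\<in>X - {0}. r ^ nat \<bar>n\<bar>) \<le> 2 * (1 * (r / (1 - r)))"
        by (rule sum_int_tails_le[where b = "-1"]) (use assms X in auto)
      finally show ?thesis by simp
    qed
    thus "bdd_above (sum (\<lambda>n::int. r ^ nat \<bar>n\<bar>) ` {F. F \<subseteq> UNIV \<and> finite F})" by (intro bdd_aboveI) auto
  qed (use assms in auto)
  thus ?thesis by (rule summable_on_cmult_right)
qed

text \<open>The difference of (n + s)^2 and n^2/2 - s^2 is (n + 2 s)^2/2, and n^2 \<ge> |n| for
  integers. A linear exponent turns Gaussian sums into geometric ones.\<close>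

lemma shifted_square_ge: "(of_int n + s)\<^sup>2 \<ge> \<bar>of_int n\<bar> / 2 - (s::real)\<^sup>2"
proof -
  have "\<bar>n\<bar> * 1 \<le> \<bar>n\<bar> * \<bar>n\<bar>"
  proof (cases "n = 0")
    case False
    hence "1 \<le> \<bar>n\<bar>" by linarith
    thus ?thesis by (rule mult_left_mono) simp
  qed simp
  hence "\<bar>n\<bar> \<le> n\<^sup>2" by (simp add: power2_eq_square)
  hence "real_of_int \<bar>n\<bar> \<le> real_of_int (n\<^sup>2)" by (simp only: of_int_le_iff)
  hence "\<bar>real_of_int n\<bar> \<le> (of_int n)\<^sup>2" by simp
  moreover have "0 \<le> (of_int n + 2 * s)\<^sup>2" by simp
  ultimately show ?thesis by (simp add: power2_eq_square algebra_simps)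
qed

lemma exp_shifted_square_le:
  assumes d: "d > 0" and y: "y \<ge> d"
  shows "exp (- (pi * y * (of_int n + s)\<^sup>2)) \<le> exp (pi * d * s\<^sup>2) * exp (- (pi * d / 2)) ^ nat \<bar>n\<bar>"
proof -
  have "d * (\<bar>of_int n\<bar> / 2 - s\<^sup>2) \<le> d * (of_int n + s)\<^sup>2" using d shifted_square_ge by (intro mult_left_mono) auto
  also have "\<dots> \<le> y * (of_int n + s)\<^sup>2" using y by (intro mult_right_mono) auto
  finally have "pi * (d * (\<bar>of_int n\<bar> / 2 - s\<^sup>2)) \<le> pi * (y * (of_int n + s)\<^sup>2)" by (intro mult_left_mono) auto
  hence "exp (- (pi * y * (of_int n + s)\<^sup>2)) \<le> exp (pi * d * s\<^sup>2 + real (nat \<bar>n\<bar>) * (- (pi * d / 2)))"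
    by (simp add: algebra_simps)
  thus ?thesis by (simp only: exp_add exp_of_nat_mult)
qed

section \<open>Theta constants\<close>

text \<open>The Jacobi theta constants theta_3, theta_4 and theta_2 are the cases (0, 0), (0, 1/2)
  and (1/2, 0) of (s, u). Poisson summation exchanges the shift s with the character u.\<close>

definition jtheta :: "real \<Rightarrow> real \<Rightarrow> complex \<Rightarrow> complex" where
  "jtheta s u \<tau> = (\<Sum>\<^sub>\<infinity>n\<in>(UNIV::int set). exp (of_real pi * \<i> * \<tau> * (of_int n + of_real s)\<^sup>2 + 2 * of_real pi * \<i> * of_int n * of_real u))"

lemma norm_jtheta_term:
  "cmod (exp (of_real pi * \<i> * \<tau> * (of_int n + of_real s)\<^sup>2 + 2 * of_real pi * \<i> * of_int n * of_real u)) = exp (- (pi * Im \<tau> * (of_int n + s)\<^sup>2))"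
proof -
  have "of_real pi * \<i> * \<tau> * (of_int n + of_real s)\<^sup>2 = \<i> * \<tau> * of_real (pi * (of_int n + s)\<^sup>2)" by simp
  hence "Re (of_real pi * \<i> * \<tau> * (of_int n + of_real s)\<^sup>2 + 2 * of_real pi * \<i> * of_int n * of_real u) = - (pi * Im \<tau> * (of_int n + s)\<^sup>2)"
    by (simp del: of_real_mult of_real_power of_real_add)
  thus ?thesis by (simp only: norm_exp_eq_Re)
qed

lemma jtheta_abs_summable:
  assumes "Im \<tau> > 0"
  shows "(\<lambda>n::int. cmod (exp (of_real pi * \<i> * \<tau> * (of_int n + of_real s)\<^sup>2 + 2 * of_real pi * \<i> * of_int n * of_real u))) summable_on UNIV"
  unfolding norm_jtheta_term
proof (rule summable_on_comparison_test)
  show "(\<lambda>n::int. exp (pi * Im \<tau> * s\<^sup>2) * exp (- (pi * Im \<tau> / 2)) ^ nat \<bar>n\<bar>) summable_on UNIV"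
    using assms by (intro summable_on_int_geometric) auto
  show "exp (- (pi * Im \<tau> * (of_int n + s)\<^sup>2)) \<le> exp (pi * Im \<tau> * s\<^sup>2) * exp (- (pi * Im \<tau> / 2)) ^ nat \<bar>n\<bar>" for n :: int
    using assms by (intro exp_shifted_square_le) auto
qed auto

lemma jtheta_has_sum:
  assumes "Im \<tau> > 0"
  shows "((\<lambda>n::int. exp (of_real pi * \<i> * \<tau> * (of_int n + of_real s)\<^sup>2 + 2 * of_real pi * \<i> * of_int n * of_real u)) has_sum jtheta s u \<tau>) UNIV"
  unfolding jtheta_def using abs_summable_summable[OF jtheta_abs_summable[OF assms]] by (rule has_sum_infsum)

lemma holomorphic_jtheta: "jtheta s u holomorphic_on \<H>"
proof -
  have "(\<lambda>\<tau>. \<Sum>\<^sub>\<infinity>n\<in>(UNIV::int set). exp (of_real pi * \<i> * \<tau> * (of_int n + of_real s)\<^sup>2 + 2 * of_real pi * \<i> * of_int n * of_real u)) holomorphic_on \<H>"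
  proof (rule holomorphic_infsum[OF open_H])
    fix K assume K: "compact K" "K \<subseteq> \<H>"
    obtain d where d: "d > 0" "\<And>z. z \<in> K \<Longrightarrow> d \<le> Im z"
    proof (cases "K = {}")
      case True
      thus ?thesis using that[of 1] by auto
    next
      case False
      obtain z0 where "z0 \<in> K" "\<And>z. z \<in> K \<Longrightarrow> Im z0 \<le> Im z"
        using continuous_attains_inf[OF K(1) False continuous_on_Im[OF continuous_on_id]] by auto
      thus ?thesis using that[of "Im z0"] K(2) by auto
    qed
    define M where "M = (\<lambda>n::int. exp (pi * d * s\<^sup>2) * exp (- (pi * d / 2)) ^ nat \<bar>n\<bar>)"
    have "M summable_on UNIV" unfolding M_def using d by (intro summable_on_int_geometric) auto
    moreover have "cmod (exp (of_real pi * \<i> * \<tau> * (of_int n + of_real s)\<^sup>2 + 2 * of_real pi * \<i> * of_int n * of_real u)) \<le> M n"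
      if "\<tau> \<in> K" for \<tau> n
      unfolding norm_jtheta_term M_def using d that by (intro exp_shifted_square_le) auto
    ultimately show "\<exists>M. M summable_on UNIV \<and> (\<forall>n\<in>(UNIV::int set). \<forall>\<tau>\<in>K. cmod (exp (of_real pi * \<i> * \<tau> * (of_int n + of_real s)\<^sup>2 + 2 * of_real pi * \<i> * of_int n * of_real u)) \<le> M n)"
      by blast
  qed (intro holomorphic_intros)
  thus ?thesis unfolding jtheta_def[abs_def] .
qed

lemma periodised_gaussian:
  fixes t s :: real
  assumes t: "t > 0"
  defines "f \<equiv> (\<lambda>n::int. \<lambda>w::complex. exp (- (of_real (pi * t) * (w + of_real s + of_int n)\<^sup>2)))"
  assumes K: "compact K"
  shows "\<exists>M. M summable_on UNIV \<and> (\<forall>n\<in>UNIV. \<forall>w\<in>K. cmod (f n w) \<le> M n)"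
proof -
  obtain R where R: "R > 0" "\<And>z. z \<in> K \<Longrightarrow> cmod z \<le> R"
    using compact_imp_bounded[OF K] by (auto simp: bounded_pos)
  define A where "A = (R + \<bar>s\<bar>)\<^sup>2"
  define M where "M = (\<lambda>n::int. exp (pi * t * (R\<^sup>2 + A)) * exp (- (pi * t / 2)) ^ nat \<bar>n\<bar>)"
  have "M summable_on UNIV" unfolding M_def using t by (intro summable_on_int_geometric) auto
  moreover have "cmod (f n w) \<le> M n" if w: "w \<in> K" for n w
  proof -
    define x y where "x = Re w" and "y = Im w"
    have xy: "\<bar>x\<bar> \<le> R" "\<bar>y\<bar> \<le> R"
      using abs_Re_le_cmod[of w] abs_Im_le_cmod[of w] R(2)[OF w] by (auto simp: x_def y_def)
    have y2: "y\<^sup>2 \<le> R\<^sup>2" using xy(2) R(1) by (simp add: abs_le_square_iff[symmetric])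
    have "\<bar>x + s\<bar> \<le> R + \<bar>s\<bar>" using xy by linarith
    hence s2: "(x + s)\<^sup>2 \<le> A" unfolding A_def using R(1) by (simp add: abs_le_square_iff[symmetric])
    have "Re ((w + of_real s + of_int n)\<^sup>2) = (of_int n + (x + s))\<^sup>2 - y\<^sup>2"
      by (simp add: x_def y_def Re_power2 algebra_simps)
    moreover have "Re (- (of_real (pi * t) * W)) = - (pi * t * Re W)" for W by simp
    ultimately have "cmod (f n w) = exp (- (pi * t * ((of_int n + (x + s))\<^sup>2 - y\<^sup>2)))"
      by (simp only: f_def norm_exp_eq_Re)
    also have "\<dots> \<le> exp (- (pi * t * (\<bar>of_int n\<bar> / 2 - A - R\<^sup>2)))"
    proof -
      have "pi * t * (\<bar>of_int n\<bar> / 2 - A - R\<^sup>2) \<le> pi * t * ((of_int n + (x + s))\<^sup>2 - y\<^sup>2)"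
        using shifted_square_ge[of n "x + s"] s2 y2 t by (intro mult_left_mono) auto
      thus ?thesis by (simp only: exp_le_cancel_iff neg_le_iff_le)
    qed
    also have "- (pi * t * (\<bar>of_int n\<bar> / 2 - A - R\<^sup>2)) = pi * t * (R\<^sup>2 + A) + real (nat \<bar>n\<bar>) * (- (pi * t / 2))"
      by (simp add: algebra_simps)
    also have "exp \<dots> = M n" by (simp only: M_def exp_add exp_of_nat_mult)
    finally show ?thesis .
  qed
  ultimately show ?thesis by blast
qed

text \<open>The unit intervals centred at -K, ..., K tile the interval on the right.\<close>

lemma integral_unfold_symmetric:
  fixes g :: "real \<Rightarrow> complex"
  assumes g: "continuous_on UNIV g"
  shows "(\<Sum>n\<in>{- int K..int K}. integral {-1/2..1/2} (\<lambda>x. g (x + of_int n))) = integral {- (real K + 1/2)..real K + 1/2} g"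
proof -
  have int: "g integrable_on {a..b}" for a b
    by (rule integrable_continuous_interval) (use g continuous_on_subset in blast)
  have sh: "integral {-1/2..1/2} (\<lambda>x. g (x + of_int n)) = integral {of_int n - 1/2..of_int n + 1/2} g" for n
    using integral_shift_Icc_real[of "-1/2" "1/2" g "of_int n"] by (simp add: o_def add.commute)
  show ?thesis
  proof (induction K)
    case 0
    show ?case using sh[of 0] by simp
  next
    case (Suc K)
    have "integral {- (real (Suc K) + 1/2)..real (Suc K) + 1/2} g
       = integral {- (real (Suc K) + 1/2)..- (real K + 1/2)} g + integral {- (real K + 1/2)..real (Suc K) + 1/2} g"
      by (rule Henstock_Kurzweil_Integration.integral_combine[symmetric]) (auto intro: int)
    also have "integral {- (real K + 1/2)..real (Suc K) + 1/2} g = integral {- (real K + 1/2)..real K + 1/2} g + integral {real K + 1/2..real (Suc K) + 1/2} g"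
      by (rule Henstock_Kurzweil_Integration.integral_combine[symmetric]) (auto intro: int)
    finally have *: "integral {- (real (Suc K) + 1/2)..real (Suc K) + 1/2} g
       = integral {- (real (Suc K) + 1/2)..- (real K + 1/2)} g + (integral {- (real K + 1/2)..real K + 1/2} g + integral {real K + 1/2..real (Suc K) + 1/2} g)" .
    have a: "of_int (- int (Suc K)) - 1/2 = - (real (Suc K) + 1/2)" "of_int (- int (Suc K)) + 1/2 = - (real K + 1/2)"
      "of_int (int (Suc K)) - 1/2 = real K + 1/2" "of_int (int (Suc K)) + 1/2 = real (Suc K) + 1/2" by simp_all
    show ?case unfolding * sum_symmetric_int_Suc Suc unfolding sh a by (simp only: add.assoc)
  qed
qed

text \<open>The left side is the value at 0 of the periodised Gaussian, so it is the limit of the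
  symmetric sums of its Fourier coefficients. By unfolding these are Fourier transforms of a shifted
  Gaussian, and their sum is absolutely convergent with the right side as value.\<close>

lemma poisson_gaussian:
  fixes t s :: real
  assumes t: "t > 0"
  shows "jtheta s 0 (\<i> * of_real t) = jtheta 0 s (\<i> * of_real (1 / t)) / of_real (sqrt t)"
proof -
  define f where "f = (\<lambda>n::int. \<lambda>w::complex. exp (- (of_real (pi * t) * (w + of_real s + of_int n)\<^sup>2)))"
  define F where "F = (\<lambda>w. \<Sum>\<^sub>\<infinity>n\<in>(UNIV::int set). f n w)"
  have maj: "\<exists>M. M summable_on UNIV \<and> (\<forall>n\<in>UNIV. \<forall>w\<in>K. cmod (f n w) \<le> M n)" if "compact K" for K
    unfolding f_def by (rule periodised_gaussian[OF t that])
  have F: "F holomorphic_on UNIV"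
    unfolding F_def by (rule holomorphic_infsum[OF open_UNIV _ maj]) (auto simp: f_def intro!: holomorphic_intros)
  have F0: "F 0 = jtheta s 0 (\<i> * of_real t)"
    unfolding F_def jtheta_def f_def by (intro infsum_cong) (simp add: add.commute mult_ac)
  define c where "c = (\<lambda>k::int. exp (of_real pi * \<i> * (\<i> * of_real (1 / t)) * (of_int k + of_real 0)\<^sup>2 + 2 * of_real pi * \<i> * of_int k * of_real s))"
  have coeff: "integral {-1/2..1/2} (\<lambda>x. F (of_real x) * fexp k (of_real x)) = c k / of_real (sqrt t)" for k
  proof -
    define g where "g = (\<lambda>y::real. f 0 (of_real y) * fexp k (of_real y))"
    have fg: "f n (of_real x) * fexp k (of_real x) = g (x + of_int n)" for n x
    proof -
      have "fexp k (of_real x + of_int n) = fexp k (of_real x)" by (simp only: fexp_add fexp_of_int mult_1_right)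
      moreover have "f 0 (of_real x + of_int n) = f n (of_real x)" by (simp add: f_def add_ac)
      ultimately show ?thesis by (simp only: g_def of_real_add of_real_of_int_eq)
    qed
    have gc: "continuous_on UNIV g" unfolding g_def f_def by (intro continuous_intros)
    define I where "I = {-1/2..1/2::real}"
    have "compact (complex_of_real ` I)" unfolding I_def by (intro compact_continuous_image continuous_intros) auto
    then obtain M where M: "M summable_on UNIV" "\<And>n x. x \<in> I \<Longrightarrow> cmod (f n (of_real x)) \<le> M n"
      using maj[of "complex_of_real ` I"] by blast
    have ul: "uniform_limit I (\<lambda>X x. \<Sum>n\<in>X. g (x + of_int n)) (\<lambda>x. \<Sum>\<^sub>\<infinity>n\<in>(UNIV::int set). g (x + of_int n)) (finite_subsets_at_top UNIV)"
      by (rule Weierstrass_m_test_general[OF _ M(1)]) (simp add: M(2) norm_mult flip: fg)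
    have sumF: "(\<Sum>\<^sub>\<infinity>n\<in>(UNIV::int set). g (x + of_int n)) = F (of_real x) * fexp k (of_real x)" for x
      unfolding fg[symmetric] F_def by (rule infsum_cmult_left')
    have gcn: "continuous_on I (\<lambda>x. g (x + of_int n))" for n
      by (rule continuous_on_compose2[OF gc]) (auto intro!: continuous_intros)
    \<comment> \<open>Uniform convergence on the period allows integration term by term; the limit
      over all finite sets is then restricted to symmetric ones.\<close>
    obtain S J where S: "\<And>X. ((\<lambda>x. \<Sum>n\<in>X. g (x + of_int n)) has_integral S X) I"
      and J: "((\<lambda>x. F (of_real x) * fexp k (of_real x)) has_integral J) I" and lim: "(S \<longlongrightarrow> J) (finite_subsets_at_top (UNIV :: int set))"
    proof (rule uniform_limit_integral[where a = "-1/2::real" and b = "1/2::real", folded I_def, OF ul[unfolded sumF]])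
      show "continuous_on I (\<lambda>x. \<Sum>n\<in>X. g (x + of_int n))" for X :: "int set" by (intro continuous_on_sum gcn)
    qed (use that in auto)
    have "S {- int K..int K} = integral {- (real K + 1/2)..real K + 1/2} g" for K
    proof -
      have "S {- int K..int K} = integral I (\<lambda>x. \<Sum>n\<in>{- int K..int K}. g (x + of_int n))"
        using S by (rule integral_unique[symmetric])
      also have "\<dots> = (\<Sum>n\<in>{- int K..int K}. integral I (\<lambda>x. g (x + of_int n)))"
        using gcn unfolding I_def by (intro integral_sum integrable_continuous_interval) auto
      also have "\<dots> = integral {- (real K + 1/2)..real K + 1/2} g" unfolding I_def by (rule integral_unfold_symmetric[OF gc])
      finally show ?thesis .
    qed
    hence lim1: "(\<lambda>K. integral {- (real K + 1/2)..real K + 1/2} g) \<longlonglongrightarrow> J"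
      using filterlim_compose[OF lim filterlim_symmetric_int] by simp
    define g0 where "g0 = (\<lambda>y::real. complex_of_real (exp (- pi * t * y\<^sup>2)) * fexp k (of_real y))"
    \<comment> \<open>The shift by s turns into the factor e(k s) of the Fourier transform.\<close>
    have gg0: "g y = fexp k (of_real (- s)) * g0 (s + 1 * y)" for y
    proof -
      have "fexp k (of_real y) = fexp k (of_real (- s)) * fexp k (of_real (s + y))"
        unfolding fexp_add[symmetric] by simp
      moreover have "f 0 (of_real y) = of_real (exp (- pi * t * (s + y)\<^sup>2))"
        by (simp add: f_def add.commute flip: exp_of_real)
      ultimately show ?thesis by (simp add: g_def g0_def)
    qed
    have ig0: "integrable lborel g0" unfolding g0_def by (rule gaussian_fourier(1)[OF t])
    have "integrable lborel (\<lambda>y. g0 (s + 1 * y))" using lborel_integrable_real_affine_iff[of 1 g0 s] ig0 by simp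
    hence ig: "integrable lborel g" unfolding gg0[abs_def] by (rule integrable_mult_right)
    have "(LINT y|lborel. g y) = fexp k (of_real (- s)) * (LINT y|lborel. g0 (s + 1 * y))"
      unfolding gg0 by (rule integral_mult_right_zero)
    also have "(LINT y|lborel. g0 (s + 1 * y)) = (LINT y|lborel. g0 y)"
      using lborel_integral_real_affine[of 1 g0 s] by simp
    also have "\<dots> = of_real (exp (- pi * (of_int k)\<^sup>2 / t) / sqrt t)"
      unfolding g0_def by (rule gaussian_fourier(2)[OF t])
    finally have "(LINT y|lborel. g y) = fexp k (of_real (- s)) * of_real (exp (- pi * (of_int k)\<^sup>2 / t) / sqrt t)" .
    have val: "(LINT y|lborel. g y) = c k / of_real (sqrt t)"
    proof -
      have "of_real pi * \<i> * (\<i> * of_real (1 / t)) * (of_int k + of_real 0)\<^sup>2 + 2 * of_real pi * \<i> * of_int k * of_real s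
         = of_real (- pi * (of_int k)\<^sup>2 / t) + (- (2 * of_real pi * \<i> * of_int k * of_real (- s)))"
        by (simp add: field_simps)
      hence "c k = exp (of_real (- pi * (of_int k)\<^sup>2 / t) + (- (2 * of_real pi * \<i> * of_int k * of_real (- s))))"
        by (simp only: c_def)
      hence "c k = of_real (exp (- pi * (of_int k)\<^sup>2 / t)) * fexp k (of_real (- s))"
        by (simp only: fexp_def exp_add exp_of_real)
      thus ?thesis using \<open>(LINT y|lborel. g y) = fexp k (of_real (- s)) * of_real (exp (- pi * (of_int k)\<^sup>2 / t) / sqrt t)\<close>
        by simp
    qed
    \<comment> \<open>The integrals over growing intervals also converge to the Lebesgue integral
      over the line, which identifies J.\<close>
    have "(\<lambda>K. LINT y|lborel. indicator {- (real K + 1/2)..real K + 1/2} y *\<^sub>R g y) \<longlonglongrightarrow> (LINT y|lborel. g y)"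
    proof (rule integral_dominated_convergence[where w = "\<lambda>y. norm (g y)"])
      show "AE y in lborel. (\<lambda>K. indicator {- (real K + 1/2)..real K + 1/2} y *\<^sub>R g y) \<longlonglongrightarrow> g y"
      proof (intro AE_I2 tendsto_eventually)
        fix y :: real
        have "\<forall>\<^sub>F K in sequentially. real K \<ge> \<bar>y\<bar>" by real_asymp
        thus "\<forall>\<^sub>F K in sequentially. indicator {- (real K + 1/2)..real K + 1/2} y *\<^sub>R g y = g y"
          by eventually_elim (auto simp: indicator_def)
      qed
      show "AE y in lborel. norm (indicator {- (real K + 1/2)..real K + 1/2} y *\<^sub>R g y) \<le> norm (g y)" for K
        by (auto split: split_indicator)
    qed (use ig in auto)
    moreover have "(LINT y|lborel. indicator {- (real K + 1/2)..real K + 1/2} y *\<^sub>R g y) = integral {- (real K + 1/2)..real K + 1/2} g" for K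
    proof -
      have "set_integrable lborel {- (real K + 1/2)..real K + 1/2} g"
        unfolding set_integrable_def by (rule integrable_mult_indicator[OF _ ig]) simp
      from set_borel_integral_eq_integral(2)[OF this] show ?thesis by (simp add: set_lebesgue_integral_def)
    qed
    ultimately have "J = (LINT y|lborel. g y)" using lim1 LIMSEQ_unique by auto
    thus ?thesis using J val by (simp add: integral_unique I_def)
  qed
  have "(c has_sum jtheta 0 s (\<i> * of_real (1 / t))) UNIV"
    unfolding c_def using t by (intro jtheta_has_sum) auto
  hence "((\<lambda>k. c k / of_real (sqrt t)) has_sum (jtheta 0 s (\<i> * of_real (1 / t)) / of_real (sqrt t))) UNIV"
    by (rule has_sum_divide_const)
  from has_sum_symmetric_int[OF this] fourier_series_at_0[OF F]
  have "F 0 = jtheta 0 s (\<i> * of_real (1 / t)) / of_real (sqrt t)"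
    unfolding coeff using LIMSEQ_unique by blast
  thus ?thesis by (simp add: F0)
qed

section \<open>Modularity of the theta function\<close>

text \<open>Poisson summation gives the identity on the positive imaginary axis, and the identity
  theorem extends it. Squares avoid choosing a root of -i \<tau>.\<close>

lemma jtheta_inversion:
  assumes \<tau>: "Im \<tau> > 0"
  shows "(jtheta 0 s (- 1 / \<tau>))\<^sup>2 = - \<i> * \<tau> * (jtheta s 0 \<tau>)\<^sup>2"
proof -
  define f where "f = (\<lambda>\<tau>. (jtheta 0 s (- 1 / \<tau>))\<^sup>2 + \<i> * \<tau> * (jtheta s 0 \<tau>)\<^sup>2)"
  have inv: "Im (- 1 / z) > 0" if "Im z > 0" for z
    using that by (auto simp: Im_one_over zero_less_divide_iff)
  have comp: "(\<lambda>\<tau>. jtheta 0 s (- 1 / \<tau>)) holomorphic_on \<H>"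
  proof -
    have "(\<lambda>\<tau>::complex. - 1 / \<tau>) holomorphic_on \<H>" by (intro holomorphic_intros) auto
    moreover have "(\<lambda>\<tau>::complex. - 1 / \<tau>) ` \<H> \<subseteq> \<H>" using inv by auto
    ultimately show ?thesis using holomorphic_on_compose_gen[OF _ holomorphic_jtheta] by (auto simp: o_def)
  qed
  have f: "f holomorphic_on \<H>"
    unfolding f_def by (intro holomorphic_intros comp holomorphic_jtheta)
  define U where "U = (\<lambda>t. \<i> * of_real t) ` {0<..}"
  have "f \<tau> = 0"
  proof (rule analytic_continuation[OF f open_H connected_H, of U \<i>])
    show "U \<subseteq> \<H>" by (auto simp: U_def)
    show "\<i> islimpt U"
      unfolding islimpt_sequential
    proof (intro exI[of _ "\<lambda>n. \<i> * of_real (1 + 1 / Suc n)"] conjI allI)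
      show "\<i> * of_real (1 + 1 / Suc n) \<in> U - {\<i>}" for n
      proof -
        have "\<i> * of_real (1 + 1 / Suc n) \<in> U" unfolding U_def by (intro imageI) (auto intro: add_pos_nonneg)
        moreover have "Im (\<i> * of_real (1 + 1 / Suc n)) \<noteq> Im \<i>" by simp
        hence "\<i> * of_real (1 + 1 / Suc n) \<noteq> \<i>" by (rule contrapos_nn) (simp only:)
        ultimately show ?thesis by (intro DiffI) simp_all
      qed
      have "(\<lambda>n. 1 + 1 / real (Suc n)) \<longlonglongrightarrow> 1" by real_asymp
      hence "(\<lambda>n. \<i> * complex_of_real (1 + 1 / real (Suc n))) \<longlonglongrightarrow> \<i> * complex_of_real 1"
        by (intro tendsto_intros)
      thus "(\<lambda>n. \<i> * complex_of_real (1 + 1 / real (Suc n))) \<longlonglongrightarrow> \<i>" by simp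
    qed
    fix z assume "z \<in> U"
    then obtain t where t: "t > 0" "z = \<i> * of_real t" by (auto simp: U_def)
    have "- 1 / z = \<i> * of_real (1 / t)" using t by (simp add: field_simps)
    moreover have "jtheta 0 s (\<i> * of_real (1 / t)) = of_real (sqrt t) * jtheta s 0 (\<i> * of_real t)"
      using poisson_gaussian[OF t(1), of s] t(1) by simp
    ultimately have "(jtheta 0 s (- 1 / z))\<^sup>2 = of_real ((sqrt t)\<^sup>2) * (jtheta s 0 z)\<^sup>2"
      by (simp add: power_mult_distrib t(2))
    thus "f z = 0" using t by (simp add: f_def)
  qed (use \<tau> in auto)
  thus ?thesis by (simp add: f_def add_eq_0_iff2)
qed

lemma exp_pi_i_int_cong:
  assumes "even (p - q)" shows "exp (of_real pi * \<i> * of_int p) = exp (of_real pi * \<i> * of_int q)"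
proof -
  obtain k where k: "p = q + 2 * k" using assms by (metis add.commute diff_add_cancel evenE)
  have "of_real pi * \<i> * of_int p = of_real pi * \<i> * of_int q + 2 * of_real pi * \<i> * of_int k"
    by (simp add: k algebra_simps)
  thus ?thesis using exp_integer_2pi[of "of_int k"] by (simp add: exp_add mult_ac)
qed

lemma jtheta_shift:
  "jtheta 0 0 (\<tau> + 1) = jtheta 0 (1/2) \<tau>"
  "jtheta 0 (1/2) (\<tau> + 1) = jtheta 0 0 \<tau>"
  "jtheta (1/2) 0 (\<tau> + 1) = exp (of_real pi * \<i> / 4) * jtheta (1/2) 0 \<tau>"
proof -
  have e: "exp (A + of_real pi * \<i> * of_int p) = exp (A + of_real pi * \<i> * of_int q)" if "even (p - q)" for A :: complex and p q
    using exp_pi_i_int_cong[OF that] by (simp only: exp_add)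
  show "jtheta 0 0 (\<tau> + 1) = jtheta 0 (1/2) \<tau>"
    unfolding jtheta_def
  proof (intro infsum_cong)
    fix n :: int
    show "exp (of_real pi * \<i> * (\<tau> + 1) * (of_int n + of_real 0)\<^sup>2 + 2 * of_real pi * \<i> * of_int n * of_real 0)
       = exp (of_real pi * \<i> * \<tau> * (of_int n + of_real 0)\<^sup>2 + 2 * of_real pi * \<i> * of_int n * of_real (1/2))"
      using e[of "n\<^sup>2" n "of_real pi * \<i> * \<tau> * (of_int n)\<^sup>2"] by (simp add: algebra_simps)
  qed
  show "jtheta 0 (1/2) (\<tau> + 1) = jtheta 0 0 \<tau>"
    unfolding jtheta_def
  proof (intro infsum_cong)
    fix n :: int
    show "exp (of_real pi * \<i> * (\<tau> + 1) * (of_int n + of_real 0)\<^sup>2 + 2 * of_real pi * \<i> * of_int n * of_real (1/2))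
       = exp (of_real pi * \<i> * \<tau> * (of_int n + of_real 0)\<^sup>2 + 2 * of_real pi * \<i> * of_int n * of_real 0)"
      using e[of "n\<^sup>2 + n" 0 "of_real pi * \<i> * \<tau> * (of_int n)\<^sup>2"] by (simp add: algebra_simps)
  qed
  have "jtheta (1/2) 0 (\<tau> + 1) = (\<Sum>\<^sub>\<infinity>n\<in>(UNIV::int set). exp (of_real pi * \<i> / 4) *
     exp (of_real pi * \<i> * \<tau> * (of_int n + of_real (1/2))\<^sup>2 + 2 * of_real pi * \<i> * of_int n * of_real 0))"
    unfolding jtheta_def
  proof (intro infsum_cong)
    fix n :: int
    have "of_real pi * \<i> * (\<tau> + 1) * (of_int n + of_real (1/2))\<^sup>2
       = (of_real pi * \<i> / 4 + of_real pi * \<i> * \<tau> * (of_int n + of_real (1/2))\<^sup>2) + of_real pi * \<i> * of_int (n\<^sup>2 + n)"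
      by (simp add: power2_eq_square field_simps)
    hence "exp (of_real pi * \<i> * (\<tau> + 1) * (of_int n + of_real (1/2))\<^sup>2)
       = exp ((of_real pi * \<i> / 4 + of_real pi * \<i> * \<tau> * (of_int n + of_real (1/2))\<^sup>2) + of_real pi * \<i> * of_int 0)"
      using e[of "n\<^sup>2 + n" 0] by simp
    thus "exp (of_real pi * \<i> * (\<tau> + 1) * (of_int n + of_real (1/2))\<^sup>2 + 2 * of_real pi * \<i> * of_int n * of_real 0)
       = exp (of_real pi * \<i> / 4) * exp (of_real pi * \<i> * \<tau> * (of_int n + of_real (1/2))\<^sup>2 + 2 * of_real pi * \<i> * of_int n * of_real 0)"
      by (simp add: exp_add)
  qed
  also have "\<dots> = exp (of_real pi * \<i> / 4) * jtheta (1/2) 0 \<tau>"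
    unfolding jtheta_def by (rule infsum_cmult_right')
  finally show "jtheta (1/2) 0 (\<tau> + 1) = exp (of_real pi * \<i> / 4) * jtheta (1/2) 0 \<tau>" .
qed

lemma int_infsum_tails_le:
  fixes f :: "int \<Rightarrow> complex"
  assumes sm: "(\<lambda>n. cmod (f n)) summable_on UNIV" and r: "0 \<le> r" "r < 1" and c: "c \<ge> 0" and b: "b < 1"
    and pos: "\<And>n. n \<ge> 1 \<Longrightarrow> cmod (f n) \<le> c * r ^ nat n" and neg: "\<And>n. n \<le> b \<Longrightarrow> cmod (f n) \<le> c * r ^ nat (b + 1 - n)"
  shows "cmod ((\<Sum>\<^sub>\<infinity>n\<in>UNIV. f n) - (\<Sum>n\<in>{b+1..0}. f n)) \<le> 2 * (c * (r / (1 - r)))"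
proof -
  define X where "X = {1..} \<union> {..b}"
  have UN: "UNIV = {b+1..0} \<union> X" "{b+1..0} \<inter> X = {}" using b by (auto simp: X_def)
  have smX: "(\<lambda>n. cmod (f n)) summable_on X" using summable_on_subset_banach[OF sm] by blast
  have "(\<Sum>\<^sub>\<infinity>n\<in>UNIV. f n) = (\<Sum>\<^sub>\<infinity>n\<in>{b+1..0}. f n) + (\<Sum>\<^sub>\<infinity>n\<in>X. f n)"
    unfolding UN(1) using abs_summable_summable[OF smX] by (intro infsum_Un_disjoint UN(2)) auto
  hence "(\<Sum>\<^sub>\<infinity>n\<in>UNIV. f n) - (\<Sum>n\<in>{b+1..0}. f n) = (\<Sum>\<^sub>\<infinity>n\<in>X. f n)" by simp
  moreover have "cmod (\<Sum>\<^sub>\<infinity>n\<in>X. f n) \<le> (\<Sum>\<^sub>\<infinity>n\<in>X. cmod (f n))" by (rule norm_infsum_bound[OF smX])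
  moreover have "\<dots> \<le> 2 * (c * (r / (1 - r)))"
  proof (rule infsum_le_finite_sums[OF smX])
    fix Y assume "finite Y" "Y \<subseteq> X"
    thus "(\<Sum>n\<in>Y. cmod (f n)) \<le> 2 * (c * (r / (1 - r)))"
      unfolding X_def by (intro sum_int_tails_le[OF r c _ _ b] pos neg)
  qed
  ultimately show ?thesis by simp
qed

lemma exp_minus_2_less: "exp (- 2) < (1/3::real)"
proof -
  have e: "(2::real) \<le> exp 1" using exp_ge_add_one_self[of 1] by simp
  have "(2::real) * 2 \<le> exp 1 * exp 1" by (intro mult_mono e) auto
  hence "(4::real) \<le> exp 2" by (simp flip: exp_add)
  thus ?thesis by (simp add: exp_minus field_simps)
qed

text \<open>In the domain pi Im \<tau> \<ge> 2, so r = |exp (pi i \<tau>)| is below 1/3 and the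
  tails are smaller than the leading term. With characteristic 1/2, (n + 1/2)^2 = 1/4 + n (n + 1):
  the terms n = 0 and n = -1 coincide and exceed the rest.\<close>

lemma jtheta_nonzero_F:
  assumes \<tau>: "\<tau> \<in> \<F>"
  shows "jtheta 0 u \<tau> \<noteq> 0" "jtheta (1/2) 0 \<tau> \<noteq> 0"
proof -
  define y where "y = Im \<tau>"
  have y0: "Im \<tau> > 0" using F_subset_H[OF \<tau>] .
  have s3: "sqrt 3 \<ge> 17/10" by (rule real_le_rsqrt) (simp add: power2_eq_square)
  have y: "y \<ge> 17/20" using fundamental_domain_Im[OF \<tau>] s3 by (simp add: y_def)
  have "3 * (17/20) \<le> pi * y" using y pi_gt3 by (intro mult_mono) auto
  hence piy: "pi * y \<ge> 2" by simp
  define r where "r = exp (- (pi * y))"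
  have "r \<le> exp (- 2)" using piy by (simp add: r_def)
  hence "r < 1/3" using exp_minus_2_less by linarith
  moreover have "0 \<le> r" by (simp add: r_def)
  ultimately have r: "0 \<le> r" "r < 1/3" "r < 1" by auto
  have tail: "2 * (r / (1 - r)) < 1" using r by (simp add: field_simps)
  define f where "f = (\<lambda>s u n. exp (of_real pi * \<i> * \<tau> * (of_int n + of_real s)\<^sup>2 + 2 * of_real pi * \<i> * of_int n * of_real u))"
  have nf: "cmod (f s u n) = exp (- (pi * y * (of_int n + s)\<^sup>2))" for s u n
    unfolding f_def y_def by (rule norm_jtheta_term)
  have J: "jtheta s u \<tau> = (\<Sum>\<^sub>\<infinity>n\<in>UNIV. f s u n)" for s u by (simp add: jtheta_def f_def)
  have sm: "(\<lambda>n. cmod (f s u n)) summable_on UNIV" for s u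
    unfolding f_def by (rule jtheta_abs_summable[OF y0])
  have powr_le: "exp (- (pi * y * x)) \<le> r ^ k" if "x \<ge> real k" for x k
  proof -
    have "exp (- (pi * y * x)) \<le> exp (real k * (- (pi * y)))"
      using that y by (simp add: mult.commute mult_left_mono)
    thus ?thesis unfolding r_def exp_of_nat_mult .
  qed
  have sq: "n\<^sup>2 \<ge> k" if "\<bar>n\<bar> \<ge> k" "k \<ge> 1" for n k :: int
  proof -
    have "k * 1 \<le> \<bar>n\<bar> * \<bar>n\<bar>" using that by (intro mult_mono) auto
    thus ?thesis by (simp add: power2_eq_square)
  qed
  show "jtheta 0 u \<tau> \<noteq> 0"
  proof
    assume z: "jtheta 0 u \<tau> = 0"
    have le: "cmod (f 0 u n) \<le> 1 * r ^ k" if "int k \<ge> 1" "\<bar>n\<bar> \<ge> int k" for n k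
    proof -
      have "real_of_int (int k) \<le> real_of_int (n\<^sup>2)" using sq[OF that(2,1)] by (simp only: of_int_le_iff)
      thus ?thesis using powr_le[of k "(real_of_int n)\<^sup>2"] by (simp add: nf)
    qed
    have "cmod (jtheta 0 u \<tau> - (\<Sum>n\<in>{-1+1..0}. f 0 u n)) \<le> 2 * (1 * (r / (1 - r)))"
      unfolding J
    proof (rule int_infsum_tails_le[OF sm r(1,3)])
      show "cmod (f 0 u n) \<le> 1 * r ^ nat n" if "n \<ge> 1" for n using that by (intro le) auto
      show "cmod (f 0 u n) \<le> 1 * r ^ nat (- 1 + 1 - n)" if "n \<le> - 1" for n using that by (intro le) auto
    qed auto
    moreover have "(\<Sum>n\<in>{-1+1..0}. f 0 u n) = 1" by (simp add: f_def)
    ultimately show False using z tail by simp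
  qed
  show "jtheta (1/2) 0 \<tau> \<noteq> 0"
  proof
    assume z: "jtheta (1/2) 0 \<tau> = 0"
    define c where "c = exp (- (pi * y / 4))"
    have c: "c > 0" by (simp add: c_def)
    have le: "cmod (f (1/2) 0 n) \<le> c * r ^ k" if "n * (n + 1) \<ge> int k" for n k
    proof -
      have "real_of_int (int k) \<le> real_of_int (n * (n + 1))" using that by (simp only: of_int_le_iff)
      hence "exp (- (pi * y * (real_of_int (n * (n + 1))))) \<le> r ^ k" by (intro powr_le) simp
      moreover have "- (pi * y * (of_int n + 1/2)\<^sup>2) = - (pi * y / 4) + - (pi * y * (real_of_int (n * (n + 1))))"
        by (simp add: power2_eq_square field_simps)
      ultimately show ?thesis unfolding nf c_def by (simp only: exp_add) (simp add: mult_left_mono)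
    qed
    have 1: "n * (n + 1) \<ge> n" if "n \<ge> 1" for n :: int using that by (simp add: algebra_simps)
    have 2: "n * (n + 1) \<ge> - 1 - n" if "n \<le> - 2" for n :: int
    proof -
      have "0 \<le> (- 1 - n) * (- 1 - n)" by simp
      thus ?thesis using that by (simp add: algebra_simps)
    qed
    have "cmod (jtheta (1/2) 0 \<tau> - (\<Sum>n\<in>{-2+1..0}. f (1/2) 0 n)) \<le> 2 * (c * (r / (1 - r)))"
      unfolding J
    proof (rule int_infsum_tails_le[OF sm r(1,3)])
      show "cmod (f (1/2) 0 n) \<le> c * r ^ nat n" if "n \<ge> 1" for n using 1[OF that] that by (intro le) simp
      show "cmod (f (1/2) 0 n) \<le> c * r ^ nat (- 2 + 1 - n)" if "n \<le> - 2" for n using 2[OF that] that by (intro le) simp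
    qed (use c in auto)
    moreover have "{-2+1..0::int} = {-1, 0}" by auto
    moreover have "f (1/2) 0 (-1) = f (1/2) 0 0" by (simp add: f_def power2_eq_square)
    ultimately have "cmod (2 * f (1/2) 0 0) \<le> 2 * (c * (r / (1 - r)))" using z by (simp add: norm_minus_commute)
    moreover have "cmod (2 * f (1/2) 0 0) = 2 * c" unfolding norm_mult nf by (simp add: c_def power2_eq_square)
    ultimately have "c * 1 \<le> c * (r / (1 - r))" by simp
    hence "1 \<le> r / (1 - r)" using c by (simp only: mult_le_cancel_left_pos)
    thus False using r by (simp add: field_simps)
  qed
qed

section \<open>Generators of the modular group and of Gamma0(4)\<close>

lemma zero_row_cases:
  assumes "A \<in> SL2Z" "A$2$1 = 0"
  obtains n where "A = Tm n \<or> A = - Tm n"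
proof -
  have *: "A$1$1 * A$2$2 = 1" using assms by (simp add: SL2Z_iff)
  hence "A$1$1 = 1 \<and> A$2$2 = 1 \<or> A$1$1 = -1 \<and> A$2$2 = -1" by (auto simp: zmult_eq_1_iff)
  hence "A = Tm (A$1$2) \<or> A = - Tm (- (A$1$2))" using assms(2) by (auto simp: mat2_eq_iff)
  thus ?thesis using that by blast
qed

text \<open>Euclid's algorithm on the bottom row: multiplying by T^n S on the right replaces c by d
  mod c. With generators on the right, a property quantified over all points passes from B to the
  product by the composition rule.\<close>

lemma SL2Z_induct [consumes 1, case_names one T S minus]:
  assumes A: "A \<in> SL2Z" and one: "P (mat 1)"
    and T: "\<And>B n. B \<in> SL2Z \<Longrightarrow> P B \<Longrightarrow> P (B ** Tm n)"
    and S: "\<And>B. B \<in> SL2Z \<Longrightarrow> P B \<Longrightarrow> P (B ** Sm)"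
    and minus: "\<And>B. B \<in> SL2Z \<Longrightarrow> P B \<Longrightarrow> P (- B)"
  shows "P A"
  using A
proof (induction "nat \<bar>A$2$1\<bar>" arbitrary: A rule: less_induct)
  case less
  show ?case
  proof (cases "A$2$1 = 0")
    case True
    obtain n where n: "A = Tm n \<or> A = - Tm n" using zero_row_cases[OF less.prems True] .
    have "P (Tm n)" using T[OF one_in_SL2Z one, of n] by simp
    thus ?thesis using n minus[of "Tm n"] by auto
  next
    case False
    define c d where "c = A$2$1" and "d = A$2$2"
    define n where "n = - (d div c)"
    define B where "B = (A ** Tm n) ** Sm"
    have B: "B \<in> SL2Z" unfolding B_def using less.prems by (intro SL2Z_mult) auto
    have "B$2$1 = d mod c"
      by (simp add: B_def mult2_nth c_def d_def n_def minus_mult_div_eq_mod[symmetric])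
    moreover have "\<bar>d mod c\<bar> < \<bar>c\<bar>" using False abs_mod_less[of c d] by (simp add: c_def)
    ultimately have "P B" using less.hyps[of B] B by (simp add: c_def)
    have "Sm ** Sm = - mat 1" by (simp add: mat2_eq_iff mult2_nth)
    hence "A = (- (B ** Sm)) ** Tm (- n)"
      by (simp add: B_def mult2_minus Tm_add flip: matrix_mul_assoc)
    moreover have "P ((- (B ** Sm)) ** Tm (- n))"
      using B \<open>P B\<close> by (intro T minus S) (auto intro: SL2Z_mult)
    ultimately show ?thesis by simp
  qed
qed

lemma balanced_residue:
  fixes c d :: int
  assumes "c \<noteq> 0" shows "\<exists>n. 2 * \<bar>d + n * c\<bar> \<le> \<bar>c\<bar>"
proof -
  define r where "r = d mod c"
  have d: "d = (d div c) * c + r" by (simp add: r_def)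
  have r: "\<bar>r\<bar> < \<bar>c\<bar>" using assms abs_mod_less by (simp add: r_def)
  have sg: "c > 0 \<Longrightarrow> r \<ge> 0" "c < 0 \<Longrightarrow> r \<le> 0" by (auto simp: r_def)
  show ?thesis
  proof (cases "2 * \<bar>r\<bar> \<le> \<bar>c\<bar>")
    case True
    hence "2 * \<bar>d + (- (d div c)) * c\<bar> \<le> \<bar>c\<bar>" by (subst d) (simp add: algebra_simps)
    thus ?thesis ..
  next
    case False
    have "d + (- (d div c) - 1) * c = r - c" by (subst d) (simp add: algebra_simps)
    hence "2 * \<bar>d + (- (d div c) - 1) * c\<bar> \<le> \<bar>c\<bar>" using False r sg assms by (cases "c > 0") auto
    thus ?thesis ..
  qed
qed

definition Vm :: "int \<Rightarrow> int^2^2" where "Vm n = mat2 1 0 (4 * n) 1"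

lemma Vm_nth [simp]: "Vm n $ 1 $ 1 = 1" "Vm n $ 1 $ 2 = 0" "Vm n $ 2 $ 1 = 4 * n" "Vm n $ 2 $ 2 = 1"
  by (simp_all add: Vm_def)

lemma Vm_in_SL2Z [simp]: "Vm n \<in> SL2Z" by (simp add: SL2Z_iff)

text \<open>Euclid with balanced remainders. T^n makes 2 |d| \<le> |c|, and as V^m changes c by
  multiples of 4 d, it then makes |c| at most the new 2 |d|, which is smaller than the old
  |c|.\<close>

lemma Gamma0_4_induct [consumes 1, case_names one T V minus]:
  assumes A: "A \<in> Gamma0 4" and one: "P (mat 1)"
    and T: "\<And>B n. B \<in> SL2Z \<Longrightarrow> P B \<Longrightarrow> P (B ** Tm n)"
    and V: "\<And>B n. B \<in> SL2Z \<Longrightarrow> P B \<Longrightarrow> P (B ** Vm n)"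
    and minus: "\<And>B. B \<in> SL2Z \<Longrightarrow> P B \<Longrightarrow> P (- B)"
  shows "P A"
  using A
proof (induction "nat \<bar>A$2$1\<bar>" arbitrary: A rule: less_induct)
  case less
  have AS: "A \<in> SL2Z" and c4: "4 dvd A$2$1" using less.prems by (auto simp: Gamma0_def)
  show ?case
  proof (cases "A$2$1 = 0")
    case True
    obtain n where n: "A = Tm n \<or> A = - Tm n" using zero_row_cases[OF AS True] .
    have "P (Tm n)" using T[OF one_in_SL2Z one, of n] by simp
    thus ?thesis using n minus[of "Tm n"] by auto
  next
    case False
    define c d where "c = A$2$1" and "d = A$2$2"
    obtain n where n: "2 * \<bar>d + n * c\<bar> \<le> \<bar>c\<bar>" using balanced_residue[of c d] False by (auto simp: c_def)
    define d' where "d' = d + n * c"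
    have ev: "even c" using c4 by (auto simp: c_def)
    have "odd d"
    proof
      assume "even d"
      hence "even (A$1$1 * A$2$2 - A$1$2 * A$2$1)" using ev by (simp add: c_def d_def)
      moreover have "A$1$1 * A$2$2 - A$1$2 * A$2$1 = 1" using AS by (simp add: SL2Z_iff)
      ultimately show False by (simp only: odd_one)
    qed
    hence odd: "odd d'" using ev by (simp add: d'_def)
    hence d'0: "d' \<noteq> 0" by auto
    \<comment> \<open>For odd d' the number 2 |d'| is 2 modulo 4 while c is 0 modulo 4. This
      strictness is what makes the descent terminate.\<close>
    have "\<not> 4 dvd 2 * \<bar>d'\<bar>" using odd by presburger
    moreover have "4 dvd \<bar>c\<bar>" using c4 by (simp add: c_def)
    ultimately have "2 * \<bar>d'\<bar> \<noteq> \<bar>c\<bar>" by metis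
    hence less1: "2 * \<bar>d'\<bar> < \<bar>c\<bar>" using n by (simp add: d'_def)
    obtain m where m: "2 * \<bar>c + m * (4 * d')\<bar> \<le> \<bar>4 * d'\<bar>" using balanced_residue[of "4 * d'" c] d'0 by auto
    define B where "B = (A ** Tm n) ** Vm m"
    have BS: "B \<in> SL2Z" unfolding B_def using AS by (intro SL2Z_mult) auto
    have B21: "B$2$1 = c + m * (4 * d')"
      by (simp add: B_def mult2_nth c_def d_def d'_def algebra_simps)
    have B4: "B \<in> Gamma0 4" using BS c4 by (simp add: Gamma0_def B21 c_def)
    have "\<bar>B$2$1\<bar> < \<bar>A$2$1\<bar>"
    proof -
      have "\<bar>x\<bar> < \<bar>z\<bar>" if "2 * \<bar>x\<bar> \<le> \<bar>4 * y\<bar>" "2 * \<bar>y\<bar> < \<bar>z\<bar>" for x y z :: int using that by linarith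
      from this[OF m less1] show ?thesis by (simp only: B21 c_def)
    qed
    hence "nat \<bar>B$2$1\<bar> < nat \<bar>A$2$1\<bar>" by simp
    from this B4 have "P B" by (rule less.hyps)
    have V1: "Vm m ** Vm (- m) = mat 1" by (simp add: mat2_eq_iff mult2_nth)
    have "(B ** Vm (- m)) ** Tm (- n) = A ** (Tm n ** ((Vm m ** Vm (- m)) ** Tm (- n)))"
      by (simp only: B_def matrix_mul_assoc)
    hence "A = (B ** Vm (- m)) ** Tm (- n)" by (simp add: V1 Tm_add)
    moreover have "P ((B ** Vm (- m)) ** Tm (- n))"
      using BS \<open>P B\<close> by (intro T V) (auto intro: SL2Z_mult)
    ultimately show ?thesis by simp
  qed
qed

text \<open>The modular group permutes the three theta constants up to nonvanishing factors, so the zero set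
  of their product is invariant and may be looked for in the fundamental domain.\<close>

lemma jtheta_0_0_nonzero:
  assumes \<tau>: "Im \<tau> > 0" shows "jtheta 0 0 \<tau> \<noteq> 0"
proof -
  define Z where "Z = (\<lambda>\<tau>. jtheta 0 0 \<tau> * jtheta 0 (1/2) \<tau> * jtheta (1/2) 0 \<tau>)"
  have T1: "Z (\<tau> + 1) = 0 \<longleftrightarrow> Z \<tau> = 0" for \<tau> by (auto simp: Z_def jtheta_shift)
  \<comment> \<open>The function that is 0 at the zeros of Z and 1 elsewhere has period 1, hence
    every integer as a period.\<close>
  have T: "Z (\<tau> + of_int n) = 0 \<longleftrightarrow> Z \<tau> = 0" if "Im \<tau> > 0" for \<tau> n
    using periodic_int_multiple[of "\<lambda>\<tau>. if Z \<tau> = 0 then 0 else 1" 1 \<tau> n] that T1 by (simp split: if_splits)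
  have S: "Z (- 1 / \<tau>) = 0 \<longleftrightarrow> Z \<tau> = 0" if \<tau>: "Im \<tau> > 0" for \<tau>
  proof -
    have inv: "Im (- 1 / \<tau>) > 0" using \<tau> by (auto simp: Im_one_over zero_less_divide_iff)
    have nz: "\<tau> \<noteq> 0" using \<tau> by auto
    have eq: "jtheta 0 s (- 1 / z) = 0 \<longleftrightarrow> jtheta s 0 z = 0" if "Im z > 0" for s z
    proof -
      have "z \<noteq> 0" using that by auto
      moreover have "(jtheta 0 s (- 1 / z))\<^sup>2 = 0 \<longleftrightarrow> - \<i> * z * (jtheta s 0 z)\<^sup>2 = 0"
        by (simp only: jtheta_inversion[OF that])
      ultimately show ?thesis by simp
    qed
    \<comment> \<open>The inversion at -1/\<tau> supplies the other half of the exchange of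
      \<open>jtheta 0 (1/2)\<close> and \<open>jtheta (1/2) 0\<close>.\<close>
    have "- 1 / (- 1 / \<tau>) = \<tau>" by simp
    hence "jtheta 0 (1/2) \<tau> = 0 \<longleftrightarrow> jtheta (1/2) 0 (- 1 / \<tau>) = 0" using eq[OF inv, of "1/2"] by simp
    thus ?thesis using eq[OF \<tau>, of 0] eq[OF \<tau>, of "1/2"] by (auto simp: Z_def)
  qed
  have all: "\<forall>w. Im w > 0 \<longrightarrow> (Z (moebius_action A w) = 0 \<longleftrightarrow> Z w = 0)" if "A \<in> SL2Z" for A
    using that
  proof (induction A rule: SL2Z_induct)
    case (T B n)
    thus ?case using \<open>\<And>\<tau> n. Im \<tau> > 0 \<Longrightarrow> (Z (\<tau> + of_int n) = 0) = (Z \<tau> = 0)\<close> by (simp add: moebius_mult)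
  next
    case (S B)
    have "Im (- 1 / w) > 0" if "Im w > 0" for w using that by (auto simp: Im_one_over zero_less_divide_iff)
    thus ?case using S \<open>\<And>\<tau>. Im \<tau> > 0 \<Longrightarrow> (Z (- 1 / \<tau>) = 0) = (Z \<tau> = 0)\<close> by (simp add: moebius_mult)
  qed auto
  obtain A w where A: "A \<in> SL2Z" "w \<in> \<F>" "\<tau> = moebius_action A w"
    using fundamental_domain_cover[OF \<tau>] by blast
  have "Z w \<noteq> 0" using jtheta_nonzero_F[OF A(2)] by (simp add: Z_def)
  hence "Z \<tau> \<noteq> 0" using all[OF A(1)] F_subset_H[OF A(2)] A(3) by blast
  thus ?thesis by (simp add: Z_def)
qed

section \<open>The theta function on Gamma0(4)\<close>

lemma theta_eq_jtheta: "theta z = jtheta 0 0 (2 * z)"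
  unfolding theta_def jtheta_def by (intro infsum_cong) (simp add: mult_ac)

lemma theta_nonzero: "Im z > 0 \<Longrightarrow> theta z \<noteq> 0"
  using jtheta_0_0_nonzero[of "2 * z"] by (simp add: theta_eq_jtheta)

lemma holomorphic_theta: "theta holomorphic_on \<H>"
proof -
  have "(\<lambda>z::complex. 2 * z) holomorphic_on \<H>" by (intro holomorphic_intros)
  moreover have "(\<lambda>z::complex. 2 * z) ` \<H> \<subseteq> \<H>" by auto
  ultimately have "(\<lambda>z. jtheta 0 0 (2 * z)) holomorphic_on \<H>"
    using holomorphic_on_compose_gen[OF _ holomorphic_jtheta] by (auto simp: o_def)
  thus ?thesis by (simp add: theta_eq_jtheta[abs_def])
qed

lemma theta_add_int: "theta (z + of_int k) = theta z"
proof -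
  have "exp (2 * of_real pi * \<i> * of_int (n\<^sup>2) * (z + of_int k)) = exp (2 * of_real pi * \<i> * of_int (n\<^sup>2) * z)" for n
  proof -
    have "2 * of_real pi * \<i> * of_int (n\<^sup>2) * (z + of_int k) = 2 * of_real pi * \<i> * of_int (n\<^sup>2) * z + (2 * of_int (n\<^sup>2 * k) * of_real pi) * \<i>"
      by (simp add: algebra_simps)
    thus ?thesis using exp_integer_2pi[of "of_int (n\<^sup>2 * k)"] by (simp add: exp_add)
  qed
  thus ?thesis by (simp add: theta_def)
qed

text \<open>The Fricke involution -1/(4 z) is -1/\<tau> in the variable \<tau> = 2 z; squaring the
  relation of the theta constant gives the factor (-2 i z)^2 = -4 z^2.\<close>

lemma theta_inversion:
  assumes "Im z > 0" shows "theta (- 1 / (4 * z)) ^ 4 = - 4 * z\<^sup>2 * theta z ^ 4"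
proof -
  have "(jtheta 0 0 (- 1 / (2 * z)))\<^sup>2 = - \<i> * (2 * z) * (jtheta 0 0 (2 * z))\<^sup>2"
    using assms by (intro jtheta_inversion) simp
  moreover have "2 * (- 1 / (4 * z)) = - 1 / (2 * z)" by simp
  ultimately have "(theta (- 1 / (4 * z)))\<^sup>2 = - \<i> * (2 * z) * (theta z)\<^sup>2" by (simp only: theta_eq_jtheta)
  hence "((theta (- 1 / (4 * z)))\<^sup>2)\<^sup>2 = (- \<i> * (2 * z) * (theta z)\<^sup>2)\<^sup>2" by simp
  thus ?thesis by (simp add: power_mult_distrib flip: power_mult)
qed

text \<open>The lower unipotent matrix is the translation by -k conjugated with the Fricke
  involution: with w = -1/(4 z) one has w - k = w (4 k z + 1). Theta is invariant under the
  translation, and the factors of the two involutions leave the square of the denominator.\<close>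

lemma theta_Vm:
  assumes z: "Im z > 0" shows "theta (moebius_action (Vm k) z) ^ 4 = denom (Vm k) z ^ 2 * theta z ^ 4"
proof -
  have z0: "z \<noteq> 0" using z by auto
  define D where "D = denom (Vm k) z"
  have D: "D = 4 * of_int k * z + 1" by (simp add: D_def denom_def)
  have D0: "D \<noteq> 0" unfolding D_def using denom_nonzero[OF Vm_in_SL2Z z] .
  define w where "w = - 1 / (4 * z)"
  have w: "Im w > 0"
    using Im_one_over[of "4 * z"] z z0 by (simp add: w_def zero_less_divide_iff)
  have w0: "w \<noteq> 0" using w by auto
  define w' where "w' = w + of_int (- k)"
  have w': "Im w' > 0" using w by (simp add: w'_def)
  have w'0: "w' \<noteq> 0" using w' by auto
  have w'eq: "w' = w * D" using z0 by (simp add: w'_def w_def D field_simps)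
  have "moebius_action (Vm k) z = z / D" by (simp add: moebius_action_def D_def)
  also have "\<dots> = - 1 / (4 * w')" using z0 D0 by (simp add: w'eq w_def)
  finally have "theta (moebius_action (Vm k) z) ^ 4 = - 4 * w'\<^sup>2 * theta w' ^ 4"
    using theta_inversion[OF w'] by simp
  also have "theta w' = theta w" unfolding w'_def by (rule theta_add_int)
  also have "- 4 * w'\<^sup>2 * theta w ^ 4 = D ^ 2 * (- 4 * w\<^sup>2 * theta w ^ 4)" by (simp add: w'eq power_mult_distrib)
  also have "- 4 * w\<^sup>2 * theta w ^ 4 = theta (- 1 / (4 * w)) ^ 4" using theta_inversion[OF w] by simp
  also have "- 1 / (4 * w) = z" using z0 by (simp add: w_def)
  finally show ?thesis by (simp add: D_def)
qed

lemma theta_power4: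
  assumes "A \<in> Gamma0 4" "Im z > 0"
  shows "theta (moebius_action A z) ^ 4 = denom A z ^ 2 * theta z ^ 4"
proof -
  have "\<forall>z. Im z > 0 \<longrightarrow> theta (moebius_action A z) ^ 4 = denom A z ^ 2 * theta z ^ 4"
    using assms(1)
  proof (induction A rule: Gamma0_4_induct)
    case (T B n)
    thus ?case by (simp add: moebius_mult denom_mult theta_add_int)
  next
    case (V B n)
    show ?case
    proof (intro allI impI)
      fix z :: complex assume z: "Im z > 0"
      have "theta (moebius_action B (moebius_action (Vm n) z)) ^ 4
         = denom B (moebius_action (Vm n) z) ^ 2 * theta (moebius_action (Vm n) z) ^ 4"
        using V(2) z by simp
      thus "theta (moebius_action (B ** Vm n) z) ^ 4 = denom (B ** Vm n) z ^ 2 * theta z ^ 4"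
        using V(1) z by (simp add: moebius_mult denom_mult theta_Vm power_mult_distrib)
    qed
  qed auto
  thus ?thesis using assms(2) by blast
qed

section \<open>Uniformity in the level\<close>

lemma in_principal_congruence_subgroup_iff:
  "A \<in> principal_congruence_subgroup N \<longleftrightarrow>
     A \<in> SL2Z \<and> int N dvd A$1$1 - 1 \<and> int N dvd A$1$2 \<and> int N dvd A$2$1 \<and> int N dvd A$2$2 - 1"
  by (auto simp: principal_congruence_subgroup_def forall_2)

lemma congruence_group_Gamma0:
  assumes "N > 0" shows "congruence_group (Gamma0 N) N"
proof
  show "A ** B \<in> Gamma0 N" if "A \<in> Gamma0 N" "B \<in> Gamma0 N" for A B
    using that by (auto simp: Gamma0_def SL2Z_mult mult2_nth)
qed (use assms in \<open>auto simp: Gamma0_def in_principal_congruence_subgroup_iff\<close>)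

lemma congruence_group_principal:
  assumes "N > 0" shows "congruence_group (principal_congruence_subgroup N) N"
proof
  show "A ** B \<in> principal_congruence_subgroup N"
    if "A \<in> principal_congruence_subgroup N" "B \<in> principal_congruence_subgroup N" for A B
  proof -
    have e1: "(A ** B)$1$1 - 1 = (A$1$1 - 1) * B$1$1 + (B$1$1 - 1) + A$1$2 * B$2$1"
      and e2: "(A ** B)$2$2 - 1 = A$2$1 * B$1$2 + (A$2$2 - 1) * B$2$2 + (B$2$2 - 1)"
      by (simp_all add: mult2_nth algebra_simps)
    have "int N dvd (A ** B)$1$1 - 1" unfolding e1
      using that by (intro dvd_add dvd_mult dvd_mult2) (simp_all add: in_principal_congruence_subgroup_iff)
    moreover have "int N dvd (A ** B)$2$2 - 1" unfolding e2
      using that by (intro dvd_add dvd_mult dvd_mult2) (simp_all add: in_principal_congruence_subgroup_iff)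
    ultimately show ?thesis
      using that by (simp add: in_principal_congruence_subgroup_iff SL2Z_mult mult2_nth)
  qed
qed (use assms in \<open>auto simp: in_principal_congruence_subgroup_iff\<close>)

section \<open>Automorphy factors of the three families\<close>

text \<open>A matrix -T^n has denominator -1, which satisfies the condition at infinity only for
  even k.\<close>

lemma automorphy_factor_denom_power:
  assumes "congruence_group \<Gamma> M" and k: "k > 2" and hN: "h > 0" "N > 0"
    and unipotent: "\<And>G. G \<in> \<Gamma> \<Longrightarrow> G$2$1 = 0 \<Longrightarrow> \<exists>n. G = Tm (n * int h) \<or> even k \<and> G = - Tm (n * int h)"
    and Tm: "Tm (int h) \<in> \<Gamma>" and level: "\<And>G. G \<in> \<Gamma> \<Longrightarrow> int N dvd G$2$1"
  shows "automorphy_factor \<Gamma> M (\<lambda>A z. denom A z ^ k) (2 * k) h N"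
proof -
  interpret congruence_group \<Gamma> M by fact
  show ?thesis
  proof unfold_locales
    show "(\<lambda>z. denom G z ^ k) holomorphic_on \<H>" for G by (intro holomorphic_intros)
    show "(denom G z ^ k) ^ 4 = denom G z ^ (2 * (2 * k))" for G z by (simp add: mult.commute flip: power_mult)
    show "denom (G ** H) z ^ k = denom G (moebius_action H z) ^ k * denom H z ^ k"
      if "G \<in> \<Gamma>" "H \<in> \<Gamma>" "Im z > 0" for G H z
      using that sub by (simp add: denom_mult subset_iff power_mult_distrib)
    show "denom G z ^ k = 1" if "G \<in> \<Gamma>" "G$2$1 = 0" for G z
      using unipotent[OF that] by auto
    show "\<exists>n. \<forall>z. Im z > 0 \<longrightarrow> moebius_action G z = z + of_int n * of_nat h" if "G \<in> \<Gamma>" "G$2$1 = 0" for G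
      using unipotent[OF that] by auto
  qed (use k hN Tm level in auto)
qed

lemma automorphy_factor_Gamma0:
  assumes "k > 2" "even k" "N > 0"
  shows "automorphy_factor (Gamma0 N) N (\<lambda>A z. denom A z ^ k) (2 * k) 1 N"
proof (rule automorphy_factor_denom_power[OF congruence_group_Gamma0])
  show "\<exists>n. G = Tm (n * int 1) \<or> even k \<and> G = - Tm (n * int 1)" if "G \<in> Gamma0 N" "G$2$1 = 0" for G
    using zero_row_cases[of G] that assms by (auto simp: Gamma0_def)
qed (use assms in \<open>auto simp: Gamma0_def\<close>)

text \<open>From N = 3 on, -1 is not congruent to 1 modulo N, so no -T^n occurs and odd weights are
  admissible. The width at infinity is N.\<close>

lemma automorphy_factor_principal:
  assumes "k > 2" "N \<ge> 3"
  shows "automorphy_factor (principal_congruence_subgroup N) N (\<lambda>A z. denom A z ^ k) (2 * k) N N"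
proof (rule automorphy_factor_denom_power[OF congruence_group_principal])
  show "\<exists>n. G = Tm (n * int N) \<or> even k \<and> G = - Tm (n * int N)"
    if G: "G \<in> principal_congruence_subgroup N" "G$2$1 = 0" for G
  proof -
    obtain n where n: "G = Tm n \<or> G = - Tm n"
      using zero_row_cases[of G] G by (auto simp: in_principal_congruence_subgroup_iff)
    have "G \<noteq> - Tm n"
    proof
      assume "G = - Tm n"
      hence "int N dvd - 2" using G by (simp add: in_principal_congruence_subgroup_iff)
      hence "int N dvd 2" by simp
      hence "int N \<le> 2" by (rule zdvd_imp_le) simp
      thus False using assms by simp
    qed
    hence "G = Tm n" using n by simp
    moreover have "int N dvd n" using G by (simp add: in_principal_congruence_subgroup_iff \<open>G = Tm n\<close>)
    ultimately show ?thesis by (metis dvdE mult.commute)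
  qed
qed (use assms in \<open>auto simp: in_principal_congruence_subgroup_iff\<close>)

text \<open>-1 fixes every point but has factor (-1)^k, so f = -f.\<close>

lemma cusp_forms_odd_trivial:
  assumes k: "odd k" and \<Gamma>: "- mat 1 \<in> \<Gamma>"
  shows "cusp_forms \<kappa> \<Gamma> (\<lambda>A z. denom A z ^ k) = {\<lambda>z. 0}"
proof -
  have "f z = 0" if f: "f \<in> cusp_forms \<kappa> \<Gamma> (\<lambda>A z. denom A z ^ k)" for f z
  proof (cases "z \<in> \<H>")
    case True
    hence "f (moebius_action (- mat 1) z) = denom (- mat 1) z ^ k * f z"
      using f \<Gamma> by (simp only: cusp_forms_def mem_Collect_eq)
    thus ?thesis using k by (simp add: eq_neg_iff_add_eq_0)
  qed (use f in \<open>simp add: cusp_forms_def\<close>)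
  moreover have "(\<lambda>z. 0) \<in> cusp_forms \<kappa> \<Gamma> (\<lambda>A z. denom A z ^ k)"
    by (simp add: cusp_forms_def)
  ultimately show ?thesis by (auto simp: fun_eq_iff)
qed

lemma Gamma0_4_mult_subset: "Gamma0 (4 * N) \<subseteq> Gamma0 4"
  by (auto simp: Gamma0_def dest: dvd_mult_left)

lemma theta_quotient_power4:
  assumes "G \<in> Gamma0 4" "Im z > 0"
  shows "((theta (moebius_action G z) / theta z) ^ j) ^ 4 = denom G z ^ (2 * j)"
proof -
  have "((theta (moebius_action G z) / theta z) ^ j) ^ 4 = (theta (moebius_action G z) ^ 4 / theta z ^ 4) ^ j"
    by (simp add: mult.commute power_divide flip: power_mult)
  also have "theta (moebius_action G z) ^ 4 / theta z ^ 4 = denom G z ^ 2"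
    using theta_power4[OF assms] theta_nonzero[OF assms(2)] by simp
  finally show ?thesis by (simp flip: power_mult)
qed

text \<open>The factor is a quotient of values of theta, so the cocycle relation and holomorphy
  follow once theta has no zeros. Lower left entries are multiples of 4 N; the level is recorded as
  N to match the parameter over which uniformity is claimed.\<close>

lemma automorphy_factor_theta:
  assumes j: "j > 4" and N: "N > 0"
  shows "automorphy_factor (Gamma0 (4 * N)) (4 * N) (\<lambda>A z. (theta (moebius_action A z) / theta z) ^ j) j 1 N"
proof -
  interpret congruence_group "Gamma0 (4 * N)" "4 * N" by (rule congruence_group_Gamma0) (use N in simp)
  have \<Gamma>: "G \<in> SL2Z" if "G \<in> Gamma0 (4 * N)" for G using that sub by blast
  have unipotent: "\<exists>n. G = Tm n \<or> G = - Tm n" if "G \<in> Gamma0 (4 * N)" "G$2$1 = 0" for G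
    using zero_row_cases[OF \<Gamma>] that by metis
  show ?thesis
  proof unfold_locales
    fix G assume G: "G \<in> Gamma0 (4 * N)"
    have "moebius_action G ` \<H> \<subseteq> \<H>" using \<Gamma>[OF G] by auto
    hence "theta \<circ> moebius_action G holomorphic_on \<H>"
      by (intro holomorphic_on_compose_gen[OF holomorphic_moebius[OF \<Gamma>[OF G]] holomorphic_theta])
    hence "(\<lambda>z. theta (moebius_action G z)) holomorphic_on \<H>" by (simp only: o_def)
    thus "(\<lambda>z. (theta (moebius_action G z) / theta z) ^ j) holomorphic_on \<H>"
      by (intro holomorphic_intros holomorphic_theta) (auto simp: theta_nonzero)
  next
    show "((theta (moebius_action G z) / theta z) ^ j) ^ 4 = denom G z ^ (2 * j)"
      if "G \<in> Gamma0 (4 * N)" "Im z > 0" for G z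
      using theta_quotient_power4[OF _ that(2)] that(1) Gamma0_4_mult_subset by blast
  next
    show "(theta (moebius_action (G ** H) z) / theta z) ^ j
        = (theta (moebius_action G (moebius_action H z)) / theta (moebius_action H z)) ^ j * (theta (moebius_action H z) / theta z) ^ j"
      if "G \<in> Gamma0 (4 * N)" "H \<in> Gamma0 (4 * N)" "Im z > 0" for G H z
    proof -
      have "theta (moebius_action H z) \<noteq> 0" using \<Gamma>[OF that(2)] that(3) by (simp add: theta_nonzero)
      thus ?thesis using \<Gamma>[OF that(1)] \<Gamma>[OF that(2)] that(3) by (simp add: moebius_mult flip: power_mult_distrib)
    qed
  next
    show "(theta (moebius_action G z) / theta z) ^ j = 1"
      if "G \<in> Gamma0 (4 * N)" "G$2$1 = 0" "Im z > 0" for G z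
      using unipotent[OF that(1,2)] theta_nonzero[OF that(3)] by (auto simp: theta_add_int)
    show "\<exists>n. \<forall>z. Im z > 0 \<longrightarrow> moebius_action G z = z + of_int n * of_nat 1"
      if "G \<in> Gamma0 (4 * N)" "G$2$1 = 0" for G
      using unipotent[OF that] by auto
  next
    show "int N dvd G$2$1" if "G \<in> Gamma0 (4 * N)" for G
      using that by (auto simp: Gamma0_def dest: dvd_mult_right)
  qed (use j N in \<open>auto simp: Gamma0_def\<close>)
qed

section \<open>Choice of the constants\<close>

lemma level_powr_small:
  fixes K a e :: real
  assumes "a > 0" "e > 0"
  shows "\<exists>N0. \<forall>N\<ge>N0. K * real N powr (- a) \<le> e"
proof -
  have "((\<lambda>N. real N powr (- a)) \<longlonglongrightarrow> 0)" using assms(1) by real_asymp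
  hence "(\<lambda>N. K * real N powr (- a)) \<longlonglongrightarrow> K * 0" by (intro tendsto_intros)
  hence "\<forall>\<^sub>F N in sequentially. K * real N powr (- a) < e"
    using assms(2) by (intro order_tendstoD(2)) auto
  thus ?thesis unfolding eventually_sequentially by (metis less_imp_le)
qed

text \<open>P selects the admissible levels. An automorphy factor is asked for only from N1 on and
  for spaces with a nonzero form, which leaves room for small principal levels and for odd weights
  on a group containing -1.\<close>

lemma uniform_basis_sup_bounds:
  fixes \<Gamma> :: "nat \<Rightarrow> (int^2^2) set"
  assumes m: "m > 4"
    and group: "\<And>N. P N \<Longrightarrow> \<exists>M. congruence_group (\<Gamma> N) M"
    and J_power4: "\<And>N G z. P N \<Longrightarrow> G \<in> \<Gamma> N \<Longrightarrow> Im z > 0 \<Longrightarrow> J G z ^ 4 = denom G z ^ (2 * m)"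
    and factor: "\<And>N. P N \<Longrightarrow> N \<ge> N1 \<Longrightarrow> cusp_forms (real m / 2) (\<Gamma> N) J \<noteq> {\<lambda>z. 0} \<Longrightarrow>
      \<exists>M h. automorphy_factor (\<Gamma> N) M J m h N"
  shows "\<exists>c C. c > 0 \<and> C > 0 \<and> (\<forall>N. P N \<longrightarrow>
    (\<forall>B. orthonormal_basis (real m / 2) (\<Gamma> N) (cusp_forms (real m / 2) (\<Gamma> N) J) B \<longrightarrow>
       basis_sup (real m / 2) B \<le> ennreal C \<and>
       (cusp_forms (real m / 2) (\<Gamma> N) J \<noteq> {\<lambda>z. 0} \<longrightarrow> ennreal c \<le> basis_sup (real m / 2) B)))"
proof -
  define V where "V = (\<lambda>N. cusp_forms (real m / 2) (\<Gamma> N) J)"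
  define low where "low = (\<lambda>N c. \<forall>B. orthonormal_basis (real m / 2) (\<Gamma> N) (V N) B \<longrightarrow> ennreal c \<le> basis_sup (real m / 2) B)"
  have low_mono: "low N c'" if "low N c" "c' \<le> c" for N c c'
    using that ennreal_leI[OF that(2)] unfolding low_def by (meson order_trans)
  have weak: "congruence_group.weak_form (\<Gamma> N) m f" if "P N" "congruence_group (\<Gamma> N) M" "f \<in> V N" for N M f
    using congruence_group.weak_form_if_cusp_form[OF that(2) J_power4[OF that(1)]] that(3) unfolding V_def by blast
  have upper: "basis_sup (real m / 2) B \<le> ennreal (sup_const m)"
    if P: "P N" and B: "orthonormal_basis (real m / 2) (\<Gamma> N) (V N) B" for N B
  proof -
    obtain M where M: "congruence_group (\<Gamma> N) M" using group[OF P] by blast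
    show ?thesis
      by (rule congruence_group.basis_sup_le[OF M B]) (use weak[OF P M] in \<open>simp_all add: V_def\<close>)
  qed
  have ex_low: "\<exists>c>0. low N c" if P: "P N" and ne: "V N \<noteq> {\<lambda>z. 0}" for N
  proof -
    obtain M where M: "congruence_group (\<Gamma> N) M" using group[OF P] by blast
    show ?thesis unfolding low_def
      by (rule congruence_group.basis_sup_ge_nontrivial[OF M _ weak[OF P M] ne]) (simp_all add: V_def)
  qed
  define c0 where "c0 = (exp (- (2 * pi)) / 2)\<^sup>2 / (sup_const m * (energy_const m)\<^sup>2)"
  have c0: "c0 > 0" unfolding c0_def using sup_const_pos[of m] energy_const_pos[OF m] by simp
  obtain N0 where N0: "\<And>N. N \<ge> N0 \<Longrightarrow> lattice_const (real m / 4) * real N powr (- (real m / 4)) \<le> exp (- (2 * pi)) / 2"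
    using level_powr_small[of "real m / 4" "exp (- (2 * pi)) / 2" "lattice_const (real m / 4)"] m by auto
  have large: "low N c0" if N: "N \<ge> max N0 N1" and P: "P N" and ne: "V N \<noteq> {\<lambda>z. 0}" for N
  proof -
    obtain M h where Mh: "automorphy_factor (\<Gamma> N) M J m h N" using factor[OF P] N ne by (auto simp: V_def)
    show ?thesis unfolding low_def V_def c0_def
      using automorphy_factor.lower_const_le_basis_sup[OF Mh N0] N by auto
  qed
  \<comment> \<open>Levels that claim nothing receive the value 1, so that the minimum over the
    finitely many small levels stays positive.\<close>
  define cN where "cN = (\<lambda>N. if P N \<and> V N \<noteq> {\<lambda>z. 0} then SOME c. c > 0 \<and> low N c else 1)"
  have cN: "cN N > 0 \<and> (P N \<and> V N \<noteq> {\<lambda>z. 0} \<longrightarrow> low N (cN N))" for N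
  proof (cases "P N \<and> V N \<noteq> {\<lambda>z. 0}")
    case True
    thus ?thesis using someI_ex[OF ex_low[of N]] unfolding cN_def by simp
  qed (auto simp: cN_def)
  define c where "c = Min (insert c0 (cN ` {..<max N0 N1}))"
  have "c > 0" unfolding c_def using c0 cN by (subst Min_gr_iff) auto
  have c_le: "c \<le> c0" "N < max N0 N1 \<Longrightarrow> c \<le> cN N" for N
    unfolding c_def by (auto intro!: Min_le)
  have "low N c" if "P N" "V N \<noteq> {\<lambda>z. 0}" for N
  proof (cases "N < max N0 N1")
    case True
    thus ?thesis using low_mono[OF _ c_le(2)[OF True]] cN[of N] that by blast
  next
    case False
    hence "N \<ge> max N0 N1" by (simp only: not_less)
    from low_mono[OF large[OF this that] c_le(1)] show ?thesis .
  qed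
  thus ?thesis using upper \<open>c > 0\<close> sup_const_pos[of m] unfolding low_def V_def by blast
qed

theorem theorem1p10:
  shows "(\<forall>k::nat. k > 2 \<longrightarrow>
           (\<exists>c C :: real. c > 0 \<and> C > 0 \<and>
             (\<forall>N::nat. N > 0 \<longrightarrow>
               (\<forall>B. orthonormal_basis (real k) (Gamma0 N) (cusp_forms_integral k (Gamma0 N)) B \<longrightarrow>
                  basis_sup (real k) B \<le> ennreal C \<and>
                  (cusp_forms_integral k (Gamma0 N) \<noteq> {\<lambda>z. 0} \<longrightarrow>
                     ennreal c \<le> basis_sup (real k) B)))))
       \<and> (\<forall>k::nat. k > 2 \<longrightarrow>
           (\<exists>c C :: real. c > 0 \<and> C > 0 \<and>
             (\<forall>N::nat. N > 0 \<longrightarrow>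
               (\<forall>B. orthonormal_basis (real k) (principal_congruence_subgroup N)
                      (cusp_forms_integral k (principal_congruence_subgroup N)) B \<longrightarrow>
                  basis_sup (real k) B \<le> ennreal C \<and>
                  (cusp_forms_integral k (principal_congruence_subgroup N) \<noteq> {\<lambda>z. 0} \<longrightarrow>
                     ennreal c \<le> basis_sup (real k) B)))))
       \<and> (\<forall>j::nat. odd j \<and> real j / 2 \<ge> 5 / 2 \<longrightarrow>
           (\<exists>c C :: real. c > 0 \<and> C > 0 \<and>
             (\<forall>N::nat. N > 0 \<and> squarefree N \<longrightarrow>
               (\<forall>B. orthonormal_basis (real j / 2) (Gamma0 (4 * N)) (cusp_forms_half_integral j N) B \<longrightarrow>
                  basis_sup (real j / 2) B \<le> ennreal C \<and>
                  (cusp_forms_half_integral j N \<noteq> {\<lambda>z. 0} \<longrightarrow>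
                     ennreal c \<le> basis_sup (real j / 2) B)))))"
proof (intro conjI allI impI)
  fix k :: nat assume k: "k > 2"
  \<comment> \<open>Integral weight k is the case m = 2 k, and m > 4 becomes k > 2.\<close>
  have half: "real (2 * k) / 2 = real k" by simp
  have power4: "(denom G z ^ k) ^ 4 = denom G z ^ (2 * (2 * k))" for G z
    by (simp add: mult.commute flip: power_mult)
  show "\<exists>c C :: real. c > 0 \<and> C > 0 \<and>
             (\<forall>N::nat. N > 0 \<longrightarrow>
               (\<forall>B. orthonormal_basis (real k) (Gamma0 N) (cusp_forms_integral k (Gamma0 N)) B \<longrightarrow>
                  basis_sup (real k) B \<le> ennreal C \<and>
                  (cusp_forms_integral k (Gamma0 N) \<noteq> {\<lambda>z. 0} \<longrightarrow>
                     ennreal c \<le> basis_sup (real k) B)))"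
    unfolding cusp_forms_integral_def half[symmetric]
  proof (rule uniform_basis_sup_bounds)
    show "\<exists>M h. automorphy_factor (Gamma0 N) M (\<lambda>A z. denom A z ^ k) (2 * k) h N"
      if "N > 0" "N \<ge> 1" "cusp_forms (real (2 * k) / 2) (Gamma0 N) (\<lambda>A z. denom A z ^ k) \<noteq> {\<lambda>z. 0}" for N
    proof -
      \<comment> \<open>A nonzero form forces k to be even here, so the construction of the Poincare
        series applies.\<close>
      have "- mat 1 \<in> Gamma0 N" by (simp add: Gamma0_def)
      hence "even k" using that(3) cusp_forms_odd_trivial by blast
      thus ?thesis using automorphy_factor_Gamma0[OF k _ that(1)] by blast
    qed
  qed (use k power4 congruence_group_Gamma0 in auto)
  show "\<exists>c C :: real. c > 0 \<and> C > 0 \<and>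
             (\<forall>N::nat. N > 0 \<longrightarrow>
               (\<forall>B. orthonormal_basis (real k) (principal_congruence_subgroup N)
                      (cusp_forms_integral k (principal_congruence_subgroup N)) B \<longrightarrow>
                  basis_sup (real k) B \<le> ennreal C \<and>
                  (cusp_forms_integral k (principal_congruence_subgroup N) \<noteq> {\<lambda>z. 0} \<longrightarrow>
                     ennreal c \<le> basis_sup (real k) B)))"
    unfolding cusp_forms_integral_def half[symmetric]
  proof (rule uniform_basis_sup_bounds)
    show "\<exists>M h. automorphy_factor (principal_congruence_subgroup N) M (\<lambda>A z. denom A z ^ k) (2 * k) h N"
      if "N > 0" "N \<ge> 3" for N
      using automorphy_factor_principal[OF k that(2)] by blast
  qed (use k power4 congruence_group_principal in auto)
next
  fix j :: nat assume "odd j \<and> real j / 2 \<ge> 5 / 2"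
  hence j: "j > 4" by simp
  show "\<exists>c C :: real. c > 0 \<and> C > 0 \<and>
             (\<forall>N::nat. N > 0 \<and> squarefree N \<longrightarrow>
               (\<forall>B. orthonormal_basis (real j / 2) (Gamma0 (4 * N)) (cusp_forms_half_integral j N) B \<longrightarrow>
                  basis_sup (real j / 2) B \<le> ennreal C \<and>
                  (cusp_forms_half_integral j N \<noteq> {\<lambda>z. 0} \<longrightarrow>
                     ennreal c \<le> basis_sup (real j / 2) B)))"
    unfolding cusp_forms_half_integral_def
  proof (rule uniform_basis_sup_bounds[OF j])
    show "\<exists>M. congruence_group (Gamma0 (4 * N)) M" if "N > 0 \<and> squarefree N" for N
      using congruence_group_Gamma0[of "4 * N"] that by auto
    show "((theta (moebius_action G z) / theta z) ^ j) ^ 4 = denom G z ^ (2 * j)"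
      if "G \<in> Gamma0 (4 * N)" "Im z > 0" for N G z
      using theta_quotient_power4[OF _ that(2)] that(1) Gamma0_4_mult_subset by blast
    show "\<exists>M h. automorphy_factor (Gamma0 (4 * N)) M (\<lambda>A z. (theta (moebius_action A z) / theta z) ^ j) j h N"
      if "N > 0 \<and> squarefree N" "N \<ge> 1" for N
      using automorphy_factor_theta[OF j, of N] that(1) by blast
  qed
qed

end
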